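(* Assume that $H$ is bounded and of finite variation, that the function $u\mapsto H'(u-)(1-H(u-))^{-2}$ belongs to $\mathbf{L}^{1}$ (is integrable on every compact interval of $[0,\infty)$), and that there are a deterministic sequence $a_n\downarrow 0$ and stochastic processes $w,w^{1}$ in $\mathbf{D}[0,\infty)$ such that, as $n\to\infty$, $$\bigl(a_n^{-1}(H_n-H),\,a_n^{-1}(H_n^{1}-H^{1})\bigr)\stackrel{\mathcal L}{\rightarrow}(w,w^{1})$$ on $\mathbf{D}([0,\infty),\mathbf{R})\times\mathbf{D}([0,\infty),\mathbf{R})$. Then $$a_n^{-1}(\Lambda_n(t)-\Lambda(t))\stackrel{\mathcal L}{\rightarrow}\int_0^t\frac{1}{1-H(u-)}\,dw^{1}(u)+\int_0^t\frac{w(u)}{(1-H(u-))^{2}}\,dH^{1}(u),$$ as processes in $t$, on $\mathbf{D}[0,\infty)$, as $n\to\infty$.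
   Context: Data: $(t_i,\delta_i)$, $i=1,\dots,n$, where $t_i=\min(T_i,\tau_i)$ and $\delta_i=1_{\{T_i\le\tau_i\}}$. The $T_i\ge 0$ are lifetimes with distribution function $F(t)=P(T_i\le t)$, and the $\tau_i$ are censoring times with distribution function $G(t)=P(\tau_i\le t)$. The data form a stationary sequence (possibly dependent over $i$), and censoring is independent and noninformative; in particular the censoring times are independent of the lifetimes. Define $H(t)=P(t_i\le t)=1-(1-F(t))(1-G(t))$ and $H^{1}(t)=P(t_i\le t,\delta_i=1)$. It is assumed that $H^1(t)\to0$ and $H(t)-H^1(t)\to 0$ as $t\to 0$. The derivative of $H$ is denoted $H'$, and $f(u-)$ denotes the left-hand limit of $f$ at $u$. The empirical versions are $H_n(t)=\frac1n\sum_{i=1}^n 1_{\{t_i\le t\}}$ and $H_n^{1}(t)=\frac1n\sum_{i=1}^n\delta_i1_{\{t_i\le t\}}$. The Nelson-Aalen estimator is $\Lambda_n(t)=\int_0^t\frac{1}{1-H_n(u-)}\,dH_n^{1}(u)$, and the cumulative hazard function is $\Lambda(t)=\int_0^t\frac{1}{1-H(u-)}\,dH^{1}(u)$. $\mathbf{D}[0,\infty)=\mathbf{D}([0,\infty),\mathbf{R})$ is the space of cadlag functions on $[0,\infty)$ with the metric of uniform convergence on compact intervals and the $\sigma$-algebra generated by the closed balls. The product space carries the maximum of the two metrics. $\stackrel{\mathcal L}{\rightarrow}$ denotes weak convergence, i.e. convergence of expectations of bounded continuous functionals measurable for the given $\sigma$-algebra. The integral with respect to $w^{1}$ is understood through partial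 integration: $\int_0^t\frac{1}{1-H(u-)}\,dw^{1}(u)=\frac{w^{1}(t)}{1-H(t-)}-\frac{w^1(0)}{1-H(0-)}-\int_0^t\frac{H'(u-)}{(1-H(u-))^{2}}w^{1}(u)\,du$. *)

theory Defs
  imports "HOL-Probability.Probability"
begin

section \<open>Weak convergence with respect to the ball sigma-algebra\<close>

definition ball_algebra :: "'s metric \<Rightarrow> 's measure" where
  "ball_algebra m = sigma (mspace m) {mcball_of m x r | x r. x \<in> mspace m}"

text \<open>The test functionals have to be continuous for the metric \<open>m\<close> and measurable for the
  sigma-algebra \<open>A\<close>. On a non-separable space the second property is not a consequence of the first
  one: \<open>A\<close> may be smaller than the Borel sigma-algebra.\<close>

definition converges_weakly ::
  "'s metric \<Rightarrow> 's measure \<Rightarrow> 'a measure \<Rightarrow> (nat \<Rightarrow> 'a \<Rightarrow> 's) \<Rightarrow> 'b measure \<Rightarrow> ('b \<Rightarrow> 's) \<Rightarrow> bool"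
  where
  "converges_weakly m A M X N Y \<longleftrightarrow>
     (\<forall>n. X n \<in> M \<rightarrow>\<^sub>M A) \<and> Y \<in> N \<rightarrow>\<^sub>M A \<and>
     (\<forall>f :: 's \<Rightarrow> real.
        continuous_map (mtopology_of m) euclideanreal f \<and> bounded (f ` mspace m) \<and>
        f \<in> borel_measurable A \<longrightarrow>
        (\<lambda>n. \<integral>\<omega>. f (X n \<omega>) \<partial>M) \<longlonglongrightarrow> (\<integral>\<omega>. f (Y \<omega>) \<partial>N))"

definition max_metric :: "'s metric \<Rightarrow> 't metric \<Rightarrow> ('s \<times> 't) metric" where
  "max_metric m1 m2 =
     metric (mspace m1 \<times> mspace m2,
             \<lambda>p q. max (mdist m1 (fst p) (fst q)) (mdist m2 (snd p) (snd q)))"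

lemma Metric_space_max:
  "Metric_space (mspace m1 \<times> mspace m2)
     (\<lambda>p q. max (mdist m1 (fst p) (fst q)) (mdist m2 (snd p) (snd q)))"
proof
  fix p q r assume "p \<in> mspace m1 \<times> mspace m2" "q \<in> mspace m1 \<times> mspace m2" "r \<in> mspace m1 \<times> mspace m2"
  then have "mdist m1 (fst p) (fst r) \<le> mdist m1 (fst p) (fst q) + mdist m1 (fst q) (fst r)"
    and "mdist m2 (snd p) (snd r) \<le> mdist m2 (snd p) (snd q) + mdist m2 (snd q) (snd r)"
    by (auto intro!: mdist_triangle)
  then show "max (mdist m1 (fst p) (fst r)) (mdist m2 (snd p) (snd r))
     \<le> max (mdist m1 (fst p) (fst q)) (mdist m2 (snd p) (snd q))
      + max (mdist m1 (fst q) (fst r)) (mdist m2 (snd q) (snd r))"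
    by linarith
next
  fix p q assume *: "p \<in> mspace m1 \<times> mspace m2" "q \<in> mspace m1 \<times> mspace m2"
  have "mdist m1 (fst p) (fst q) \<ge> 0" "mdist m2 (snd p) (snd q) \<ge> 0" by simp_all
  then have "max (mdist m1 (fst p) (fst q)) (mdist m2 (snd p) (snd q)) = 0 \<longleftrightarrow>
    mdist m1 (fst p) (fst q) = 0 \<and> mdist m2 (snd p) (snd q) = 0" by linarith
  with * show "max (mdist m1 (fst p) (fst q)) (mdist m2 (snd p) (snd q)) = 0 \<longleftrightarrow> p = q"
    by (auto simp: prod_eq_iff mem_Times_iff)
qed (simp_all add: mdist_commute le_max_iff_disj)


section \<open>The space of cadlag functions on the half-line\<close>

text \<open>A function on the half-line is represented by a function on the reals which is
  \<open>undefined\<close> at negative arguments.\<close>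

definition cadlag :: "(real \<Rightarrow> real) set" where
  "cadlag = {x \<in> extensional {0..}.
     (\<forall>t\<ge>0. continuous (at_right t) x) \<and> (\<forall>t>0. \<exists>l. (x \<longlongrightarrow> l) (at_left t))}"

text \<open>The usual metric of uniform convergence on compact intervals is
  \<open>d(x, y) = (\<Sum>k\<ge>1. 2\<^sup>-\<^sup>k s\<^sub>k / (1 + s\<^sub>k))\<close>, where \<open>s\<^sub>k\<close> is the supremum of \<open>\<bar>x - y\<bar>\<close> over \<open>[0, k]\<close>.
  Because \<open>s / (1 + s)\<close> is continuous and increasing, it may be applied before the supremum is taken.
  The form below is meaningful for arbitrary (also unbounded) functions.

  Truncation, that is \<open>min 1 s\<^sub>k\<close> in place of \<open>s\<^sub>k / (1 + s\<^sub>k)\<close>, would give the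
  same topology but a smaller ball sigma-algebra, for which the evaluations \<open>x \<mapsto> x t\<close> are not measurable.\<close>

definition sup_dist_on :: "real \<Rightarrow> (real \<Rightarrow> real) \<Rightarrow> (real \<Rightarrow> real) \<Rightarrow> real" where
  "sup_dist_on b x y = (SUP t\<in>{0..b}. \<bar>x t - y t\<bar> / (1 + \<bar>x t - y t\<bar>))"

definition cadlag_dist :: "(real \<Rightarrow> real) \<Rightarrow> (real \<Rightarrow> real) \<Rightarrow> real" where
  "cadlag_dist x y = (\<Sum>k. (1/2) ^ Suc k * sup_dist_on (real (Suc k)) x y)"

definition cadlag_metric :: "(real \<Rightarrow> real) metric" where
  "cadlag_metric = metric (cadlag, cadlag_dist)"

lemma bdd_sup_dist: "bdd_above ((\<lambda>t. \<bar>x t - y t\<bar> / (1 + \<bar>x t - y t\<bar>)) ` {0..b::real})"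
  for x y :: "real \<Rightarrow> real"
  by (rule bdd_aboveI[of _ 1]) (auto simp: divide_simps)

lemma sup_dist_on_upper:
  "t \<in> {0..b} \<Longrightarrow> \<bar>x t - y t\<bar> / (1 + \<bar>x t - y t\<bar>) \<le> sup_dist_on b x y"
  unfolding sup_dist_on_def by (rule cSUP_upper[OF _ bdd_sup_dist])

lemma sup_dist_on_least:
  "0 \<le> b \<Longrightarrow> (\<And>t. 0 \<le> t \<Longrightarrow> t \<le> b \<Longrightarrow> \<bar>x t - y t\<bar> / (1 + \<bar>x t - y t\<bar>) \<le> c) \<Longrightarrow> sup_dist_on b x y \<le> c"
  unfolding sup_dist_on_def by (rule cSUP_least) auto

lemma sup_dist_on_nonneg: "0 \<le> b \<Longrightarrow> 0 \<le> sup_dist_on b x y"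
  by (rule order_trans[OF _ sup_dist_on_upper[of 0]]) auto

lemma sup_dist_on_le_1: "0 \<le> b \<Longrightarrow> sup_dist_on b x y \<le> 1"
  by (rule sup_dist_on_least) (auto simp: divide_simps)

lemma sup_dist_on_commute: "sup_dist_on b x y = sup_dist_on b y x"
  unfolding sup_dist_on_def by (simp add: abs_minus_commute)

lemma sup_dist_on_triangle:
  assumes "0 \<le> b" shows "sup_dist_on b x z \<le> sup_dist_on b x y + sup_dist_on b y z"
proof (rule sup_dist_on_least[OF assms])
  fix t assume t: "0 \<le> t" "t \<le> b"
  define u v w where "u = \<bar>x t - y t\<bar>" and "v = \<bar>y t - z t\<bar>" and "w = \<bar>x t - z t\<bar>"
  have uvw: "0 \<le> u" "0 \<le> v" "0 \<le> w" "w \<le> u + v" unfolding u_def v_def w_def by auto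
  have "w / (1 + w) \<le> (u + v) / (1 + (u + v))" using uvw by (simp add: divide_simps algebra_simps)
  also have "\<dots> = u / (1 + (u + v)) + v / (1 + (u + v))" by (simp add: add_divide_distrib)
  also have "\<dots> \<le> u / (1 + u) + v / (1 + v)"
    using uvw by (intro add_mono divide_left_mono) auto
  also have "\<dots> \<le> sup_dist_on b x y + sup_dist_on b y z"
    unfolding u_def v_def by (intro add_mono sup_dist_on_upper) (use t in auto)
  finally show "\<bar>x t - z t\<bar> / (1 + \<bar>x t - z t\<bar>) \<le> sup_dist_on b x y + sup_dist_on b y z"
    by (simp add: w_def)
qed

lemma summable_cadlag_dist: "summable (\<lambda>k. (1/2) ^ Suc k * sup_dist_on (real (Suc k)) x y)"
proof (rule summable_comparison_test'[of "\<lambda>k. (1/2) ^ Suc k" 0])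
  show "summable (\<lambda>k. (1/2 :: real) ^ Suc k)"
    by (subst summable_Suc_iff) (simp add: summable_geometric)
  show "norm ((1/2) ^ Suc n * sup_dist_on (real (Suc n)) x y) \<le> (1/2) ^ Suc n" for n
    using sup_dist_on_nonneg[of "real (Suc n)" x y] sup_dist_on_le_1[of "real (Suc n)" x y]
    by (simp add: abs_mult mult_left_le)
qed

lemma cadlag_dist_term_le:
  "(1/2) ^ Suc k * sup_dist_on (real (Suc k)) x y \<le> cadlag_dist x y"
  unfolding cadlag_dist_def
  using sum_le_suminf[OF summable_cadlag_dist, of "{k}" x y] sup_dist_on_nonneg by simp

lemma Metric_space_cadlag: "Metric_space cadlag cadlag_dist"
proof
  show "0 \<le> cadlag_dist x y" for x y
    unfolding cadlag_dist_def
    by (intro suminf_nonneg summable_cadlag_dist mult_nonneg_nonneg sup_dist_on_nonneg) auto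
  show "cadlag_dist x y = cadlag_dist y x" for x y
    unfolding cadlag_dist_def by (simp add: sup_dist_on_commute[of _ x y])
  show "cadlag_dist x z \<le> cadlag_dist x y + cadlag_dist y z" for x y z
    unfolding cadlag_dist_def suminf_add[OF summable_cadlag_dist summable_cadlag_dist]
    by (intro suminf_le summable_add summable_cadlag_dist)
      (simp add: distrib_left[symmetric] sup_dist_on_triangle)
  fix x y assume xy: "x \<in> cadlag" "y \<in> cadlag"
  show "cadlag_dist x y = 0 \<longleftrightarrow> x = y"
  proof
    assume d: "cadlag_dist x y = 0"
    show "x = y"
    proof
      fix t
      show "x t = y t"
      proof (cases "0 \<le> t")
        case True
        obtain k where k: "t \<le> real (Suc k)" by (meson le_SucI nat_le_real_less of_nat_le_iff order_trans real_arch_simple)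
        have "(1/2) ^ Suc k * sup_dist_on (real (Suc k)) x y \<le> 0"
          using cadlag_dist_term_le[of k x y] d by simp
        moreover have "0 < (1/2 :: real) ^ Suc k" by simp
        ultimately have "sup_dist_on (real (Suc k)) x y \<le> 0"
          by (meson mult_pos_pos not_less)
        with sup_dist_on_upper[of t "real (Suc k)" x y] True k
        have "\<bar>x t - y t\<bar> / (1 + \<bar>x t - y t\<bar>) \<le> 0" by simp
        then show ?thesis by (auto simp: divide_le_0_iff)
      next
        case False
        with xy show ?thesis by (simp add: cadlag_def extensional_def)
      qed
    qed
  next
    assume "x = y"
    then show "cadlag_dist x y = 0" by (simp add: cadlag_dist_def sup_dist_on_def)
  qed
qed


lemma mspace_cadlag_metric [simp]: "mspace cadlag_metric = cadlag"
  and mdist_cadlag_metric [simp]: "mdist cadlag_metric = cadlag_dist"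
  unfolding cadlag_metric_def
  by (simp_all add: Metric_space.mspace_metric Metric_space.mdist_metric Metric_space_cadlag)

lemma limitin_cadlag_metric:
  "limitin (mtopology_of cadlag_metric) X x sequentially \<longleftrightarrow>
     x \<in> cadlag \<and> (\<forall>\<^sub>F n in sequentially. X n \<in> cadlag) \<and>
     (\<forall>b. uniform_limit {0..b} X x sequentially)"
proof -
  interpret Metric_space cadlag cadlag_dist by (rule Metric_space_cadlag)
  have "(\<lambda>n. cadlag_dist (X n) x) \<longlonglongrightarrow> 0 \<longleftrightarrow> (\<forall>b. uniform_limit {0..b} X x sequentially)"
  proof
    assume lim: "(\<lambda>n. cadlag_dist (X n) x) \<longlonglongrightarrow> 0"
    show "\<forall>b. uniform_limit {0..b} X x sequentially"
    proof (intro allI uniform_limitI)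
      fix b e :: real assume e: "0 < e"
      obtain k where k: "b \<le> real (Suc k)"
        by (metis le_SucI of_nat_le_iff order_trans real_arch_simple)
      have "0 < (1/2) ^ Suc k * (e / (1 + e))" using e by simp
      with lim have "\<forall>\<^sub>F n in sequentially. cadlag_dist (X n) x < (1/2) ^ Suc k * (e / (1 + e))"
        by (rule order_tendstoD)
      then show "\<forall>\<^sub>F n in sequentially. \<forall>t\<in>{0..b}. dist (X n t) (x t) < e"
      proof eventually_elim
        case (elim n)
        then have "(1/2) ^ Suc k * sup_dist_on (real (Suc k)) (X n) x < (1/2) ^ Suc k * (e / (1 + e))"
          using cadlag_dist_term_le[of k "X n" x] by linarith
        then have s: "sup_dist_on (real (Suc k)) (X n) x < e / (1 + e)"
          by (rule mult_left_less_imp_less) simp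
        show ?case
        proof
          fix t assume "t \<in> {0..b}"
          then have "\<bar>X n t - x t\<bar> / (1 + \<bar>X n t - x t\<bar>) < e / (1 + e)"
            using sup_dist_on_upper[of t "real (Suc k)" "X n" x] s k by simp
          then show "dist (X n t) (x t) < e"
            using e by (simp add: dist_real_def field_simps)
        qed
      qed
    qed
  next
    assume lim: "\<forall>b. uniform_limit {0..b} X x sequentially"
    have s: "(\<lambda>n. sup_dist_on (real (Suc k)) (X n) x) \<longlonglongrightarrow> 0" for k
    proof (rule tendstoI)
      fix e :: real assume e: "0 < e"
      have "uniform_limit {0..real (Suc k)} X x sequentially" using lim by blast
      then have "\<forall>\<^sub>F n in sequentially. \<forall>t\<in>{0..real (Suc k)}. dist (X n t) (x t) < e / 2"
        by (rule uniform_limitD) (use e in simp)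
      then show "\<forall>\<^sub>F n in sequentially. dist (sup_dist_on (real (Suc k)) (X n) x) 0 < e"
      proof eventually_elim
        case (elim n)
        have "sup_dist_on (real (Suc k)) (X n) x \<le> e / 2"
        proof (rule sup_dist_on_least)
          fix t assume "0 \<le> t" "t \<le> real (Suc k)"
          with elim have "\<bar>X n t - x t\<bar> < e / 2" by (auto simp: dist_real_def)
          moreover have "\<bar>X n t - x t\<bar> / (1 + \<bar>X n t - x t\<bar>) \<le> \<bar>X n t - x t\<bar>"
            using divide_left_mono[of 1 "1 + \<bar>X n t - x t\<bar>" "\<bar>X n t - x t\<bar>"] by simp
          ultimately show "\<bar>X n t - x t\<bar> / (1 + \<bar>X n t - x t\<bar>) \<le> e / 2" by linarith
        qed simp
        with sup_dist_on_nonneg[of "real (Suc k)" "X n" x] e show ?case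
          by (simp add: dist_real_def)
      qed
    qed
    have "(\<lambda>n. \<Sum>k. (1/2) ^ Suc k * sup_dist_on (real (Suc k)) (X n) x) \<longlonglongrightarrow> (\<Sum>k. 0)"
    proof (rule tannerys_theorem[THEN conjunct2, THEN conjunct2])
      show "(\<lambda>n. (1/2) ^ Suc k * sup_dist_on (real (Suc k)) (X n) x) \<longlonglongrightarrow> 0" for k
        by (intro tendsto_mult_right_zero s)
      show "\<forall>\<^sub>F (k, n) in sequentially \<times>\<^sub>F sequentially.
          norm ((1/2) ^ Suc k * sup_dist_on (real (Suc k)) (X n) x) \<le> (1/2) ^ Suc k"
      proof (rule always_eventually, rule allI)
        fix p :: "nat \<times> nat"
        have "norm ((1/2) ^ Suc k * sup_dist_on (real (Suc k)) (X n) x) \<le> (1/2) ^ Suc k" for k n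
          using sup_dist_on_nonneg[of "real (Suc k)" "X n" x] sup_dist_on_le_1[of "real (Suc k)" "X n" x]
          by (simp add: abs_mult mult_left_le)
        then show "case p of (k, n) \<Rightarrow>
            norm ((1/2) ^ Suc k * sup_dist_on (real (Suc k)) (X n) x) \<le> (1/2) ^ Suc k"
          by (simp split: prod.split)
      qed
      show "summable (\<lambda>k. (1/2 :: real) ^ Suc k)"
        by (subst summable_Suc_iff) (simp add: summable_geometric)
    qed simp
    then show "(\<lambda>n. cadlag_dist (X n) x) \<longlonglongrightarrow> 0" by (simp add: cadlag_dist_def)
  qed
  then show ?thesis
    by (simp add: cadlag_metric_def limitin_metric_dist_null)
qed

section \<open>Left-hand limits and finite variation\<close>

definition left_lim :: "(real \<Rightarrow> real) \<Rightarrow> real \<Rightarrow> real" where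
  "left_lim f u = Lim (at_left u) f"

text \<open>The left-hand limit of the derivative, taken along the points at which the derivative exists
  (elsewhere \<open>deriv\<close> has an unspecified value).\<close>

definition diff_left :: "(real \<Rightarrow> real) \<Rightarrow> real \<Rightarrow> real filter" where
  "diff_left f u = at u within {s. s < u \<and> f differentiable at s}"

definition deriv_left_lim :: "(real \<Rightarrow> real) \<Rightarrow> real \<Rightarrow> real" where
  "deriv_left_lim f u = Lim (diff_left f u) (deriv f)"

definition finite_variation_on :: "real set \<Rightarrow> (real \<Rightarrow> real) \<Rightarrow> bool" where
  "finite_variation_on S f \<longleftrightarrow>
     (\<exists>B. \<forall>(s :: nat \<Rightarrow> real) n. mono_on {..n} s \<and> s ` {..n} \<subseteq> S \<longrightarrow>
        (\<Sum>i<n. \<bar>f (s (Suc i)) - f (s i)\<bar>) \<le> B)"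


section \<open>Randomly censored data\<close>

text \<open>The data are indexed from 0, so that a sample of size \<open>n\<close> has the indices \<open>i < n\<close>.\<close>

definition obs_time :: "(nat \<Rightarrow> 'a \<Rightarrow> real) \<Rightarrow> (nat \<Rightarrow> 'a \<Rightarrow> real) \<Rightarrow> nat \<Rightarrow> 'a \<Rightarrow> real" where
  "obs_time T \<tau> i \<omega> = min (T i \<omega>) (\<tau> i \<omega>)"

definition uncensored :: "(nat \<Rightarrow> 'a \<Rightarrow> real) \<Rightarrow> (nat \<Rightarrow> 'a \<Rightarrow> real) \<Rightarrow> nat \<Rightarrow> 'a \<Rightarrow> bool" where
  "uncensored T \<tau> i \<omega> \<longleftrightarrow> T i \<omega> \<le> \<tau> i \<omega>"

locale random_censoring = prob_space M for M :: "'a measure" +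
  fixes T \<tau> :: "nat \<Rightarrow> 'a \<Rightarrow> real" and F G :: "real \<Rightarrow> real"
  assumes T_measurable: "\<And>i. T i \<in> borel_measurable M"
    and tau_measurable: "\<And>i. \<tau> i \<in> borel_measurable M"
    and T_nonneg: "\<And>i \<omega>. \<omega> \<in> space M \<Longrightarrow> 0 \<le> T i \<omega>"
    and T_cdf: "\<And>i s. F s = prob {\<omega> \<in> space M. T i \<omega> \<le> s}"
    and tau_cdf: "\<And>i s. G s = prob {\<omega> \<in> space M. \<tau> i \<omega> \<le> s}"
    and stationary_data:
      "distr M (\<Pi>\<^sub>M i\<in>UNIV. borel \<Otimes>\<^sub>M count_space UNIV)
         (\<lambda>\<omega> i. (obs_time T \<tau> i \<omega>, uncensored T \<tau> i \<omega>)) =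
       distr M (\<Pi>\<^sub>M i\<in>UNIV. borel \<Otimes>\<^sub>M count_space UNIV)
         (\<lambda>\<omega> i. (obs_time T \<tau> (Suc i) \<omega>, uncensored T \<tau> (Suc i) \<omega>))"
    and independent_censoring:
      "indep_var (\<Pi>\<^sub>M i\<in>UNIV. borel) (\<lambda>\<omega> i. T i \<omega>) (\<Pi>\<^sub>M i\<in>UNIV. borel) (\<lambda>\<omega> i. \<tau> i \<omega>)"

text \<open>By stationarity every index may replace 0 in the next two definitions.\<close>

definition obs_cdf :: "'a measure \<Rightarrow> (nat \<Rightarrow> 'a \<Rightarrow> real) \<Rightarrow> (nat \<Rightarrow> 'a \<Rightarrow> real) \<Rightarrow> real \<Rightarrow> real" where
  "obs_cdf M T \<tau> s = measure M {\<omega> \<in> space M. obs_time T \<tau> 0 \<omega> \<le> s}"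

definition unc_cdf :: "'a measure \<Rightarrow> (nat \<Rightarrow> 'a \<Rightarrow> real) \<Rightarrow> (nat \<Rightarrow> 'a \<Rightarrow> real) \<Rightarrow> real \<Rightarrow> real" where
  "unc_cdf M T \<tau> s = measure M {\<omega> \<in> space M. obs_time T \<tau> 0 \<omega> \<le> s \<and> uncensored T \<tau> 0 \<omega>}"

lemma (in random_censoring) obs_cdf_eq: "obs_cdf M T \<tau> s = 1 - (1 - F s) * (1 - G s)"
  and obs_cdf_any: "obs_cdf M T \<tau> s = prob {\<omega> \<in> space M. obs_time T \<tau> i \<omega> \<le> s}"
proof -
  have *: "prob {\<omega> \<in> space M. obs_time T \<tau> i \<omega> \<le> s} = 1 - (1 - F s) * (1 - G s)" for i
  proof -
    note [measurable] = T_measurable tau_measurable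
    define A where "A = {x \<in> space (\<Pi>\<^sub>M i\<in>(UNIV::nat set). (borel :: real measure)). s < x i}"
    have A: "A \<in> sets (\<Pi>\<^sub>M i\<in>(UNIV::nat set). (borel :: real measure))"
      unfolding A_def by measurable
    have "prob ((\<lambda>\<omega>. (\<lambda>i. T i \<omega>, \<lambda>i. \<tau> i \<omega>)) -` (A \<times> A) \<inter> space M) =
        prob ((\<lambda>\<omega> i. T i \<omega>) -` A \<inter> space M) * prob ((\<lambda>\<omega> i. \<tau> i \<omega>) -` A \<inter> space M)"
      by (rule indep_varD[OF independent_censoring A A])
    also have "(\<lambda>\<omega>. (\<lambda>i. T i \<omega>, \<lambda>i. \<tau> i \<omega>)) -` (A \<times> A) \<inter> space M =
        {\<omega> \<in> space M. \<not> obs_time T \<tau> i \<omega> \<le> s}"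
      by (auto simp: obs_time_def space_PiM A_def)
    also have "(\<lambda>\<omega> i. T i \<omega>) -` A \<inter> space M = {\<omega> \<in> space M. \<not> T i \<omega> \<le> s}"
      by (auto simp: space_PiM A_def)
    also have "(\<lambda>\<omega> i. \<tau> i \<omega>) -` A \<inter> space M = {\<omega> \<in> space M. \<not> \<tau> i \<omega> \<le> s}"
      by (auto simp: space_PiM A_def)
    finally show ?thesis
      by (simp add: prob_neg T_cdf[of _ i] tau_cdf[of _ i] obs_time_def)
  qed
  show "obs_cdf M T \<tau> s = 1 - (1 - F s) * (1 - G s)"
    using *[of 0] by (simp add: obs_cdf_def)
  then show "obs_cdf M T \<tau> s = prob {\<omega> \<in> space M. obs_time T \<tau> i \<omega> \<le> s}"
    using *[of i] by simp
qed

definition emp_cdf ::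
  "(nat \<Rightarrow> 'a \<Rightarrow> real) \<Rightarrow> (nat \<Rightarrow> 'a \<Rightarrow> real) \<Rightarrow> nat \<Rightarrow> 'a \<Rightarrow> real \<Rightarrow> real" where
  "emp_cdf T \<tau> n \<omega> s = (1 / real n) * (\<Sum>i<n. of_bool (obs_time T \<tau> i \<omega> \<le> s))"

definition emp_unc_cdf ::
  "(nat \<Rightarrow> 'a \<Rightarrow> real) \<Rightarrow> (nat \<Rightarrow> 'a \<Rightarrow> real) \<Rightarrow> nat \<Rightarrow> 'a \<Rightarrow> real \<Rightarrow> real" where
  "emp_unc_cdf T \<tau> n \<omega> s =
     (1 / real n) * (\<Sum>i<n. of_bool (uncensored T \<tau> i \<omega>) * of_bool (obs_time T \<tau> i \<omega> \<le> s))"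


section \<open>Cumulative hazard and Nelson-Aalen estimator\<close>

text \<open>The integral of \<open>1 / (1 - K(u-))\<close> with respect to \<open>dK1(u)\<close> over \<open>(0, t]\<close>, for a nondecreasing
  right-continuous \<open>K1\<close>. The convention \<open>1 / 0 = 0\<close> is never relevant for an empirical pair, since
  \<open>K(u-) < 1\<close> at each jump of \<open>K1\<close>.\<close>

definition cum_hazard :: "(real \<Rightarrow> real) \<Rightarrow> (real \<Rightarrow> real) \<Rightarrow> real \<Rightarrow> real" where
  "cum_hazard K K1 t = (LINT u:{0<..t}|interval_measure K1. 1 / (1 - left_lim K u))"

definition nelson_aalen ::
  "(nat \<Rightarrow> 'a \<Rightarrow> real) \<Rightarrow> (nat \<Rightarrow> 'a \<Rightarrow> real) \<Rightarrow> nat \<Rightarrow> 'a \<Rightarrow> real \<Rightarrow> real" where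
  "nelson_aalen T \<tau> n \<omega> = cum_hazard (emp_cdf T \<tau> n \<omega>) (emp_unc_cdf T \<tau> n \<omega>)"

text \<open>The integral of \<open>1 / (1 - H(u-))\<close> with respect to \<open>dv(u)\<close> for a cadlag function \<open>v\<close> that need not be
  of finite variation: it is defined by partial integration.\<close>

definition hazard_integral :: "(real \<Rightarrow> real) \<Rightarrow> (real \<Rightarrow> real) \<Rightarrow> real \<Rightarrow> real" where
  "hazard_integral H v t =
     v t / (1 - left_lim H t) - v 0 / (1 - left_lim H 0)
     - (LINT u:{0..t}|lebesgue. deriv_left_lim H u / (1 - left_lim H u)\<^sup>2 * v u)"

end

theory Submission
  imports Defs
begin

text \<open>Put \<open>g = 1 / (1 - H)\<close>. Writing \<open>H\<^sub>n = H + a\<^sub>n x\<close> and \<open>H\<^sub>n\<^sup>1 = H\<^sup>1 + a\<^sub>n x\<^sup>1\<close>, the normalised estimator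
  is \<open>\<integral> g dx\<^sup>1 + \<integral> p\<^sub>n dH\<^sup>1 + \<integral> p\<^sub>n d(a\<^sub>n x\<^sup>1)\<close>, where \<open>p\<^sub>n\<close> tends to \<open>x g\<^sup>2\<close> uniformly when \<open>x\<close> converges.
  The first two terms give the limit. In the third one a cadlag function is integrated against a
  function that tends to zero uniformly and has bounded variation, so it vanishes by summation by parts
  after the integrand has been approximated by a difference of monotone functions.

  Since the limit is not assumed to be concentrated on a separable set and only ball-measurable
  functionals may be tested, neither Slutsky's lemma nor an almost sure representation is available.
  Instead, the functionals \<open>D\<^sub>n\<close> measuring the difference between the \<open>n\<close>-th functional and its limit are
  made continuous and measurable on the whole space, with a cutoff where the variation of the path is
  large. They satisfy \<open>D\<^sub>n(x\<^sub>n) \<rightarrow> 0\<close> along every convergent sequence \<open>x\<^sub>n\<close>, so the tail sums \<open>\<Sum>\<^bsub>n \<ge> j\<^esub> max 0 (D\<^sub>n - \<epsilon>)\<close> are locally finite, and hence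
  their truncations are themselves admissible test functionals, which decrease to zero as \<open>j\<close> grows.
  To define the estimator continuously on all pairs of cadlag functions, it is written as a
  left-endpoint Riemann sum: for a finite sample this is exact once the mesh is fine enough.\<close>

section \<open>Cadlag functions\<close>

text \<open>Two obstacles shape the functionals. For a general cadlag pair the Stieltjes integral
  defining the estimator makes no sense, whereas a Riemann sum of fixed mesh depends, on each
  bounded interval, on finitely many grid values and stopped paths; it is therefore continuous, and
  measurable because evaluations are ball-measurable. The price is that the fineness needed for
  exactness depends on the sample point. So the mesh \<open>m n\<close> is chosen for one fixed test
  functional at a time, such that the two expectations are close, and fine enough that the
  discretisation error of \<open>g\<close> integrated against \<open>H1\<close> stays small after
  division by \<open>a n\<close>. The second obstacle is that a general second path comes without a
  variation bound. The empirical function of uncensored observations is monotone with values in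
  \<open>[0, 1]\<close>, so a continuous cutoff that equals 1 up to variation 1 and vanishes from
  variation 2 on leaves the data untouched.\<close>

definition cadlag_fun :: "(real \<Rightarrow> real) \<Rightarrow> bool" where
  "cadlag_fun p \<longleftrightarrow> (\<forall>t\<ge>0. continuous (at_right t) p) \<and> (\<forall>t>0. \<exists>l. (p \<longlongrightarrow> l) (at_left t))"

text \<open>Separating \<open>extensional\<close> from the path property lets sums, products and
  integrals be formed on the whole line; restriction to the half-line is postponed to the
  end.\<close>

lemma cadlag_iff: "x \<in> cadlag \<longleftrightarrow> x \<in> extensional {0..} \<and> cadlag_fun x"
  by (auto simp: cadlag_def cadlag_fun_def)

lemma cadlag_fun_cong:
  assumes p: "cadlag_fun p" and eq: "\<And>t. 0 \<le> t \<Longrightarrow> p t = q t"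
  shows "cadlag_fun q"
  unfolding cadlag_fun_def
proof (intro conjI allI impI)
  fix t :: real assume t: "0 \<le> t"
  then have "(p \<longlongrightarrow> p t) (at_right t)" using p by (simp add: cadlag_fun_def continuous_within)
  moreover have "\<forall>\<^sub>F u in at_right t. p u = q u"
    using eventually_at_right_less[of t] by eventually_elim (use t eq in auto)
  ultimately have "(q \<longlongrightarrow> p t) (at_right t)" by (rule Lim_transform_eventually)
  then show "continuous (at_right t) q" using t eq by (simp add: continuous_within)
next
  fix t :: real assume t: "0 < t"
  then obtain l where "(p \<longlongrightarrow> l) (at_left t)" using p by (auto simp: cadlag_fun_def)
  moreover have "\<forall>\<^sub>F u in at_left t. p u = q u"
    using eventually_at_left_real[OF t] by eventually_elim (use eq in auto)
  ultimately show "\<exists>l. (q \<longlongrightarrow> l) (at_left t)" by (blast intro: Lim_transform_eventually)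
qed

lemma restrict_cadlag: "cadlag_fun p \<Longrightarrow> restrict p {0..} \<in> cadlag"
  by (auto simp: cadlag_iff intro: cadlag_fun_cong)

lemma cadlag_fun_continuous: "continuous_on UNIV p \<Longrightarrow> cadlag_fun p"
  by (auto simp: cadlag_fun_def continuous_on_def continuous_within
      intro: tendsto_within_subset[where S = UNIV])

lemma cadlag_fun_const [simp]: "cadlag_fun (\<lambda>_. c)"
  by (rule cadlag_fun_continuous) simp

lemma cadlag_fun_binop:
  assumes p: "cadlag_fun p" and q: "cadlag_fun q"
    and f: "\<And>F a b u v. (u \<longlongrightarrow> a) F \<Longrightarrow> (v \<longlongrightarrow> b) F \<Longrightarrow> ((\<lambda>t. f (u t) (v t)) \<longlongrightarrow> f a b) (F :: real filter)"
  shows "cadlag_fun (\<lambda>t. f (p t) (q t))"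
  using p q unfolding cadlag_fun_def continuous_within by (blast intro: f)

lemma cadlag_fun_add: "cadlag_fun p \<Longrightarrow> cadlag_fun q \<Longrightarrow> cadlag_fun (\<lambda>t. p t + q t)"
  and cadlag_fun_diff: "cadlag_fun p \<Longrightarrow> cadlag_fun q \<Longrightarrow> cadlag_fun (\<lambda>t. p t - q t)"
  and cadlag_fun_mult: "cadlag_fun p \<Longrightarrow> cadlag_fun q \<Longrightarrow> cadlag_fun (\<lambda>t. p t * q t)"
  by (erule (1) cadlag_fun_binop; intro tendsto_intros; assumption)+

lemma cadlag_fun_sum: "(\<And>i. i \<in> I \<Longrightarrow> cadlag_fun (p i)) \<Longrightarrow> cadlag_fun (\<lambda>t. \<Sum>i\<in>I. p i t)"
  by (induction I rule: infinite_finite_induct) (auto intro: cadlag_fun_add)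

text \<open>A Riemann sum, as a function of its upper limit, is a combination of stopped
  integrators, so this is what makes it cadlag.\<close>

lemma cadlag_fun_stop:
  assumes p: "cadlag_fun p" and c: "0 \<le> c"
  shows "cadlag_fun (\<lambda>t. p (min t c))"
  unfolding cadlag_fun_def
proof (intro conjI allI impI)
  fix t :: real assume t: "0 \<le> t"
  show "continuous (at_right t) (\<lambda>t. p (min t c))"
  proof (cases "t < c")
    case True
    have "(p \<longlongrightarrow> p t) (at_right t)" using p t by (simp add: cadlag_fun_def continuous_within)
    moreover have "\<forall>\<^sub>F u in at_right t. p u = p (min u c)"
      using eventually_at_right_real[OF True] by eventually_elim (auto simp: min_def)
    ultimately have "((\<lambda>u. p (min u c)) \<longlongrightarrow> p t) (at_right t)" by (rule Lim_transform_eventually)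
    then show ?thesis using True by (simp add: continuous_within)
  next
    case False
    have "\<forall>\<^sub>F u in at_right t. p (min u c) = p c"
      using eventually_at_right_less[of t] by eventually_elim (use False in \<open>auto simp: min_def\<close>)
    then have "((\<lambda>u. p (min u c)) \<longlongrightarrow> p c) (at_right t)" by (rule tendsto_eventually)
    then show ?thesis using False by (simp add: continuous_within min_absorb2)
  qed
next
  fix t :: real assume t: "0 < t"
  show "\<exists>l. ((\<lambda>t. p (min t c)) \<longlongrightarrow> l) (at_left t)"
  proof (cases "t \<le> c")
    case True
    obtain l where "(p \<longlongrightarrow> l) (at_left t)" using p t by (auto simp: cadlag_fun_def)
    moreover have "\<forall>\<^sub>F u in at_left t. p u = p (min u c)"
      using eventually_at_left_real[OF t] by eventually_elim (use True in \<open>auto simp: min_def\<close>)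
    ultimately show ?thesis by (blast intro: Lim_transform_eventually)
  next
    case False
    then have "c < t" by simp
    have "\<forall>\<^sub>F u in at_left t. p (min u c) = p c"
      using eventually_at_left_real[OF \<open>c < t\<close>] by eventually_elim (auto simp: min_def)
    then show ?thesis by (blast intro: tendsto_eventually)
  qed
qed

lemma cadlag_fun_step: "cadlag_fun (\<lambda>t. if a \<le> t then c else d)"
  unfolding cadlag_fun_def
proof (intro conjI allI impI)
  fix t :: real
  show "continuous (at_right t) (\<lambda>t. if a \<le> t then c else d)"
  proof (cases "a \<le> t")
    case True
    have "\<forall>\<^sub>F u in at_right t. (if a \<le> u then c else d) = c"
      using eventually_at_right_less[of t] by eventually_elim (use True in auto)
    then show ?thesis using True unfolding continuous_within by (auto intro: tendsto_eventually)
  next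
    case False
    then have "t < a" by simp
    have "\<forall>\<^sub>F u in at_right t. (if a \<le> u then c else d) = d"
      using eventually_at_right_real[OF \<open>t < a\<close>] by eventually_elim auto
    then show ?thesis using False unfolding continuous_within by (auto intro: tendsto_eventually)
  qed
  show "\<exists>l. ((\<lambda>t. if a \<le> t then c else d) \<longlongrightarrow> l) (at_left t)"
  proof (cases "a < t")
    case True
    have "\<forall>\<^sub>F u in at_left t. (if a \<le> u then c else d) = c"
      using eventually_at_left_real[OF True] by eventually_elim auto
    then show ?thesis by (blast intro: tendsto_eventually)
  next
    case False
    have "t - 1 < t" by simp
    have "\<forall>\<^sub>F u in at_left t. (if a \<le> u then c else d) = d"
      using eventually_at_left_real[OF \<open>t - 1 < t\<close>] by eventually_elim (use False in auto)
    then show ?thesis by (blast intro: tendsto_eventually)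
  qed
qed

text \<open>By right continuity \<open>p u\<close> is the limit of the values at lattice points
  strictly to the right of \<open>u\<close>. Each approximant factors through an integer, hence is
  measurable whatever \<open>p\<close> is.\<close>

lemma cadlag_fun_measurable:
  assumes "cadlag_fun p"
  shows "(\<lambda>u. indicator {0..} u * p u) \<in> borel_measurable borel"
proof (rule borel_measurable_LIMSEQ_real)
  let ?r = "\<lambda>m u. (real_of_int \<lfloor>u * real (Suc m)\<rfloor> + 1) / real (Suc m)"
  show "(\<lambda>u. indicator {0..} u * p (?r m u)) \<in> borel_measurable borel" for m
  proof -
    have "(\<lambda>u. \<lfloor>u * real (Suc m)\<rfloor>) \<in> borel \<rightarrow>\<^sub>M count_space UNIV" by measurable
    then have "(\<lambda>u. (\<lambda>k. p ((real_of_int k + 1) / real (Suc m))) \<lfloor>u * real (Suc m)\<rfloor>) \<in> borel_measurable borel"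
      by (rule measurable_compose) simp
    then show ?thesis by measurable
  qed
  fix u :: real
  show "(\<lambda>m. indicator {0..} u * p (?r m u)) \<longlonglongrightarrow> indicator {0..} u * p u"
  proof (cases "0 \<le> u")
    case True
    have gt: "u < ?r m u" for m
      by (simp add: pos_less_divide_eq)
    have le: "?r m u \<le> u + 1 / real (Suc m)" for m
      using of_int_floor_le[of "u * real (Suc m)"]
      by (simp add: add_divide_distrib pos_divide_le_eq del: of_nat_Suc)
    have "(\<lambda>m. ?r m u) \<longlonglongrightarrow> u"
    proof (rule tendsto_sandwich[of "\<lambda>_. u" _ _ "\<lambda>m. u + 1 / real (Suc m)"])
      show "(\<lambda>m. u + 1 / real (Suc m)) \<longlonglongrightarrow> u"
        using tendsto_add[OF tendsto_const[of u] lim_1_over_n[THEN LIMSEQ_Suc]] by simp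
    qed (use gt le in \<open>auto intro!: always_eventually less_imp_le\<close>)
    moreover have "\<forall>\<^sub>F m in sequentially. ?r m u \<in> {u<..} \<and> ?r m u \<noteq> u"
      by (rule always_eventually) (metis gt greaterThan_iff less_irrefl)
    ultimately have "filterlim (\<lambda>m. ?r m u) (at_right u) sequentially"
      unfolding filterlim_at by blast
    moreover have "(p \<longlongrightarrow> p u) (at_right u)"
      using assms True by (simp add: cadlag_fun_def continuous_within)
    ultimately have "(\<lambda>m. p (?r m u)) \<longlonglongrightarrow> p u" by (rule filterlim_compose[rotated])
    then show ?thesis by (intro tendsto_intros)
  qed simp
qed

text \<open>Bisection: the property passes to adjacent intervals by gluing, and near each point the
  one-sided limits make \<open>p\<close> uniformly close to a function with a single jump.\<close>

lemma cadlag_fun_approx: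
  assumes p: "cadlag_fun p" and e: "0 < e" and b: "0 \<le> b"
  shows "\<exists>q1 q2. mono q1 \<and> mono q2 \<and> (\<forall>t\<in>{0..b}. \<bar>p t - (q1 t - q2 t)\<bar> \<le> e)"
proof -
  \<comment> \<open>The condition \<open>0 \<le> t\<close> is part of \<open>P\<close> because the
    local step of \<open>Bolzano\<close> also considers intervals reaching below 0.\<close>
  define P where "P c d \<longleftrightarrow> (\<exists>q1 q2. mono q1 \<and> mono q2 \<and>
    (\<forall>t. c \<le> t \<and> t \<le> d \<and> 0 \<le> t \<longrightarrow> \<bar>p t - (q1 t - q2 t)\<bar> \<le> e))" for c d
  have "P 0 b" using b
  proof (induction rule: Bolzano)
    case (trans c d f)
    obtain q1 q2 where q: "mono q1" "mono q2" "\<And>t. c \<le> t \<and> t \<le> d \<and> 0 \<le> t \<Longrightarrow> \<bar>p t - (q1 t - q2 t)\<bar> \<le> e"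
      using trans(1) unfolding P_def by blast
    obtain r1 r2 where r: "mono r1" "mono r2" "\<And>t. d \<le> t \<and> t \<le> f \<and> 0 \<le> t \<Longrightarrow> \<bar>p t - (r1 t - r2 t)\<bar> \<le> e"
      using trans(2) unfolding P_def by blast
    \<comment> \<open>The same constant is added to both right-hand pieces: it is large enough for
      both glued functions to increase, and it cancels in their difference.\<close>
    define C where "C = max (q1 d - r1 d) (q2 d - r2 d)"
    have C: "q1 d \<le> r1 d + C" "q2 d \<le> r2 d + C" by (auto simp: C_def)
    have glue: "mono (\<lambda>t. if t < d then u t else v t + C)"
      if "mono u" "mono v" "u d \<le> v d + C" for u v :: "real \<Rightarrow> real"
      using that by (auto simp: mono_def) (smt (verit, best))
    show ?case unfolding P_def
    proof (intro exI conjI allI impI)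
      show "mono (\<lambda>t. if t < d then q1 t else r1 t + C)" by (rule glue[OF q(1) r(1) C(1)])
      show "mono (\<lambda>t. if t < d then q2 t else r2 t + C)" by (rule glue[OF q(2) r(2) C(2)])
      fix t assume "c \<le> t \<and> t \<le> f \<and> 0 \<le> t"
      then show "\<bar>p t - ((if t < d then q1 t else r1 t + C) - (if t < d then q2 t else r2 t + C))\<bar> \<le> e"
        using q(3)[of t] r(3)[of t] by auto
    qed
  next
    case (local x)
    then have x: "0 \<le> x" by simp
    have "(p \<longlongrightarrow> p x) (at_right x)" using p x by (simp add: cadlag_fun_def continuous_within)
    then have "\<forall>\<^sub>F u in at_right x. dist (p u) (p x) < e" using e by (rule tendstoD)
    then obtain d1 where d1: "d1 > x" "\<And>u. x < u \<Longrightarrow> u < d1 \<Longrightarrow> \<bar>p u - p x\<bar> < e"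
      by (auto simp: eventually_at_right_field dist_real_def)
    obtain l d2 where d2: "d2 < x" "\<And>u. d2 < u \<Longrightarrow> u < x \<Longrightarrow> 0 \<le> u \<Longrightarrow> \<bar>p u - l\<bar> < e"
    proof (cases "x = 0")
      case True
      then show ?thesis using that[of "-1" 0] by simp
    next
      case False
      then have "0 < x" using x by simp
      then obtain l where "(p \<longlongrightarrow> l) (at_left x)" using p unfolding cadlag_fun_def by blast
      then have "\<forall>\<^sub>F u in at_left x. dist (p u) l < e" using e by (rule tendstoD)
      then show ?thesis using that[of _ l]
        by (auto simp: eventually_at_left_field dist_real_def)
    qed
    \<comment> \<open>The jump from the left limit \<open>l\<close> to \<open>p x\<close> is split
      by sign: an upward jump goes into \<open>q1\<close>, a downward one into
      \<open>q2\<close>.\<close>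
    define q1 where "q1 u = (if u < x then l else l + max 0 (p x - l))" for u
    define q2 where "q2 u = (if u < x then 0 else max 0 (l - p x))" for u
    have m: "mono q1" "mono q2" by (auto simp: mono_def q1_def q2_def)
    show ?case
    proof (intro exI[of _ "min (d1 - x) (x - d2)"] conjI allI impI)
      fix c d assume cd: "c \<le> x \<and> x \<le> d \<and> d - c < min (d1 - x) (x - d2)"
      show "P c d" unfolding P_def
      proof (intro exI conjI allI impI)
        fix t assume "c \<le> t \<and> t \<le> d \<and> 0 \<le> t"
        with cd d1(2)[of t] d2(2)[of t] e show "\<bar>p t - (q1 t - q2 t)\<bar> \<le> e"
          by (cases t x rule: linorder_cases) (auto simp: q1_def q2_def)
      qed (use m in auto)
    qed (use d1 d2 in auto)
  qed
  then obtain q1 q2 where "mono q1" "mono q2" "\<forall>t. 0 \<le> t \<and> t \<le> b \<and> 0 \<le> t \<longrightarrow> \<bar>p t - (q1 t - q2 t)\<bar> \<le> e"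
    unfolding P_def by blast
  then show ?thesis by (intro exI[of _ q1] exI[of _ q2]) auto
qed

lemma cadlag_fun_bounded:
  assumes p: "cadlag_fun p"
  obtains B where "0 \<le> B" "\<And>t. 0 \<le> t \<Longrightarrow> t \<le> b \<Longrightarrow> \<bar>p t\<bar> \<le> B"
proof (cases "0 \<le> b")
  case True
  obtain q1 q2 where q: "mono q1" "mono q2" "\<And>t. t \<in> {0..b} \<Longrightarrow> \<bar>p t - (q1 t - q2 t)\<bar> \<le> 1"
    using cadlag_fun_approx[OF p _ True, of 1] by auto
  show ?thesis
  proof (rule that[of "1 + \<bar>q1 0\<bar> + \<bar>q1 b\<bar> + \<bar>q2 0\<bar> + \<bar>q2 b\<bar>"])
    fix t assume t: "0 \<le> t" "t \<le> b"
    show "\<bar>p t\<bar> \<le> 1 + \<bar>q1 0\<bar> + \<bar>q1 b\<bar> + \<bar>q2 0\<bar> + \<bar>q2 b\<bar>"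
      using q(3)[of t] monoD[OF q(1) t(1)] monoD[OF q(1) t(2)] monoD[OF q(2) t(1)] monoD[OF q(2) t(2)] t
      by auto
  qed simp
qed (use that[of 0] in auto)

text \<open>\<open>Q\<close> is the sum \<open>q1 + q2\<close> for an approximation within
  \<open>e / 2\<close>. It replaces the variation of \<open>p\<close>, which may be infinite: up to
  \<open>e\<close>, oscillations are bounded by increments that telescope.\<close>

lemma cadlag_fun_modulus:
  assumes p: "cadlag_fun p" and e: "0 < e" and b: "0 \<le> b"
  shows "\<exists>Q. mono Q \<and> (\<forall>u v. 0 \<le> u \<and> u \<le> v \<and> v \<le> b \<longrightarrow> \<bar>p v - p u\<bar> \<le> e + (Q v - Q u))"
proof -
  obtain q1 q2 where q: "mono q1" "mono q2" "\<And>t. t \<in> {0..b} \<Longrightarrow> \<bar>p t - (q1 t - q2 t)\<bar> \<le> e / 2"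
    using cadlag_fun_approx[OF p _ b, of "e / 2"] e by auto
  show ?thesis
  proof (intro exI[of _ "\<lambda>t. q1 t + q2 t"] conjI allI impI)
    show "mono (\<lambda>t. q1 t + q2 t)" using q by (auto simp: mono_def intro: add_mono)
    fix u v assume uv: "0 \<le> u \<and> u \<le> v \<and> v \<le> b"
    have "q1 u \<le> q1 v" "q2 u \<le> q2 v" using q uv by (auto dest: monoD)
    then show "\<bar>p v - p u\<bar> \<le> e + (q1 v + q2 v - (q1 u + q2 u))"
      using q(3)[of u] q(3)[of v] uv unfolding atLeastAtMost_iff by linarith
  qed
qed

section \<open>Measurability with respect to the ball sigma-algebra\<close>

lemma space_ball_algebra [simp]: "space (ball_algebra cadlag_metric) = cadlag"
  unfolding ball_algebra_def by (subst space_measure_of) auto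

lemma sets_ball_algebra_mcball:
  "z \<in> cadlag \<Longrightarrow> mcball_of cadlag_metric z r \<in> sets (ball_algebra cadlag_metric)"
  unfolding ball_algebra_def by (subst sets_measure_of) auto

lemma mono_sigmoid:
  fixes a b :: real
  shows "0 \<le> a \<Longrightarrow> 0 \<le> b \<Longrightarrow> a / (1 + a) \<le> b / (1 + b) \<longleftrightarrow> a \<le> b"
  by (simp add: divide_simps algebra_simps)

text \<open>Right continuity transfers a strict excess at \<open>t\<close> to nearby rationals on
  the right. At the end \<open>b\<close> of the interval there is no room for this, so
  \<open>b\<close> is adjoined.\<close>

lemma sup_dist_on_countable:
  assumes x: "cadlag_fun x" and y: "cadlag_fun y" and b: "0 \<le> b"
  shows "sup_dist_on b x y = (SUP t\<in>insert b ({0..b} \<inter> \<rat>). \<bar>x t - y t\<bar> / (1 + \<bar>x t - y t\<bar>))"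
    (is "_ = ?S")
proof -
  let ?f = "\<lambda>t. \<bar>x t - y t\<bar> / (1 + \<bar>x t - y t\<bar>)"
  have bdd: "bdd_above (?f ` (insert b ({0..b} \<inter> \<rat>)))"
    by (rule bdd_above_mono[OF bdd_sup_dist[of x y b]]) (use b in auto)
  show ?thesis
  proof (rule antisym)
    show "sup_dist_on b x y \<le> ?S"
    proof (rule sup_dist_on_least[OF b])
      fix t assume t: "0 \<le> t" "t \<le> b"
      show "?f t \<le> ?S"
      proof (rule ccontr)
        assume "\<not> ?f t \<le> ?S"
        then have gt: "?S < ?f t" by simp
        then have "t \<noteq> b" using cSUP_upper[OF _ bdd, of b] by auto
        then have tb: "t < b" using t by simp
        have "(x \<longlongrightarrow> x t) (at_right t)" "(y \<longlongrightarrow> y t) (at_right t)"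
          using x y t by (auto simp: cadlag_fun_def continuous_within)
        then have "(?f \<longlongrightarrow> ?f t) (at_right t)" by (auto intro!: tendsto_intros)
        then have "\<forall>\<^sub>F u in at_right t. ?S < ?f u" using gt by (rule order_tendstoD)
        then obtain c where c: "t < c" "\<And>u. t < u \<Longrightarrow> u < c \<Longrightarrow> ?S < ?f u"
          by (auto simp: eventually_at_right_field)
        obtain r where r: "r \<in> \<rat>" "t < r" "r < min b c"
          using Rats_dense_in_real[of t "min b c"] c(1) tb by auto
        then have "?f r \<le> ?S" using t by (intro cSUP_upper[OF _ bdd]) auto
        then show False using c(2)[of r] r by auto
      qed
    qed
    show "?S \<le> sup_dist_on b x y"
      by (rule cSUP_least) (use b in \<open>auto intro!: sup_dist_on_upper\<close>)
  qed
qed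

text \<open>A ball is described by a series of countable suprema of functions of single evaluations.
  Together with the converse \<open>eval_measurable_ball_algebra\<close> this reduces measurability
  of path-valued maps to fixed times.\<close>

lemma measurable_into_ball_algebra:
  assumes f: "\<And>\<omega>. \<omega> \<in> space M \<Longrightarrow> f \<omega> \<in> cadlag"
    and ev: "\<And>t. 0 \<le> t \<Longrightarrow> (\<lambda>\<omega>. f \<omega> t) \<in> borel_measurable M"
  shows "f \<in> M \<rightarrow>\<^sub>M ball_algebra cadlag_metric"
proof -
  have s: "(\<lambda>\<omega>. sup_dist_on (real (Suc k)) z (f \<omega>)) \<in> borel_measurable M" if z: "z \<in> cadlag" for k z
  proof -
    have "(\<lambda>\<omega>. SUP t\<in>insert (real (Suc k)) ({0..real (Suc k)} \<inter> \<rat>). \<bar>z t - f \<omega> t\<bar> / (1 + \<bar>z t - f \<omega> t\<bar>))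
        \<in> borel_measurable M"
    proof (rule borel_measurable_cSUP)
      show "countable (insert (real (Suc k)) ({0..real (Suc k)} \<inter> \<rat>))"
        by (auto intro: countable_subset[OF _ countable_rat])
      show "bdd_above ((\<lambda>t. \<bar>z t - f \<omega> t\<bar> / (1 + \<bar>z t - f \<omega> t\<bar>)) ` insert (real (Suc k)) ({0..real (Suc k)} \<inter> \<rat>))" for \<omega>
        by (rule bdd_above_mono[OF bdd_sup_dist[of z "f \<omega>" "real (Suc k)"]]) auto
      fix t assume "t \<in> insert (real (Suc k)) ({0..real (Suc k)} \<inter> \<rat>)"
      then have [measurable]: "(\<lambda>\<omega>. f \<omega> t) \<in> borel_measurable M" by (intro ev) auto
      show "(\<lambda>\<omega>. \<bar>z t - f \<omega> t\<bar> / (1 + \<bar>z t - f \<omega> t\<bar>)) \<in> borel_measurable M" by measurable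
    qed
    then show ?thesis
      by (rule measurable_cong[THEN iffD1, rotated])
        (use f z in \<open>auto simp: cadlag_iff sup_dist_on_countable\<close>)
  qed
  show ?thesis unfolding ball_algebra_def
  proof (rule measurable_measure_of)
    fix B assume "B \<in> {mcball_of cadlag_metric x r |x r. x \<in> mspace cadlag_metric}"
    then obtain z r where z: "z \<in> cadlag" and B: "B = mcball_of cadlag_metric z r" by auto
    have [measurable]: "(\<lambda>\<omega>. cadlag_dist z (f \<omega>)) \<in> borel_measurable M"
      unfolding cadlag_dist_def using s[OF z] by measurable
    have "f -` B \<inter> space M = {\<omega> \<in> space M. cadlag_dist z (f \<omega>) \<le> r}"
      using f z by (auto simp: B)
    then show "f -` B \<inter> space M \<in> sets M" by simp
  qed (use f in auto)
qed

lemma cadlag_dist_measurable: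
  assumes "z \<in> cadlag" shows "cadlag_dist z \<in> borel_measurable (ball_algebra cadlag_metric)"
proof (subst borel_measurable_iff_le, intro allI)
  fix r
  have "{x \<in> space (ball_algebra cadlag_metric). cadlag_dist z x \<le> r} = mcball_of cadlag_metric z r"
    using assms by auto
  then show "{x \<in> space (ball_algebra cadlag_metric). cadlag_dist z x \<le> r} \<in> sets (ball_algebra cadlag_metric)"
    using sets_ball_algebra_mcball[OF assms] by simp
qed

text \<open>Letting the centre of a ball tend to infinity on \<open>[k + 1/2, \<infinity>)\<close> saturates all terms of the
  metric with index at least \<open>k\<close> and leaves the others unchanged.\<close>

lemma cadlag_dist_partial_measurable:
  assumes z: "z \<in> cadlag"
  shows "(\<lambda>x. \<Sum>j<k. (1/2) ^ Suc j * sup_dist_on (real (Suc j)) z x)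
    \<in> borel_measurable (ball_algebra cadlag_metric)"
proof -
  \<comment> \<open>Term \<open>j\<close> of the metric sees \<open>[0, j + 1]\<close>, which ends
    before \<open>c\<close> when \<open>j < k\<close> and contains \<open>c\<close> when
    \<open>j \<ge> k\<close>.\<close>
  define c where "c = real k + 1 / 2"
  define y where "y i = restrict (\<lambda>t. if t < c then z t else real i) {0..}" for i :: nat
  have y_eq: "y i t = (if t < c then z t else real i)" if "0 \<le> t" for i t
    using that by (simp add: y_def)
  have y: "y i \<in> cadlag" for i
  proof -
    have "cadlag_fun (\<lambda>t. z (min t c) + (real i - z c) * (if c \<le> t then 1 else 0))"
      by (rule cadlag_fun_add[OF cadlag_fun_stop[of z c] cadlag_fun_mult[OF cadlag_fun_const cadlag_fun_step]])
        (use z in \<open>auto simp: c_def cadlag_iff\<close>)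
    then have "cadlag_fun (y i)"
      by (rule cadlag_fun_cong) (simp add: y_eq min_def algebra_simps)
    then show ?thesis by (auto simp: cadlag_iff y_def)
  qed
  \<comment> \<open>The saturated tail contributes the geometric remainder \<open>(1/2) ^ k\<close>,
    which is subtracted at the end.\<close>
  have "(\<lambda>x. (\<Sum>j<k. (1/2) ^ Suc j * sup_dist_on (real (Suc j)) z x) + (1/2) ^ k)
    \<in> borel_measurable (ball_algebra cadlag_metric)"
  proof (rule borel_measurable_LIMSEQ_real)
    show "cadlag_dist (y i) \<in> borel_measurable (ball_algebra cadlag_metric)" for i
      by (rule cadlag_dist_measurable[OF y])
    fix x
    define P where "P = (\<Sum>j<k. (1/2) ^ Suc j * sup_dist_on (real (Suc j)) z x)"
    define s where "s i = \<bar>real i - x c\<bar> / (1 + \<bar>real i - x c\<bar>)" for i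
    have P_eq: "(\<Sum>j<k. (1/2) ^ Suc j * sup_dist_on (real (Suc j)) (y i) x) = P" for i
      unfolding P_def
    proof (intro sum.cong refl arg_cong2[of _ _ _ _ "(*)"])
      fix j assume j: "j \<in> {..<k}"
      show "sup_dist_on (real (Suc j)) (y i) x = sup_dist_on (real (Suc j)) z x"
        unfolding sup_dist_on_def
        by (rule SUP_cong) (use j in \<open>auto simp: y_eq c_def\<close>)
    qed
    have geo: "(\<lambda>j. (1/2 :: real) ^ Suc (j + k)) sums ((1/2) ^ k)"
      using sums_mult[OF power_half_series, of "(1/2) ^ k"] by (simp add: power_add mult_ac)
    have split: "cadlag_dist (y i) x = P + (\<Sum>j. (1/2) ^ Suc (j + k) * sup_dist_on (real (Suc (j + k))) (y i) x)" for i
      unfolding cadlag_dist_def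
      by (subst suminf_split_initial_segment[where k = k, OF summable_cadlag_dist]) (simp only: P_eq add.commute)
    have summ: "summable (\<lambda>j. (1/2) ^ Suc (j + k) * sup_dist_on (real (Suc (j + k))) (y i) x)" for i
      using summable_ignore_initial_segment[where k = k, OF summable_cadlag_dist] .
    have up: "cadlag_dist (y i) x \<le> P + (1/2) ^ k" for i
    proof -
      have "(\<Sum>j. (1/2) ^ Suc (j + k) * sup_dist_on (real (Suc (j + k))) (y i) x) \<le> (\<Sum>j. (1/2) ^ Suc (j + k))"
        by (intro suminf_le summ sums_summable[OF geo] mult_left_le sup_dist_on_le_1) auto
      then show ?thesis using split[of i] sums_unique[OF geo] by simp
    qed
    \<comment> \<open>The single point \<open>c\<close> suffices: the quotient there already tends
      to the maximal value 1.\<close>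
    have low: "P + (1/2) ^ k * s i \<le> cadlag_dist (y i) x" for i
    proof -
      have "(1/2) ^ k * s i = (\<Sum>j. (1/2) ^ Suc (j + k) * s i)"
        using sums_unique[OF sums_mult2[OF geo, of "s i"]] .
      also have "\<dots> \<le> (\<Sum>j. (1/2) ^ Suc (j + k) * sup_dist_on (real (Suc (j + k))) (y i) x)"
      proof (intro suminf_le summ sums_summable[OF sums_mult2[OF geo]] mult_left_mono)
        fix j
        have "y i c = real i" by (subst y_eq) (auto simp: c_def)
        then show "s i \<le> sup_dist_on (real (Suc (j + k))) (y i) x"
          using sup_dist_on_upper[of c "real (Suc (j + k))" "y i" x] by (auto simp: s_def c_def)
      qed auto
      finally show ?thesis using split[of i] by simp
    qed
    have "s \<longlonglongrightarrow> 1"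
    proof -
      have "s = (\<lambda>i. 1 - inverse (1 + \<bar>real i - x c\<bar>))"
        by (rule ext) (simp add: s_def field_simps add_nonneg_eq_0_iff)
      moreover have "filterlim (\<lambda>i. 1 + \<bar>real i - x c\<bar>) at_top sequentially"
        by (rule filterlim_at_top_mono[of "\<lambda>i. real i + (1 - x c)"])
          (auto intro!: filterlim_tendsto_add_at_top[OF tendsto_const, of _ _ "1 - x c", simplified add.commute] filterlim_real_sequentially always_eventually simp: add.commute)
      then have "(\<lambda>i. 1 - inverse (1 + \<bar>real i - x c\<bar>)) \<longlonglongrightarrow> 1 - 0"
        by (intro tendsto_intros tendsto_inverse_0_at_top)
      ultimately show ?thesis by simp
    qed
    then have lim: "(\<lambda>i. P + (1/2) ^ k * s i) \<longlonglongrightarrow> P + (1/2) ^ k * 1"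
      by (intro tendsto_add tendsto_mult tendsto_const)
    show "(\<lambda>i. cadlag_dist (y i) x) \<longlonglongrightarrow> P + (1/2) ^ k"
      by (rule tendsto_sandwich[OF always_eventually[OF allI[OF low]] always_eventually[OF allI[OF up]]])
        (use lim in \<open>simp_all only: mult_1_right tendsto_const\<close>)
  qed
  from borel_measurable_diff[OF this borel_measurable_const[of "(1/2) ^ k"]] show ?thesis
    by (simp only: add_diff_cancel_right')
qed

text \<open>Consecutive partial sums of the metric differ by one weighted term, so each supremum is
  recovered from them.\<close>

lemma sup_dist_on_measurable:
  assumes z: "z \<in> cadlag"
  shows "(\<lambda>x. sup_dist_on (real (Suc k)) z x) \<in> borel_measurable (ball_algebra cadlag_metric)"
proof -
  have "(\<lambda>x. 2 ^ Suc k * ((\<Sum>j<Suc k. (1/2) ^ Suc j * sup_dist_on (real (Suc j)) z x)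
      - (\<Sum>j<k. (1/2) ^ Suc j * sup_dist_on (real (Suc j)) z x))) \<in> borel_measurable (ball_algebra cadlag_metric)"
    by (intro borel_measurable_times borel_measurable_diff borel_measurable_const cadlag_dist_partial_measurable z)
  moreover have "2 ^ Suc k * ((1/2) ^ Suc k * s) = s" for s :: real
    by (simp add: power_divide)
  ultimately show ?thesis by (simp only: sum.lessThan_Suc add_diff_cancel_left')
qed

text \<open>A cadlag function exceeds \<open>c\<close> at \<open>t\<close> iff it lies within distance \<open>n\<close>, for some \<open>n\<close>, of the bump of
  height slightly more than \<open>c + n\<close> on a short interval to the right of \<open>t\<close>.\<close>

lemma eval_measurable_ball_algebra:
  assumes t: "0 \<le> t"
  shows "(\<lambda>x. x t) \<in> borel_measurable (ball_algebra cadlag_metric)"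
proof (subst borel_measurable_iff_greater, intro allI)
  fix c
  obtain k where k: "t \<le> real (Suc k)" by (metis le_SucI of_nat_le_iff order_trans real_arch_simple)
  define b where "b = real (Suc k)"
  \<comment> \<open>The extra \<open>1 / real (Suc n)\<close> turns the non-strict ball condition at
    \<open>t\<close> into the strict inequality \<open>c < x t\<close>.\<close>
  define h where "h n = c + real n + 1 / real (Suc n)" for n
  define z where "z n = restrict (\<lambda>u. (if t \<le> u then h n else 0) - (if t + 1 / real (Suc n) \<le> u then h n else 0)) {0..}" for n
  have z: "z n \<in> cadlag" for n
    unfolding z_def by (intro restrict_cadlag cadlag_fun_diff cadlag_fun_step)
  have z_eq: "z n u = (if t \<le> u \<and> u < t + 1 / real (Suc n) then h n else 0)" if "0 \<le> u" for n u
  proof -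
    have "u < t + 1 / real (Suc n)" if "u < t" using that by (rule less_trans) simp
    then show ?thesis using that by (auto simp: z_def)
  qed
  have dist_le: "sup_dist_on b (z n) x \<le> real n / (1 + real n) \<longleftrightarrow>
      (\<forall>u\<in>{0..b}. \<bar>z n u - x u\<bar> \<le> real n)" for n x
  proof
    assume *: "sup_dist_on b (z n) x \<le> real n / (1 + real n)"
    show "\<forall>u\<in>{0..b}. \<bar>z n u - x u\<bar> \<le> real n"
    proof
      fix u assume "u \<in> {0..b}"
      from order_trans[OF sup_dist_on_upper[OF this, of "z n" x] *]
      show "\<bar>z n u - x u\<bar> \<le> real n" by (simp add: mono_sigmoid)
    qed
  next
    assume "\<forall>u\<in>{0..b}. \<bar>z n u - x u\<bar> \<le> real n"
    then show "sup_dist_on b (z n) x \<le> real n / (1 + real n)"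
      by (intro sup_dist_on_least) (auto simp: mono_sigmoid b_def)
  qed
  have "{x \<in> space (ball_algebra cadlag_metric). c < x t} =
     (\<Union>n. {x \<in> space (ball_algebra cadlag_metric). sup_dist_on b (z n) x \<le> real n / (1 + real n)})"
    (is "?L = ?R")
  proof
    show "?R \<subseteq> ?L"
    proof clarify
      fix n x assume "sup_dist_on b (z n) x \<le> real n / (1 + real n)"
      then have "\<bar>z n t - x t\<bar> \<le> real n" using dist_le t k by (auto simp: b_def)
      moreover have "z n t = h n" using t by (simp add: z_eq)
      moreover have "0 < 1 / real (Suc n)" by simp
      ultimately show "c < x t" unfolding h_def by linarith
    qed
    show "?L \<subseteq> ?R"
    proof clarify
      fix x assume x: "x \<in> space (ball_algebra cadlag_metric)" "c < x t"
      then have cx: "cadlag_fun x" by (simp add: cadlag_iff)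
      obtain B where B: "0 \<le> B" "\<And>u. 0 \<le> u \<Longrightarrow> u \<le> b \<Longrightarrow> \<bar>x u\<bar> \<le> B"
        using cadlag_fun_bounded[OF cx, of b] by auto
      define \<eta> where "\<eta> = (x t - c) / 2"
      have \<eta>: "0 < \<eta>" "c + \<eta> < x t" using x(2) by (auto simp: \<eta>_def field_simps)
      have "(x \<longlongrightarrow> x t) (at_right t)" using cx t by (simp add: cadlag_fun_def continuous_within)
      then have "\<forall>\<^sub>F u in at_right t. c + \<eta> < x u" using \<eta>(2) by (rule order_tendstoD)
      then obtain d where d: "t < d" "\<And>u. t < u \<Longrightarrow> u < d \<Longrightarrow> c + \<eta> < x u"
        by (auto simp: eventually_at_right_field)
      \<comment> \<open>For large \<open>n\<close> the bump fits into the right neighbourhood of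
        \<open>t\<close>, its excess stays below \<eta>, and \<open>n\<close> dominates the size of
        \<open>x\<close>, which takes care of the points outside the bump.\<close>
      have "0 < min (d - t) \<eta>" using d \<eta> by simp
      then have "\<forall>\<^sub>F n in sequentially. 1 / real (Suc n) < min (d - t) \<eta>"
        by (rule order_tendstoD(2)[OF lim_1_over_n[THEN LIMSEQ_Suc]])
      moreover have "\<forall>\<^sub>F n in sequentially. B + \<bar>c\<bar> \<le> real n"
        using filterlim_real_sequentially by (simp add: filterlim_at_top)
      ultimately have "\<forall>\<^sub>F n in sequentially. 1 / real (Suc n) < min (d - t) \<eta> \<and> B + \<bar>c\<bar> \<le> real n"
        by (rule eventually_conj)
      then obtain n where n: "1 / real (Suc n) < min (d - t) \<eta>" "B + \<bar>c\<bar> \<le> real n"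
        by (auto simp: eventually_sequentially)
      have "\<forall>u\<in>{0..b}. \<bar>z n u - x u\<bar> \<le> real n"
      proof
        fix u assume u: "u \<in> {0..b}"
        have xB: "\<bar>x u\<bar> \<le> B" using B(2) u by auto
        show "\<bar>z n u - x u\<bar> \<le> real n"
        proof (cases "t \<le> u \<and> u < t + 1 / real (Suc n)")
          case True
          then have "c + \<eta> < x u" using d(2)[of u] \<eta>(2) n(1) by (cases "u = t") auto
          moreover have "z n u = h n" using True u by (simp add: z_eq)
          moreover have "0 < 1 / real (Suc n)" by simp
          ultimately show ?thesis using n xB unfolding h_def by linarith
        next
          case False
          then have "z n u = 0" using u by (auto simp: z_eq)
          then show ?thesis using xB n(2) by simp
        qed
      qed
      then show "x \<in> ?R" using dist_le x(1) by blast
    qed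
  qed
  also have "\<dots> \<in> sets (ball_algebra cadlag_metric)"
    using sup_dist_on_measurable[OF z, of k] unfolding b_def by measurable
  finally show "{x \<in> space (ball_algebra cadlag_metric). c < x t} \<in> sets (ball_algebra cadlag_metric)" .
qed

section \<open>An extended continuous mapping theorem\<close>

lemma limitin_mtopology_of:
  "limitin (mtopology_of m) z x F \<longleftrightarrow>
     x \<in> mspace m \<and> (\<forall>e>0. \<forall>\<^sub>F k in F. z k \<in> mspace m \<and> mdist m (z k) x < e)"
  unfolding mtopology_of_def
  by (rule Metric_space.limitin_metric[OF Metric_space_mspace_mdist])

lemma continuous_map_real_sequentiallyI:
  fixes m :: "'s metric" and f :: "'s \<Rightarrow> real"
  assumes "\<And>z x. limitin (mtopology_of m) z x sequentially \<Longrightarrow> (\<And>k. z k \<in> mspace m) \<Longrightarrow>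
    (\<lambda>k. f (z k)) \<longlonglongrightarrow> f x"
  shows "continuous_map (mtopology_of m) euclideanreal f"
proof -
  interpret Metric_space "mspace m" "mdist m" by (rule Metric_space_mspace_mdist)
  show ?thesis unfolding mtopology_of_def continuous_map_from_metric
  proof (intro conjI ballI allI impI)
    fix a U assume a: "a \<in> mspace m" and U: "openin euclideanreal U \<and> f a \<in> U"
    show "\<exists>r>0. \<forall>x. x \<in> mspace m \<and> mdist m a x < r \<longrightarrow> f x \<in> U"
    proof (rule ccontr)
      assume "\<not> ?thesis"
      then have "\<forall>k. \<exists>x. x \<in> mspace m \<and> mdist m a x < 1 / real (Suc k) \<and> f x \<notin> U"
        by (metis divide_pos_pos of_nat_0_less_iff zero_less_Suc zero_less_one)
      then obtain z where z: "\<And>k. z k \<in> mspace m" "\<And>k. mdist m a (z k) < 1 / real (Suc k)"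
        "\<And>k. f (z k) \<notin> U" by metis
      have "limitin (mtopology_of m) z a sequentially" unfolding limitin_mtopology_of
      proof (intro conjI allI impI a)
        fix e :: real assume "e > 0"
        then have "\<forall>\<^sub>F k in sequentially. 1 / real (Suc k) < e"
          by (rule order_tendstoD(2)[OF lim_1_over_n[THEN LIMSEQ_Suc]])
        then show "\<forall>\<^sub>F k in sequentially. z k \<in> mspace m \<and> mdist m (z k) a < e"
          by eventually_elim (use z in \<open>auto simp: commute intro: less_trans\<close>)
      qed
      then have "(\<lambda>k. f (z k)) \<longlonglongrightarrow> f a" using z(1) by (rule assms)
      then have "\<forall>\<^sub>F k in sequentially. f (z k) \<in> U"
        using U by (auto intro: topological_tendstoD)
      then show False using z(3) by simp
    qed
  qed auto
qed

text \<open>The weights \<open>\<rho> n\<close> are 1 on the range of \<open>X n\<close> for large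
  \<open>n\<close>, so they do not alter the expectations, while \<open>cconv\<close> has to be
  verified only along sequences of positive weight.\<close>

theorem extended_continuous_mapping:
  fixes m :: "'s metric" and \<Psi> \<rho> :: "nat \<Rightarrow> 's \<Rightarrow> real" and \<Psi>0 :: "'s \<Rightarrow> real"
  assumes M: "prob_space M" and N: "prob_space N"
    and weak: "converges_weakly m A M X N Y"
    and spA: "space A = mspace m"
    and meas: "\<And>n. \<Psi> n \<in> borel_measurable A" "\<Psi>0 \<in> borel_measurable A"
      "\<And>n. \<rho> n \<in> borel_measurable A"
    and bnd: "\<And>n x. x \<in> mspace m \<Longrightarrow> \<bar>\<Psi> n x\<bar> \<le> C" "\<And>x. x \<in> mspace m \<Longrightarrow> \<bar>\<Psi>0 x\<bar> \<le> C"
    and rho: "\<And>n x. x \<in> mspace m \<Longrightarrow> 0 \<le> \<rho> n x" "\<And>n x. x \<in> mspace m \<Longrightarrow> \<rho> n x \<le> 1"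
    and rho_1: "\<forall>\<^sub>F n in sequentially. \<forall>\<omega>\<in>space M. \<rho> n (X n \<omega>) = 1"
    and cont: "\<And>n z x. limitin (mtopology_of m) z x sequentially \<Longrightarrow> (\<And>k. z k \<in> mspace m) \<Longrightarrow>
        (\<lambda>k. \<Psi> n (z k)) \<longlonglongrightarrow> \<Psi> n x"
      "\<And>n z x. limitin (mtopology_of m) z x sequentially \<Longrightarrow> (\<And>k. z k \<in> mspace m) \<Longrightarrow>
        (\<lambda>k. \<rho> n (z k)) \<longlonglongrightarrow> \<rho> n x"
      "\<And>z x. limitin (mtopology_of m) z x sequentially \<Longrightarrow> (\<And>k. z k \<in> mspace m) \<Longrightarrow>
        (\<lambda>k. \<Psi>0 (z k)) \<longlonglongrightarrow> \<Psi>0 x"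
    and cconv: "\<And>z x \<nu>. limitin (mtopology_of m) z x sequentially \<Longrightarrow> (\<And>k. z k \<in> mspace m) \<Longrightarrow>
        filterlim \<nu> at_top sequentially \<Longrightarrow> (\<And>k. 0 < \<rho> (\<nu> k) (z k)) \<Longrightarrow>
        (\<lambda>k. \<Psi> (\<nu> k) (z k)) \<longlonglongrightarrow> \<Psi>0 x"
  shows "(\<lambda>n. \<integral>\<omega>. \<Psi> n (X n \<omega>) \<partial>M) \<longlonglongrightarrow> (\<integral>\<omega>. \<Psi>0 (Y \<omega>) \<partial>N)"
proof -
  interpret M: prob_space M by fact
  interpret N: prob_space N by fact
  interpret Metric_space "mspace m" "mdist m" by (rule Metric_space_mspace_mdist)
  have X[measurable]: "X n \<in> M \<rightarrow>\<^sub>M A" for n using weak by (auto simp: converges_weakly_def)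
  have Y[measurable]: "Y \<in> N \<rightarrow>\<^sub>M A" using weak by (auto simp: converges_weakly_def)
  note [measurable] = meas
  have spX: "\<omega> \<in> space M \<Longrightarrow> X n \<omega> \<in> mspace m" for n \<omega>
    using measurable_space[OF X] spA by auto
  have spY: "\<omega> \<in> space N \<Longrightarrow> Y \<omega> \<in> mspace m" for \<omega>
    using measurable_space[OF Y] spA by auto
  have weakD: "(\<lambda>n. \<integral>\<omega>. f (X n \<omega>) \<partial>M) \<longlonglongrightarrow> (\<integral>\<omega>. f (Y \<omega>) \<partial>N)"
    if "\<And>z x. limitin (mtopology_of m) z x sequentially \<Longrightarrow> (\<And>k. z k \<in> mspace m) \<Longrightarrow>
      (\<lambda>k. f (z k)) \<longlonglongrightarrow> f x" "\<And>x. x \<in> mspace m \<Longrightarrow> \<bar>f x\<bar> \<le> B" "f \<in> borel_measurable A"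
    for f :: "'s \<Rightarrow> real" and B
  proof -
    have "continuous_map (mtopology_of m) euclideanreal f"
      by (rule continuous_map_real_sequentiallyI[OF that(1)])
    moreover have "bounded (f ` mspace m)" using that(2) by (auto simp: bounded_real)
    ultimately show ?thesis using weak that(3) by (auto simp: converges_weakly_def)
  qed
  \<comment> \<open>Multiplication by the continuous weight keeps \<open>D n\<close> continuous on
    the whole space and discards the points about which \<open>cconv\<close> says nothing.\<close>
  define D where "D n x = \<rho> n x * \<bar>\<Psi> n x - \<Psi>0 x\<bar>" for n x
  have D_meas[measurable]: "D n \<in> borel_measurable A" for n unfolding D_def by measurable
  have D_cont: "(\<lambda>k. D n (z k)) \<longlonglongrightarrow> D n x"
    if "limitin (mtopology_of m) z x sequentially" "\<And>k. z k \<in> mspace m" for n z x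
    unfolding D_def by (intro tendsto_intros cont that)
  \<comment> \<open>Otherwise there are indices tending to infinity and points tending to
    \<open>x\<close> at which \<open>D\<close> exceeds \<open>e\<close>. This forces positive
    weights, so \<open>cconv\<close> applies along the sequence and gives a contradiction.\<close>
  have locfin: "\<exists>n0 r. 0 < r \<and> (\<forall>n\<ge>n0. \<forall>y\<in>mspace m. mdist m x y < r \<longrightarrow> D n y \<le> e)"
    if e: "0 < e" and x: "x \<in> mspace m" for e x
  proof (rule ccontr)
    assume neg: "\<not> ?thesis"
    have "\<exists>n y. k \<le> n \<and> y \<in> mspace m \<and> mdist m x y < 1 / real (Suc k) \<and> e < D n y" for k
    proof -
      have "0 < 1 / real (Suc k)" by simp
      then show ?thesis using neg by (meson not_less)
    qed
    then obtain \<nu> z where \<nu>: "\<And>k. k \<le> \<nu> k" and z: "\<And>k. z k \<in> mspace m"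
      "\<And>k. mdist m x (z k) < 1 / real (Suc k)" and eD: "\<And>k. e < D (\<nu> k) (z k)"
      by metis
    have lim: "limitin (mtopology_of m) z x sequentially" unfolding limitin_mtopology_of
    proof (intro conjI allI impI x)
      fix e :: real assume "e > 0"
      then have "\<forall>\<^sub>F k in sequentially. 1 / real (Suc k) < e"
        by (rule order_tendstoD(2)[OF lim_1_over_n[THEN LIMSEQ_Suc]])
      then show "\<forall>\<^sub>F k in sequentially. z k \<in> mspace m \<and> mdist m (z k) x < e"
        by eventually_elim (use z in \<open>auto simp: commute intro: less_trans\<close>)
    qed
    have pos: "0 < \<rho> (\<nu> k) (z k)" for k
    proof (rule ccontr)
      assume "\<not> 0 < \<rho> (\<nu> k) (z k)"
      then have "\<rho> (\<nu> k) (z k) = 0" using rho(1)[OF z(1), of "\<nu> k" k] by linarith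
      then show False using eD[of k] e unfolding D_def by simp
    qed
    have \<nu>_lim: "filterlim \<nu> at_top sequentially"
      by (rule filterlim_at_top_mono[OF filterlim_ident]) (use \<nu> in simp)
    define R where "R = (\<lambda>k. \<bar>\<Psi> (\<nu> k) (z k) - \<Psi>0 (z k)\<bar>)"
    have "R \<longlonglongrightarrow> \<bar>\<Psi>0 x - \<Psi>0 x\<bar>" unfolding R_def
      by (intro tendsto_intros cconv[OF lim z(1) \<nu>_lim pos] cont(3)[OF lim z(1)])
    then have "R \<longlonglongrightarrow> 0" by simp
    moreover have "e \<le> R k" for k
      using eD[of k] mult_right_mono[OF rho(2)[OF z(1)[of k], of "\<nu> k"], of "R k"]
      unfolding D_def R_def by auto
    ultimately show False using e LIMSEQ_le_const[of R 0 e] by auto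
  qed
  \<comment> \<open>Subtracting \<open>e\<close> makes all but finitely many summands vanish near
    each point, so the series is locally a finite sum; truncation at 1 makes it a bounded test
    functional.\<close>
  define h where "h e j x = min 1 (\<Sum>n. max 0 (D (n + j) x - e))" for e :: real and j :: nat and x
  have h_meas: "h e j \<in> borel_measurable A" for e j
    unfolding h_def by measurable
  have h_loc: "\<exists>n0 r. 0 < r \<and> (\<forall>y\<in>mspace m. mdist m x y < r \<longrightarrow>
      (\<forall>j. (\<lambda>n. max 0 (D (n + j) y - e)) sums (\<Sum>n<n0. max 0 (D (n + j) y - e))) \<and>
      (\<forall>j\<ge>n0. h e j y = 0))"
    if e: "0 < e" and x: "x \<in> mspace m" for e x
  proof -
    obtain n0 r where r: "0 < r" and n0: "\<And>n y. n \<ge> n0 \<Longrightarrow> y \<in> mspace m \<Longrightarrow> mdist m x y < r \<Longrightarrow> D n y \<le> e"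
      using locfin[OF e x] by blast
    have "(\<lambda>n. max 0 (D (n + j) y - e)) sums (\<Sum>n<n0. max 0 (D (n + j) y - e))"
      if "y \<in> mspace m" "mdist m x y < r" for y j
    proof (rule sums_finite)
      fix n assume "n \<notin> {..<n0}"
      then have "D (n + j) y \<le> e" using n0[OF _ that, of "n + j"] by simp
      then show "max 0 (D (n + j) y - e) = 0" by simp
    qed simp
    moreover have "h e j y = 0" if y: "y \<in> mspace m" "mdist m x y < r" and j: "j \<ge> n0" for y j
    proof -
      have "max 0 (D (n + j) y - e) = 0" for n using n0[OF _ y, of "n + j"] j by simp
      then show ?thesis by (simp add: h_def)
    qed
    ultimately show ?thesis using r by (intro exI[of _ n0] exI[of _ r]) auto
  qed
  have h_at: "\<exists>n0. (\<forall>j. (\<lambda>n. max 0 (D (n + j) x - e)) sums (\<Sum>n<n0. max 0 (D (n + j) x - e))) \<and>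
      (\<forall>j\<ge>n0. h e j x = 0)"
    if e: "0 < e" and x: "x \<in> mspace m" for e x
  proof -
    obtain n0 r where r: "0 < r" and *: "\<forall>y\<in>mspace m. mdist m x y < r \<longrightarrow>
      (\<forall>j. (\<lambda>n. max 0 (D (n + j) y - e)) sums (\<Sum>n<n0. max 0 (D (n + j) y - e))) \<and>
      (\<forall>j\<ge>n0. h e j y = 0)"
      using h_loc[OF e x] by blast
    have "mdist m x x < r" using r x by simp
    then show ?thesis using * x by blast
  qed
  have h_nonneg: "0 \<le> h e j x" and h_le1: "h e j x \<le> 1"
    and h_ge: "j \<le> n \<Longrightarrow> min 1 (max 0 (D n x - e)) \<le> h e j x"
    if e: "0 < e" and x: "x \<in> mspace m" for e j n x
  proof -
    obtain n0 where "(\<lambda>n. max 0 (D (n + j) x - e)) sums (\<Sum>n<n0. max 0 (D (n + j) x - e))"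
      using h_at[OF e x] by blast
    then have s: "summable (\<lambda>n. max 0 (D (n + j) x - e))" by (rule sums_summable)
    show "0 \<le> h e j x" unfolding h_def using suminf_nonneg[OF s] by simp
    show "h e j x \<le> 1" by (simp add: h_def)
    assume "j \<le> n"
    then show "min 1 (max 0 (D n x - e)) \<le> h e j x"
      unfolding h_def by (intro min.mono order_refl) (use sum_le_suminf[OF s, of "{n - j}"] in simp)
  qed
  have h_cont: "(\<lambda>k. h e j (z k)) \<longlonglongrightarrow> h e j x"
    if e: "0 < e" and z: "limitin (mtopology_of m) z x sequentially" "\<And>k. z k \<in> mspace m" for e j z x
  proof -
    have x: "x \<in> mspace m" using z(1) by (simp add: limitin_mtopology_of)
    obtain n0 r where r: "0 < r" and sums: "\<And>y. y \<in> mspace m \<Longrightarrow> mdist m x y < r \<Longrightarrow>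
        (\<lambda>n. max 0 (D (n + j) y - e)) sums (\<Sum>n<n0. max 0 (D (n + j) y - e))"
      using h_loc[OF e x] by blast
    have *: "h e j y = min 1 (\<Sum>n<n0. max 0 (D (n + j) y - e))" if "y \<in> mspace m" "mdist m x y < r" for y
      unfolding h_def sums_unique[OF sums[OF that], symmetric] ..
    have "\<forall>\<^sub>F k in sequentially. mdist m x (z k) < r"
      using z(1) r unfolding limitin_mtopology_of
      by (auto simp: commute elim!: allE[of _ r] eventually_mono)
    then have ev: "\<forall>\<^sub>F k in sequentially. min 1 (\<Sum>n<n0. max 0 (D (n + j) (z k) - e)) = h e j (z k)"
      by eventually_elim (simp add: * z(2))
    have "(\<lambda>k. min 1 (\<Sum>n<n0. max 0 (D (n + j) (z k) - e))) \<longlonglongrightarrow> min 1 (\<Sum>n<n0. max 0 (D (n + j) x - e))"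
      by (intro tendsto_intros D_cont z)
    then show ?thesis using ev * x r by (simp add: tendsto_cong)
  qed
  have hY: "(\<lambda>j. \<integral>\<omega>. h e j (Y \<omega>) \<partial>N) \<longlonglongrightarrow> 0" if e: "0 < e" for e
  proof -
    have "(\<lambda>j. \<integral>\<omega>. h e j (Y \<omega>) \<partial>N) \<longlonglongrightarrow> (\<integral>\<omega>. 0 \<partial>N)"
    proof (rule integral_dominated_convergence[where w = "\<lambda>_. 1"])
      show "AE \<omega> in N. (\<lambda>j. h e j (Y \<omega>)) \<longlonglongrightarrow> 0"
      proof (rule AE_I2)
        fix \<omega> assume "\<omega> \<in> space N"
        then have y: "Y \<omega> \<in> mspace m" by (rule spY)
        then obtain n0 where "\<forall>j\<ge>n0. h e j (Y \<omega>) = 0" using h_at[OF e y] by blast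
        then show "(\<lambda>j. h e j (Y \<omega>)) \<longlonglongrightarrow> 0"
          by (intro tendsto_eventually) (auto simp: eventually_sequentially)
      qed
      show "AE \<omega> in N. norm (h e j (Y \<omega>)) \<le> 1" for j
        using h_nonneg[OF e spY] h_le1[OF e spY] by (auto intro!: AE_I2)
    qed (use h_meas in measurable)
    then show ?thesis by simp
  qed
  have \<Psi>_int: "integrable M (\<lambda>\<omega>. \<Psi> n (X n \<omega>))" "integrable M (\<lambda>\<omega>. \<Psi>0 (X n \<omega>))" for n
    by (rule M.integrable_const_bound[where B = C]; use bnd spX in auto)+
  have h_int: "integrable M (\<lambda>\<omega>. h e j (X n \<omega>))" if "0 < e" for e j n
    by (rule M.integrable_const_bound[where B = 1])
      (use h_nonneg[OF that spX] h_le1[OF that spX] h_meas in auto)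
  have C0: "0 \<le> C"
    using bnd(2)[OF spX[of _ 0]] M.not_empty by (meson abs_ge_zero equals0I order_trans)
  have diff: "(\<lambda>n. (\<integral>\<omega>. \<Psi> n (X n \<omega>) \<partial>M) - (\<integral>\<omega>. \<Psi>0 (X n \<omega>) \<partial>M)) \<longlonglongrightarrow> 0"
  proof (rule tendstoI)
    fix \<epsilon> :: real assume eps: "0 < \<epsilon>"
    \<comment> \<open>Since \<open>D n \<le> 2 * C\<close>, also
      \<open>D n \<le> e + (2 * C + 1) * min 1 (max 0 (D n - e))\<close>: while the excess over
      \<open>e\<close> is at most 1 a factor 1 is enough, beyond that the bound \<open>2 * C\<close>
      is. Each of the two contributions costs a third of \<epsilon>.\<close>
    define e where "e = \<epsilon> / 3"
    define \<eta> where "\<eta> = \<epsilon> / 3 / (2 * C + 1)"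
    have "0 < 2 * C + 1" using C0 by simp
    then have e: "0 < e" and eta: "0 < \<eta>" and ne: "2 * C + 1 \<noteq> 0"
      using eps by (simp_all add: e_def \<eta>_def)
    have eta2: "(2 * C + 1) * \<eta> = \<epsilon> / 3"
      using nonzero_mult_div_cancel_left[OF ne, of "\<epsilon> / 3"] unfolding \<eta>_def by (simp only: times_divide_eq_right)
    have "\<forall>\<^sub>F j in sequentially. (\<integral>\<omega>. h e j (Y \<omega>) \<partial>N) < \<eta>"
      using hY[OF e] eta by (rule order_tendstoD)
    then obtain j where j: "(\<integral>\<omega>. h e j (Y \<omega>) \<partial>N) < \<eta>" by (auto simp: eventually_sequentially)
    have "(\<lambda>n. \<integral>\<omega>. h e j (X n \<omega>) \<partial>M) \<longlonglongrightarrow> (\<integral>\<omega>. h e j (Y \<omega>) \<partial>N)"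
      by (rule weakD[of _ 1])
        (use h_cont[OF e] h_nonneg[OF e] h_le1[OF e] h_meas in auto)
    then have "\<forall>\<^sub>F n in sequentially. (\<integral>\<omega>. h e j (X n \<omega>) \<partial>M) < \<eta>" using j by (rule order_tendstoD)
    then show "\<forall>\<^sub>F n in sequentially. dist ((\<integral>\<omega>. \<Psi> n (X n \<omega>) \<partial>M) - (\<integral>\<omega>. \<Psi>0 (X n \<omega>) \<partial>M)) 0 < \<epsilon>"
      using rho_1 eventually_ge_at_top[of j]
    proof eventually_elim
      case (elim n)
      have "\<bar>(\<integral>\<omega>. \<Psi> n (X n \<omega>) \<partial>M) - (\<integral>\<omega>. \<Psi>0 (X n \<omega>) \<partial>M)\<bar>
          = \<bar>\<integral>\<omega>. \<Psi> n (X n \<omega>) - \<Psi>0 (X n \<omega>) \<partial>M\<bar>"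
        using \<Psi>_int by simp
      also have "\<dots> \<le> (\<integral>\<omega>. \<bar>\<Psi> n (X n \<omega>) - \<Psi>0 (X n \<omega>)\<bar> \<partial>M)" by (rule integral_abs_bound)
      also have "\<dots> \<le> (\<integral>\<omega>. e + (2 * C + 1) * h e j (X n \<omega>) \<partial>M)"
      proof (rule integral_mono)
        fix \<omega> assume \<omega>: "\<omega> \<in> space M"
        have x: "X n \<omega> \<in> mspace m" using \<omega> by (rule spX)
        have D: "D n (X n \<omega>) = \<bar>\<Psi> n (X n \<omega>) - \<Psi>0 (X n \<omega>)\<bar>" using elim(2) \<omega> by (simp add: D_def)
        have hg: "min 1 (max 0 (D n (X n \<omega>) - e)) \<le> h e j (X n \<omega>)" using h_ge[OF e x elim(3)] .
        have 2: "D n (X n \<omega>) \<le> 2 * C" using bnd(1)[OF x, of n] bnd(2)[OF x] unfolding D by linarith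
        have "D n (X n \<omega>) \<le> e + (2 * C + 1) * min 1 (max 0 (D n (X n \<omega>) - e))"
        proof (cases "D n (X n \<omega>) - e \<le> 1")
          case True
          have "0 \<le> 2 * C * max 0 (D n (X n \<omega>) - e)" using C0 by simp
          then show ?thesis using True by (auto simp: algebra_simps max_def split: if_splits)
        qed (use 2 e in auto)
        also have "\<dots> \<le> e + (2 * C + 1) * h e j (X n \<omega>)"
          using hg C0 by (intro add_left_mono mult_left_mono) auto
        finally show "\<bar>\<Psi> n (X n \<omega>) - \<Psi>0 (X n \<omega>)\<bar> \<le> e + (2 * C + 1) * h e j (X n \<omega>)" by (simp add: D)
      qed (use \<Psi>_int h_int[OF e] in auto)
      also have "\<dots> = e + (2 * C + 1) * (\<integral>\<omega>. h e j (X n \<omega>) \<partial>M)"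
        using h_int[OF e] by (simp add: M.prob_space)
      also have "\<dots> \<le> e + (2 * C + 1) * \<eta>"
        using elim(1) C0 by (intro add_left_mono mult_left_mono) auto
      also have "\<dots> < \<epsilon>" using eta2 eps by (simp add: e_def)
      finally show ?case by (simp add: dist_real_def)
    qed
  qed
  have "(\<lambda>n. \<integral>\<omega>. \<Psi>0 (X n \<omega>) \<partial>M) \<longlonglongrightarrow> (\<integral>\<omega>. \<Psi>0 (Y \<omega>) \<partial>N)"
    by (rule weakD[of _ C]) (use cont(3) bnd(2) meas in auto)
  from tendsto_add[OF diff this] show ?thesis by simp
qed

section \<open>Riemann sums on equidistant grids\<close>

text \<open>Dividing by \<open>c + 1\<close> instead of \<open>c\<close> also covers
  \<open>c = 0\<close>.\<close>

lemma scaled_less: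
  fixes c e :: real
  assumes "0 < e" "0 \<le> c"
  obtains d where "0 < d" "d * c < e"
proof
  have "c + 1 \<noteq> 0" using assms by linarith
  then have "e / (c + 1) * (c + 1) = e" by (rule nonzero_eq_divide_eq[THEN iffD1, OF _ refl])
  moreover show "0 < e / (c + 1)" using assms by simp
  ultimately show "e / (c + 1) * c < e" by (simp add: distrib_left)
qed

text \<open>Summation by parts puts the increments on the monotone \<open>q\<close>, where they
  telescope to at most \<open>2 * B\<close>; the two boundary terms add another
  \<open>2 * B * Y\<close>. Only the size of \<open>y\<close> is measured, not its
  variation.\<close>

lemma abel_sum_bound:
  fixes q y :: "nat \<Rightarrow> real"
  assumes q: "\<And>i. i < N \<Longrightarrow> q i \<le> q (Suc i)"
    and B: "\<And>i. i \<le> N \<Longrightarrow> \<bar>q i\<bar> \<le> B" and Y: "\<And>i. i \<le> N \<Longrightarrow> \<bar>y i\<bar> \<le> Y"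
  shows "\<bar>\<Sum>i<N. q i * (y (Suc i) - y i)\<bar> \<le> 4 * B * Y"
proof -
  have Y0: "0 \<le> Y" and B0: "0 \<le> B" using Y[of 0] B[of 0] by auto
  have abel: "(\<Sum>i<N. q i * (y (Suc i) - y i)) =
      q N * y N - q 0 * y 0 - (\<Sum>i<N. y (Suc i) * (q (Suc i) - q i))" for N
    by (induction N) (auto simp: algebra_simps)
  have "\<bar>\<Sum>i<N. y (Suc i) * (q (Suc i) - q i)\<bar> \<le> (\<Sum>i<N. Y * (q (Suc i) - q i))"
    by (rule order_trans[OF sum_abs sum_mono]) (use q Y in \<open>auto simp: abs_mult intro!: mult_right_mono\<close>)
  also have "\<dots> = Y * (q N - q 0)"
    by (simp add: sum_distrib_left[symmetric] sum_lessThan_telescope)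
  also have "\<dots> \<le> Y * (2 * B)"
    using B[of N] B[of 0] Y0 by (intro mult_left_mono) auto
  finally have 1: "\<bar>\<Sum>i<N. y (Suc i) * (q (Suc i) - q i)\<bar> \<le> Y * (2 * B)" .
  have "\<bar>q N * y N\<bar> \<le> B * Y" "\<bar>q 0 * y 0\<bar> \<le> B * Y"
    unfolding abs_mult by (intro mult_mono B Y; use Y0 B0 in simp)+
  moreover have "4 * B * Y = B * Y + B * Y + Y * (2 * B)" by simp
  ultimately show ?thesis using 1 unfolding abel by linarith
qed

text \<open>The hypothesis \<open>cell\<close> expresses, without reference to a particular integral, that \<open>I\<close> is an indefinite
  integral of \<open>p\<close> with respect to \<open>dh\<close>.\<close>

lemma integrator_sum_bound:
  fixes h I p Q :: "real \<Rightarrow> real" and s w :: "nat \<Rightarrow> real"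
  assumes h: "\<And>u v. 0 \<le> u \<Longrightarrow> u \<le> v \<Longrightarrow> v \<le> b \<Longrightarrow> h u \<le> h v"
    and Q: "mono Q" "\<And>u v. 0 \<le> u \<Longrightarrow> u \<le> v \<Longrightarrow> v \<le> b \<Longrightarrow> \<bar>p v - p u\<bar> \<le> e + (Q v - Q u)"
    and cell: "\<And>u v w K. 0 \<le> u \<Longrightarrow> u \<le> v \<Longrightarrow> v \<le> b \<Longrightarrow> w \<in> {u..v} \<Longrightarrow> (\<And>a. a \<in> {u..v} \<Longrightarrow> \<bar>p a - p w\<bar> \<le> K)
       \<Longrightarrow> \<bar>I v - I u - p w * (h v - h u)\<bar> \<le> K * (h v - h u)"
    and s: "\<And>i. 0 \<le> s i" "\<And>i. s i \<le> s (Suc i)" "\<And>i. s i \<le> b"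
    and w: "\<And>i. w i \<in> {s i..s (Suc i)}"
    and mesh: "\<And>i. h (s (Suc i)) - h (s i) \<le> \<eta>" and e: "0 \<le> e" and \<eta>: "0 \<le> \<eta>"
  shows "\<bar>I (s N) - I (s 0) - (\<Sum>i<N. p (w i) * (h (s (Suc i)) - h (s i)))\<bar>
    \<le> e * (h b - h 0) + \<eta> * (Q b - Q 0)"
proof -
  have h0: "h (s N) - h (s 0) \<le> h b - h 0"
    using h[of "s N" b] h[of 0 "s 0"] s[of N] s[of 0] order_trans by fastforce
  have Q0: "Q (s N) - Q (s 0) \<le> Q b - Q 0"
    using monoD[OF Q(1) s(3)[of N]] monoD[OF Q(1) s(1)[of 0]] by simp
  \<comment> \<open>On a cell the oscillation of \<open>p\<close> is at most \<open>e\<close> plus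
    the increment of \<open>Q\<close>. In the product of the increments of \<open>Q\<close> and
    \<open>h\<close> the latter is bounded by \<eta>, which leaves a telescoping sum.\<close>
  have K: "\<bar>I (s (Suc i)) - I (s i) - p (w i) * (h (s (Suc i)) - h (s i))\<bar>
      \<le> e * (h (s (Suc i)) - h (s i)) + \<eta> * (Q (s (Suc i)) - Q (s i))" for i
  proof -
    have hm: "0 \<le> h (s (Suc i)) - h (s i)" using h[of "s i" "s (Suc i)"] s by simp
    have Qm: "0 \<le> Q (s (Suc i)) - Q (s i)" using monoD[OF Q(1) s(2)] by simp
    have "\<bar>I (s (Suc i)) - I (s i) - p (w i) * (h (s (Suc i)) - h (s i))\<bar>
      \<le> (e + (Q (s (Suc i)) - Q (s i))) * (h (s (Suc i)) - h (s i))"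
    proof (rule cell)
      fix a assume a: "a \<in> {s i..s (Suc i)}"
      have wi: "s i \<le> w i" "w i \<le> s (Suc i)" using w[of i] by auto
      have mm: "Q (s i) \<le> Q a" "Q a \<le> Q (s (Suc i))" "Q (s i) \<le> Q (w i)" "Q (w i) \<le> Q (s (Suc i))"
        using a wi by (auto intro!: monoD[OF Q(1)])
      have "\<bar>p a - p (w i)\<bar> \<le> e + \<bar>Q a - Q (w i)\<bar>"
      proof (cases "a \<le> w i")
        case True
        then show ?thesis using Q(2)[of a "w i"] monoD[OF Q(1) True] a wi s(1)[of i] s(3)[of "Suc i"] by auto
      next
        case False
        then have "w i \<le> a" by simp
        then show ?thesis using Q(2)[of "w i" a] monoD[OF Q(1) \<open>w i \<le> a\<close>] a wi s(1)[of i] s(3)[of "Suc i"] by auto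
      qed
      then show "\<bar>p a - p (w i)\<bar> \<le> e + (Q (s (Suc i)) - Q (s i))" using mm by linarith
    qed (use s w in auto)
    also have "\<dots> = e * (h (s (Suc i)) - h (s i)) + (h (s (Suc i)) - h (s i)) * (Q (s (Suc i)) - Q (s i))"
      by (simp add: algebra_simps)
    also have "\<dots> \<le> e * (h (s (Suc i)) - h (s i)) + \<eta> * (Q (s (Suc i)) - Q (s i))"
      using mesh[of i] Qm by (intro add_left_mono mult_right_mono) auto
    finally show ?thesis .
  qed
  have "\<bar>I (s N) - I (s 0) - (\<Sum>i<N. p (w i) * (h (s (Suc i)) - h (s i)))\<bar>
      = \<bar>\<Sum>i<N. I (s (Suc i)) - I (s i) - p (w i) * (h (s (Suc i)) - h (s i))\<bar>"
    by (simp only: sum_subtractf[of _ "\<lambda>i. p (w i) * (h (s (Suc i)) - h (s i))"] sum_lessThan_telescope[of "\<lambda>i. I (s i)"])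
  also have "\<dots> \<le> (\<Sum>i<N. e * (h (s (Suc i)) - h (s i)) + \<eta> * (Q (s (Suc i)) - Q (s i)))"
    by (rule order_trans[OF sum_abs sum_mono]) (use K in auto)
  also have "\<dots> = e * (h (s N) - h (s 0)) + \<eta> * (Q (s N) - Q (s 0))"
    by (simp add: sum.distrib sum_distrib_left[symmetric] sum_lessThan_telescope[of "\<lambda>i. h (s i)"]
        sum_lessThan_telescope[of "\<lambda>i. Q (s i)"])
  also have "\<dots> \<le> e * (h b - h 0) + \<eta> * (Q b - Q 0)"
    using h0 Q0 e \<eta> by (intro add_mono mult_left_mono) auto
  finally show ?thesis .
qed

text \<open>With the denominator \<open>Suc m\<close> every natural number \<open>k\<close> is a
  grid point of every mesh, at index \<open>k * Suc m\<close>.\<close>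

definition grid :: "nat \<Rightarrow> nat \<Rightarrow> real" where "grid m i = real i / real (Suc m)"

text \<open>Left endpoints evaluate the integrand strictly before a jump of \<open>y\<close>, as the
  left limit in the Nelson-Aalen integral demands. The last cell is cut at \<open>t\<close>.\<close>

definition riemann_sum :: "nat \<Rightarrow> (real \<Rightarrow> real) \<Rightarrow> (real \<Rightarrow> real) \<Rightarrow> real \<Rightarrow> real" where
  "riemann_sum m p y t = (\<Sum>i | grid m i < t. p (grid m i) * (y (min t (grid m (Suc i))) - y (grid m i)))"

lemma grid_0 [simp]: "grid m 0 = 0"
  and grid_nonneg [simp]: "0 \<le> grid m i"
  and grid_Suc: "grid m (Suc i) = grid m i + 1 / real (Suc m)"
  and grid_mult [simp]: "grid m (k * Suc m) = real k"
  by (auto simp: grid_def add_divide_distrib intro!: divide_right_mono simp del: of_nat_Suc mult_Suc_right)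
    (simp add: add_divide_distrib[symmetric])

lemma grid_le_iff [simp]: "grid m i \<le> grid m j \<longleftrightarrow> i \<le> j"
  by (simp add: grid_def divide_le_cancel)

lemma min_grid_mono: "min t (grid m i) \<le> min t (grid m (Suc i))"
  by (intro min.mono) simp_all

lemma min_grid_absorb: "t \<le> grid m i \<Longrightarrow> min t (grid m i) = t \<and> min t (grid m (Suc i)) = t"
  using grid_le_iff[of m i "Suc i"] by (auto simp: min_absorb1 simp del: grid_le_iff)

text \<open>Stopping every grid point at \<open>t\<close> gives all \<open>t\<close> in a bounded
  interval the same number of cells, and cells beyond \<open>t\<close> collapse to zero. This is the
  form suited to summation by parts.\<close>

lemma riemann_sum_eq:
  assumes t: "0 \<le> t" "t \<le> grid m N"
  shows "riemann_sum m p y t =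
    (\<Sum>i<N. p (min t (grid m i)) * (y (min t (grid m (Suc i))) - y (min t (grid m i))))"
proof -
  have sub: "{i. grid m i < t} \<subseteq> {..<N}"
  proof
    fix i assume "i \<in> {i. grid m i < t}"
    then have "grid m i < grid m N" using t by auto
    then show "i \<in> {..<N}" by (metis grid_le_iff lessThan_iff not_le)
  qed
  have "(\<Sum>i<N. p (min t (grid m i)) * (y (min t (grid m (Suc i))) - y (min t (grid m i)))) =
    (\<Sum>i | grid m i < t. p (min t (grid m i)) * (y (min t (grid m (Suc i))) - y (min t (grid m i))))"
  proof (rule sum.mono_neutral_right)
    show "\<forall>i\<in>{..<N} - {i. grid m i < t}. p (min t (grid m i)) * (y (min t (grid m (Suc i))) - y (min t (grid m i))) = 0"
    proof
      fix i assume "i \<in> {..<N} - {i. grid m i < t}"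
      then have "t \<le> grid m i" by auto
      then show "p (min t (grid m i)) * (y (min t (grid m (Suc i))) - y (min t (grid m i))) = 0"
        using min_grid_absorb by simp
    qed
  qed (use sub in auto)
  also have "\<dots> = riemann_sum m p y t"
    unfolding riemann_sum_def by (rule sum.cong) (auto simp: min_def)
  finally show ?thesis by simp
qed

lemma riemann_sum_cong:
  assumes "\<And>u. 0 \<le> u \<Longrightarrow> u \<le> t \<Longrightarrow> p u = q u" "\<And>u. 0 \<le> u \<Longrightarrow> u \<le> t \<Longrightarrow> y u = z u" "0 \<le> t"
  shows "riemann_sum m p y t = riemann_sum m q z t"
  unfolding riemann_sum_def by (rule sum.cong) (use assms in auto)

lemma riemann_sum_add_left: "riemann_sum m (\<lambda>u. p u + q u) y t = riemann_sum m p y t + riemann_sum m q y t"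
  and riemann_sum_diff_left: "riemann_sum m (\<lambda>u. p u - q u) y t = riemann_sum m p y t - riemann_sum m q y t"
  and riemann_sum_add_right: "riemann_sum m p (\<lambda>u. y u + z u) t = riemann_sum m p y t + riemann_sum m p z t"
  and riemann_sum_diff_right: "riemann_sum m p (\<lambda>u. y u - z u) t = riemann_sum m p y t - riemann_sum m p z t"
  and riemann_sum_mult_left: "riemann_sum m (\<lambda>u. c * p u) y t = c * riemann_sum m p y t"
  and riemann_sum_mult_right: "riemann_sum m p (\<lambda>u. c * y u) t = c * riemann_sum m p y t"
  unfolding riemann_sum_def sum.distrib[symmetric] sum_subtractf[symmetric] sum_distrib_left
  by (auto simp: algebra_simps intro!: sum.cong)

section \<open>Mesh-independent bounds and limits of Riemann sums\<close>

lemma riemann_sum_bound: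
  assumes t: "0 \<le> t" "t \<le> grid m N" and p: "\<And>u. 0 \<le> u \<Longrightarrow> u \<le> t \<Longrightarrow> \<bar>p u\<bar> \<le> B"
    and V: "(\<Sum>i<N. \<bar>y (min t (grid m (Suc i))) - y (min t (grid m i))\<bar>) \<le> C"
  shows "\<bar>riemann_sum m p y t\<bar> \<le> B * C"
proof -
  have B: "0 \<le> B" using p[of 0] t(1) by auto
  have "\<bar>riemann_sum m p y t\<bar> \<le> (\<Sum>i<N. B * \<bar>y (min t (grid m (Suc i))) - y (min t (grid m i))\<bar>)"
    unfolding riemann_sum_eq[OF t]
    by (rule order_trans[OF sum_abs sum_mono]) (use p t B in \<open>auto simp: abs_mult intro!: mult_right_mono\<close>)
  also have "\<dots> \<le> B * C" using V B by (simp add: sum_distrib_left[symmetric] mult_left_mono)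
  finally show ?thesis .
qed

lemma riemann_sum_mono_bound:
  assumes t: "0 \<le> t" "t \<le> b" and q: "\<And>u v. 0 \<le> u \<Longrightarrow> u \<le> v \<Longrightarrow> v \<le> b \<Longrightarrow> q u \<le> q v"
    and B: "\<And>u. 0 \<le> u \<Longrightarrow> u \<le> b \<Longrightarrow> \<bar>q u\<bar> \<le> B" and Y: "\<And>u. 0 \<le> u \<Longrightarrow> u \<le> b \<Longrightarrow> \<bar>y u\<bar> \<le> Y"
  shows "\<bar>riemann_sum m q y t\<bar> \<le> 4 * B * Y"
proof -
  obtain k where "t \<le> real k" by (meson real_arch_simple)
  then have tk: "t \<le> grid m (k * Suc m)" by (simp only: grid_mult)
  show ?thesis unfolding riemann_sum_eq[OF t(1) tk]
  proof (rule abel_sum_bound)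
    fix i
    show "q (min t (grid m i)) \<le> q (min t (grid m (Suc i)))"
      by (intro q min_grid_mono) (use t in \<open>auto simp: min_def\<close>)
  qed (use t in \<open>auto intro!: B Y simp: min_def\<close>)
qed

text \<open>The bound \<open>4 * B * Y\<close> does not depend on the mesh, so \<open>m n\<close>
  may vary freely with \<open>n\<close>.\<close>

lemma uniform_limit_riemann_sum_mono_left:
  assumes q: "\<And>u v. 0 \<le> u \<Longrightarrow> u \<le> v \<Longrightarrow> v \<le> b \<Longrightarrow> q u \<le> q v"
    and z: "uniform_limit {0..b} z (\<lambda>_. 0) F"
  shows "uniform_limit {0..b} (\<lambda>n. riemann_sum (m n) q (z n)) (\<lambda>_. 0 :: real) F"
proof (cases "0 \<le> b")
  case True
  show ?thesis
  proof (rule uniform_limitI)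
    fix e :: real assume e: "0 < e"
    define B where "B = \<bar>q 0\<bar> + \<bar>q b\<bar>"
    have B: "\<bar>q u\<bar> \<le> B" if "0 \<le> u" "u \<le> b" for u
      using q[of 0 u] q[of u b] that by (auto simp: B_def)
    have "0 \<le> 4 * B" by (simp add: B_def)
    with e obtain d where d: "0 < d" "d * (4 * B) < e" by (rule scaled_less)
    from z d(1) have "\<forall>\<^sub>F n in F. \<forall>t\<in>{0..b}. dist (z n t) 0 < d" by (rule uniform_limitD)
    then show "\<forall>\<^sub>F n in F. \<forall>t\<in>{0..b}. dist (riemann_sum (m n) q (z n) t) 0 < e"
    proof eventually_elim
      case (elim n)
      have "\<bar>riemann_sum (m n) q (z n) t\<bar> \<le> 4 * B * d" if "t \<in> {0..b}" for t
        by (rule riemann_sum_mono_bound[where b = b])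
          (use that elim q B in \<open>auto simp: dist_real_def intro: less_imp_le\<close>)
      then show ?case using d(2) by (fastforce simp: dist_real_def mult.commute)
    qed
  qed
qed simp

lemma uniform_limit_riemann_sum_bounded_variation:
  assumes p: "uniform_limit {0..b} p (\<lambda>_. 0) F"
    and V: "\<forall>\<^sub>F n in F. \<forall>t\<in>{0..b}. (\<Sum>i<N n. \<bar>z n (min t (grid (m n) (Suc i))) - z n (min t (grid (m n) i))\<bar>) \<le> C"
    and N: "\<And>n. b \<le> grid (m n) (N n)"
  shows "uniform_limit {0..b} (\<lambda>n. riemann_sum (m n) (p n) (z n)) (\<lambda>_. 0 :: real) F"
proof (rule uniform_limitI)
  fix e :: real assume e: "0 < e"
  have "0 \<le> \<bar>C\<bar>" by simp
  with e obtain d where d: "0 < d" "d * \<bar>C\<bar> < e" by (rule scaled_less)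
  from p d(1) have "\<forall>\<^sub>F n in F. \<forall>t\<in>{0..b}. dist (p n t) 0 < d" by (rule uniform_limitD)
  then show "\<forall>\<^sub>F n in F. \<forall>t\<in>{0..b}. dist (riemann_sum (m n) (p n) (z n) t) 0 < e"
    using V
  proof eventually_elim
    case (elim n)
    show ?case
    proof
      fix t assume t: "t \<in> {0..b}"
      have "(\<Sum>i<N n. \<bar>z n (min t (grid (m n) (Suc i))) - z n (min t (grid (m n) i))\<bar>) \<le> \<bar>C\<bar>"
        using elim(2) t abs_ge_self[of C] order_trans by blast
      then have "\<bar>riemann_sum (m n) (p n) (z n) t\<bar> \<le> d * \<bar>C\<bar>"
        using t elim(1) N[of n] by (intro riemann_sum_bound[where N = "N n"]) (auto simp: dist_real_def intro: less_imp_le)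
      also note d(2)
      finally show "dist (riemann_sum (m n) (p n) (z n) t) 0 < e" by (simp add: dist_real_def)
    qed
  qed
qed

text \<open>The variation bound controls the approximation error \<open>p - (q1 - q2)\<close>; for
  the monotone parts \<open>q1\<close> and \<open>q2\<close> uniform smallness of \<open>z\<close>
  is enough.\<close>

lemma uniform_limit_riemann_sum_cadlag_left:
  assumes p: "cadlag_fun p" and z: "uniform_limit {0..b} z (\<lambda>_. 0) F"
    and V: "\<forall>\<^sub>F n in F. \<forall>t\<in>{0..b}. (\<Sum>i<N n. \<bar>z n (min t (grid (m n) (Suc i))) - z n (min t (grid (m n) i))\<bar>) \<le> C"
    and N: "\<And>n. b \<le> grid (m n) (N n)"
  shows "uniform_limit {0..b} (\<lambda>n. riemann_sum (m n) p (z n)) (\<lambda>_. 0 :: real) F"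
proof (cases "0 \<le> b")
  case b: True
  show ?thesis
  proof (rule uniform_limitI)
    fix e :: real assume e: "0 < e"
    have "0 < e / 3" "0 \<le> \<bar>C\<bar>" using e by auto
    then obtain \<delta> where \<delta>: "0 < \<delta>" "\<delta> * \<bar>C\<bar> < e / 3" by (rule scaled_less)
    obtain q1 q2 where q: "mono q1" "mono q2" "\<And>t. t \<in> {0..b} \<Longrightarrow> \<bar>p t - (q1 t - q2 t)\<bar> \<le> \<delta>"
      using cadlag_fun_approx[OF p \<delta>(1) b] by auto
    have l: "uniform_limit {0..b} (\<lambda>n. riemann_sum (m n) q (z n)) (\<lambda>_. 0) F" if "mono q" for q
      by (rule uniform_limit_riemann_sum_mono_left[OF _ z]) (rule monoD[OF that])
    have "\<forall>\<^sub>F n in F. \<forall>t\<in>{0..b}. dist (riemann_sum (m n) q1 (z n) t) 0 < e / 3"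
      "\<forall>\<^sub>F n in F. \<forall>t\<in>{0..b}. dist (riemann_sum (m n) q2 (z n) t) 0 < e / 3"
      by (rule uniform_limitD[OF l[OF q(1)]], use e in simp, rule uniform_limitD[OF l[OF q(2)]], use e in simp)
    then show "\<forall>\<^sub>F n in F. \<forall>t\<in>{0..b}. dist (riemann_sum (m n) p (z n) t) 0 < e" using V
    proof eventually_elim
      case (elim n)
      show ?case
      proof
        fix t assume t: "t \<in> {0..b}"
        have "(\<Sum>i<N n. \<bar>z n (min t (grid (m n) (Suc i))) - z n (min t (grid (m n) i))\<bar>) \<le> \<bar>C\<bar>"
          using elim(3) t abs_ge_self[of C] order_trans by blast
        then have "\<bar>riemann_sum (m n) (\<lambda>u. p u - (q1 u - q2 u)) (z n) t\<bar> \<le> \<delta> * \<bar>C\<bar>"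
          using t N[of n] q(3) by (intro riemann_sum_bound[where N = "N n"]) auto
        moreover have "\<bar>riemann_sum (m n) q1 (z n) t\<bar> < e / 3" "\<bar>riemann_sum (m n) q2 (z n) t\<bar> < e / 3"
          using elim t by (auto simp: dist_real_def)
        ultimately show "dist (riemann_sum (m n) p (z n) t) 0 < e"
          using \<delta>(2) unfolding riemann_sum_diff_left dist_real_def by linarith
      qed
    qed
  qed
qed simp

text \<open>The evaluation points \<open>w\<close> are left free because left endpoints serve the
  integral against \<open>H1\<close> and right endpoints the one arising from partial integration.
  The order of choice matters: \<open>e1\<close> determines \<open>Q\<close>, then \<open>Q\<close>
  determines \<eta>, then uniform continuity of \<open>h\<close> determines the mesh.\<close>

lemma eventually_integrator_grid_bound:
  assumes p: "cadlag_fun p" and h: "\<And>u v. 0 \<le> u \<Longrightarrow> u \<le> v \<Longrightarrow> v \<le> b \<Longrightarrow> h u \<le> h v"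
    and hc: "continuous_on {0..b} h"
    and cell: "\<And>u v w K. 0 \<le> u \<Longrightarrow> u \<le> v \<Longrightarrow> v \<le> b \<Longrightarrow> w \<in> {u..v} \<Longrightarrow> (\<And>a. a \<in> {u..v} \<Longrightarrow> \<bar>p a - p w\<bar> \<le> K)
       \<Longrightarrow> \<bar>I v - I u - p w * (h v - h u)\<bar> \<le> K * (h v - h u)"
    and e: "0 < e" and b: "0 \<le> b"
  shows "\<forall>\<^sub>F m in sequentially. \<forall>t\<in>{0..b}. \<forall>w N. (\<forall>i. w i \<in> {min t (grid m i)..min t (grid m (Suc i))}) \<and> t \<le> grid m N \<longrightarrow>
    \<bar>I t - I 0 - (\<Sum>i<N. p (w i) * (h (min t (grid m (Suc i))) - h (min t (grid m i))))\<bar> < e"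
proof -
  have hb: "h 0 \<le> h b" using h b by simp
  have "0 < e / 2" "0 \<le> h b - h 0" using e hb by auto
  then obtain e1 where e1: "0 < e1" "e1 * (h b - h 0) < e / 2" by (rule scaled_less)
  obtain Q where Q: "mono Q" "\<And>u v. 0 \<le> u \<Longrightarrow> u \<le> v \<Longrightarrow> v \<le> b \<Longrightarrow> \<bar>p v - p u\<bar> \<le> e1 + (Q v - Q u)"
    using cadlag_fun_modulus[OF p e1(1) b] by blast
  have "0 < e / 2" "0 \<le> Q b - Q 0" using e monoD[OF Q(1) b] by auto
  then obtain \<eta> where \<eta>: "0 < \<eta>" "\<eta> * (Q b - Q 0) < e / 2" by (rule scaled_less)
  have "uniformly_continuous_on {0..b} h" by (rule compact_uniformly_continuous[OF hc]) simp
  then obtain d where d: "0 < d" "\<And>u v. u \<in> {0..b} \<Longrightarrow> v \<in> {0..b} \<Longrightarrow> dist u v < d \<Longrightarrow> dist (h u) (h v) < \<eta>"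
    unfolding uniformly_continuous_on_def using \<eta>(1) by (metis dist_commute)
  have "\<forall>\<^sub>F m in sequentially. 1 / real (Suc m) < d"
    by (rule order_tendstoD(2)[OF lim_1_over_n[THEN LIMSEQ_Suc] d(1)])
  then show ?thesis
  proof eventually_elim
    case (elim m)
    show ?case
    proof (intro ballI allI impI; elim conjE)
      fix t w N assume t: "t \<in> {0..b}" and w: "\<forall>i. w i \<in> {min t (grid m i)..min t (grid m (Suc i))}"
        and N: "t \<le> grid m N"
      have "\<bar>I (min t (grid m N)) - I (min t (grid m 0)) - (\<Sum>i<N. p (w i) * (h (min t (grid m (Suc i))) - h (min t (grid m i))))\<bar>
        \<le> e1 * (h b - h 0) + \<eta> * (Q b - Q 0)"
      proof (rule integrator_sum_bound[where p = p and w = w and s = "\<lambda>i. min t (grid m i)"])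
        fix i
        have "dist (min t (a + \<delta>)) (min t a) \<le> \<delta>" if "0 \<le> \<delta>" for a \<delta> :: real
          using that by (auto simp: min_def dist_real_def)
        from this[of "1 / real (Suc m)" "grid m i"]
        have "dist (min t (grid m (Suc i))) (min t (grid m i)) \<le> 1 / real (Suc m)"
          unfolding grid_Suc by simp
        then have "dist (h (min t (grid m (Suc i)))) (h (min t (grid m i))) < \<eta>"
          using t elim by (intro d) (auto simp: min_def)
        then show "h (min t (grid m (Suc i))) - h (min t (grid m i)) \<le> \<eta>" by (simp add: dist_real_def)
        show "min t (grid m i) \<le> min t (grid m (Suc i))" by (rule min_grid_mono)
      qed (use t w h Q cell e1 \<eta> in \<open>auto intro: less_imp_le\<close>)
      also have "\<dots> < e" using e1 \<eta> e by linarith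
      finally show "\<bar>I t - I 0 - (\<Sum>i<N. p (w i) * (h (min t (grid m (Suc i))) - h (min t (grid m i))))\<bar> < e"
        using N t by (simp add: min_absorb1)
    qed
  qed
qed

section \<open>Riemann sums and hazard integrals\<close>

text \<open>The last two assumptions say that \<open>q\<close> is a nonnegative density of
  \<open>g\<close> without mentioning derivatives: the first lets \<open>q\<close> integrate like
  \<open>dg\<close>, the second bounds errors on a cell by the increment of
  \<open>g\<close>.\<close>

locale hazard_limits =
  fixes H H1 g q :: "real \<Rightarrow> real"
  assumes mono_H: "mono H" and cont_H: "continuous_on UNIV H" and H_0: "H 0 = 0" and H_lt_1: "\<And>u. H u < 1"
    and mono_H1: "mono H1" and cont_H1: "continuous_on UNIV H1" and H1_increment: "\<And>u v. H1 v - H1 u \<le> 1"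
    and g_def: "g = (\<lambda>u. 1 / (1 - H u))"
    and q_integrable: "\<And>c. q absolutely_integrable_on {0..c}"
    and integral_q: "\<And>u v. 0 \<le> u \<Longrightarrow> u \<le> v \<Longrightarrow> integral {u..v} q = g v - g u"
    and integral_abs_q: "\<And>u v. 0 \<le> u \<Longrightarrow> u \<le> v \<Longrightarrow> integral {u..v} (\<lambda>s. \<bar>q s\<bar>) = g v - g u"
begin

lemma g_mono: "u \<le> v \<Longrightarrow> g u \<le> g v"
  using monoD[OF mono_H, of u v] H_lt_1[of u] H_lt_1[of v] by (simp add: g_def frac_le)

lemma g_pos: "0 < g u" using H_lt_1[of u] by (simp add: g_def)

lemma g_0 [simp]: "g 0 = 1" by (simp add: g_def H_0)

lemma g_cont: "continuous_on UNIV g"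
  unfolding g_def using H_lt_1 cont_H by (intro continuous_intros) (auto simp: less_le)

definition hazard_lint :: "(real \<Rightarrow> real) \<Rightarrow> real \<Rightarrow> real" where
  "hazard_lint p t = (LINT u:{0<..t}|interval_measure H1. p u)"

text \<open>This is \<open>hazard_integral\<close> rewritten with \<open>g\<close>, using
  \<open>g 0 = 1\<close>.\<close>

definition parts_integral :: "(real \<Rightarrow> real) \<Rightarrow> real \<Rightarrow> real" where
  "parts_integral y t = y t * g t - y 0 - (LINT u:{0..t}|lebesgue. q u * y u)"

lemma emeasure_H1: "u \<le> v \<Longrightarrow> emeasure (interval_measure H1) {u<..v} = ennreal (H1 v - H1 u)"
  by (rule emeasure_interval_measure_Ioc)
    (use mono_H1 cont_H1 in \<open>auto simp: mono_def continuous_on_eq_continuous_at intro: continuous_at_imp_continuous_within\<close>)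

lemma measure_H1: "u \<le> v \<Longrightarrow> measure (interval_measure H1) {u<..v} = H1 v - H1 u"
  using emeasure_H1[of u v] monoD[OF mono_H1, of u v] by (simp add: measure_def)

lemma cadlag_set_integrable_H1:
  assumes p: "cadlag_fun p" and u: "0 \<le> u"
  shows "set_integrable (interval_measure H1) {u<..v} p"
proof (cases "u \<le> v")
  case True
  obtain B where B: "0 \<le> B" "\<And>t. 0 \<le> t \<Longrightarrow> t \<le> v \<Longrightarrow> \<bar>p t\<bar> \<le> B"
    using cadlag_fun_bounded[OF p] by blast
  have "set_integrable (interval_measure H1) {u<..v} (\<lambda>_. B)"
    using True by (simp add: set_integrable_def emeasure_H1)
  moreover have "set_borel_measurable (interval_measure H1) {u<..v} p"
  proof -
    have "(\<lambda>s. indicator {u<..v} s * (indicator {0..} s * p s)) \<in> borel_measurable borel"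
      by (intro borel_measurable_times borel_measurable_indicator cadlag_fun_measurable p) auto
    moreover have "indicator {u<..v} s * (indicator {0..} s * p s) = indicator {u<..v} s *\<^sub>R p s" for s
      using u by (auto simp: indicator_def)
    ultimately show ?thesis by (simp add: set_borel_measurable_def)
  qed
  ultimately show ?thesis
    by (rule set_integrable_bound) (use B u in auto)
qed (simp add: set_integrable_def)

lemma hazard_lint_cell:
  assumes p: "cadlag_fun p" and uv: "0 \<le> u" "u \<le> v" and w: "w \<in> {u..v}"
    and K: "\<And>a. a \<in> {u..v} \<Longrightarrow> \<bar>p a - p w\<bar> \<le> K"
  shows "\<bar>hazard_lint p v - hazard_lint p u - p w * (H1 v - H1 u)\<bar> \<le> K * (H1 v - H1 u)"
proof -
  let ?\<mu> = "interval_measure H1"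
  have fin: "emeasure ?\<mu> {u<..v} \<noteq> \<infinity>" using uv by (simp add: emeasure_H1)
  have int: "set_integrable ?\<mu> {u<..v} p" by (rule cadlag_set_integrable_H1[OF p uv(1)])
  have intc: "set_integrable ?\<mu> {u<..v} (\<lambda>_. c :: real)" for c
    using uv by (simp add: set_integrable_def emeasure_H1)
  have c: "(LINT a:{u<..v}|?\<mu>. c) = (H1 v - H1 u) * c" for c :: real
    using fin uv by (simp add: set_integral_const measure_H1)
  have "hazard_lint p v = (LINT a:{0<..u} \<union> {u<..v}|?\<mu>. p a)"
    unfolding hazard_lint_def using uv by (simp add: ivl_disj_un_two)
  also have "\<dots> = hazard_lint p u + (LINT a:{u<..v}|?\<mu>. p a)"
    unfolding hazard_lint_def by (rule set_integral_Un) (use int cadlag_set_integrable_H1[OF p] in auto)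
  finally have "hazard_lint p v - hazard_lint p u - p w * (H1 v - H1 u) = (LINT a:{u<..v}|?\<mu>. p a - p w)"
    using int intc c by simp
  also have "\<bar>\<dots>\<bar> \<le> (LINT a:{u<..v}|?\<mu>. \<bar>p a - p w\<bar>)"
    using set_integral_norm_bound[of ?\<mu> "{u<..v}" "\<lambda>a. p a - p w"] int intc by simp
  also have "\<dots> \<le> (LINT a:{u<..v}|?\<mu>. K)"
    by (rule set_integral_mono) (use int intc K in \<open>auto intro!: set_integrable_abs set_integral_diff\<close>)
  finally show ?thesis by (simp add: c mult.commute)
qed

lemma q_mult_integrable:
  assumes y: "cadlag_fun y"
  shows "(\<lambda>s. q s * y s) absolutely_integrable_on {0..c}"
proof -
  obtain B where B: "0 \<le> B" "\<And>t. 0 \<le> t \<Longrightarrow> t \<le> c \<Longrightarrow> \<bar>y t\<bar> \<le> B"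
    using cadlag_fun_bounded[OF y] by blast
  have "(\<lambda>s. indicator {0..} s * y s) \<in> borel_measurable lebesgue"
    using cadlag_fun_measurable[OF y] by (intro measurable_completion) simp
  then have "(\<lambda>s. indicator {0..} s * y s) \<in> borel_measurable (lebesgue_on {0..c})"
    by (rule measurable_restrict_space1)
  then have "y \<in> borel_measurable (lebesgue_on {0..c})"
    by (rule measurable_cong[THEN iffD1, rotated]) (simp add: space_restrict_space)
  moreover have "bounded (y ` {0..c})" using B(2) by (auto simp: bounded_real intro!: exI[of _ B])
  ultimately have "(\<lambda>s. y s * q s) absolutely_integrable_on {0..c}"
    by (intro absolutely_integrable_bounded_measurable_product_real q_integrable) auto
  then show ?thesis by (simp add: mult.commute)
qed

text \<open>The integral against \<open>q\<close> is treated as one against the continuous monotone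
  integrator \<open>g\<close>, so that the general grid bound applies to it.\<close>

lemma lint_q_cell:
  assumes y: "cadlag_fun y" and uv: "0 \<le> u" "u \<le> v" and w: "w \<in> {u..v}"
    and K: "\<And>a. a \<in> {u..v} \<Longrightarrow> \<bar>y a - y w\<bar> \<le> K"
  shows "\<bar>(LINT s:{0..v}|lebesgue. q s * y s) - (LINT s:{0..u}|lebesgue. q s * y s) - y w * (g v - g u)\<bar> \<le> K * (g v - g u)"
proof -
  have I: "(LINT s:{0..t}|lebesgue. q s * y s) = integral {0..t} (\<lambda>s. q s * y s)"
    and int0: "(\<lambda>s. q s * y s) integrable_on {0..t}" for t
    using set_lebesgue_integral_eq_integral[OF q_mult_integrable[OF y]] by auto
  have sub: "{u..v} \<subseteq> {0..v}" using uv by auto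
  have int: "(\<lambda>s. q s * y s) integrable_on {u..v}"
    by (rule integrable_on_subinterval[OF int0 sub])
  have qa: "q absolutely_integrable_on {u..v}"
    by (rule set_integrable_subset[OF q_integrable[of v] _ sub]) simp
  then have q: "q integrable_on {u..v}" "(\<lambda>s. \<bar>q s\<bar>) integrable_on {u..v}"
    by (auto simp: absolutely_integrable_on_def)
  have "integral {0..v} (\<lambda>s. q s * y s) = integral {0..u} (\<lambda>s. q s * y s) + integral {u..v} (\<lambda>s. q s * y s)"
    using Henstock_Kurzweil_Integration.integral_combine[OF uv int0] by simp
  then have "integral {0..v} (\<lambda>s. q s * y s) - integral {0..u} (\<lambda>s. q s * y s) - y w * (g v - g u)
      = integral {u..v} (\<lambda>s. q s * y s) - integral {u..v} (\<lambda>s. y w * q s)"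
    using integral_q[OF uv] by simp
  also have "\<dots> = integral {u..v} (\<lambda>s. q s * y s - y w * q s)"
    using int q by (intro integral_diff[symmetric]) (auto intro: integrable_on_mult_right)
  also have "norm \<dots> \<le> integral {u..v} (\<lambda>s. K * \<bar>q s\<bar>)"
  proof (rule Henstock_Kurzweil_Integration.integral_norm_bound_integral)
    show "norm (q s * y s - y w * q s) \<le> K * \<bar>q s\<bar>" if "s \<in> {u..v}" for s
    proof -
      have "norm (q s * y s - y w * q s) = \<bar>y s - y w\<bar> * \<bar>q s\<bar>"
        by (simp add: abs_mult[symmetric] algebra_simps)
      then show ?thesis using K[OF that] by (simp add: mult_right_mono)
    qed
  qed (use int q in \<open>auto intro: integrable_on_mult_right integrable_diff\<close>)
  finally show ?thesis using integral_abs_q[OF uv] by (simp add: I)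
qed

lemma hazard_lint_limit:
  assumes p: "cadlag_fun p" and m: "filterlim m sequentially F"
  shows "uniform_limit {0..b} (\<lambda>n. riemann_sum (m n) p H1) (hazard_lint p) F"
proof (cases "0 \<le> b")
  case b: True
  have "uniform_limit {0..b} (\<lambda>m. riemann_sum m p H1) (hazard_lint p) sequentially"
  proof (rule uniform_limitI)
    fix e :: real assume e: "0 < e"
    obtain k where k: "b \<le> real k" by (meson real_arch_simple)
    have "\<forall>\<^sub>F m in sequentially. \<forall>t\<in>{0..b}. \<forall>w N. (\<forall>i. w i \<in> {min t (grid m i)..min t (grid m (Suc i))}) \<and> t \<le> grid m N \<longrightarrow>
      \<bar>hazard_lint p t - hazard_lint p 0 - (\<Sum>i<N. p (w i) * (H1 (min t (grid m (Suc i))) - H1 (min t (grid m i))))\<bar> < e"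
      by (rule eventually_integrator_grid_bound[OF p _ _ _ e b])
        (use mono_H1 cont_H1 hazard_lint_cell[OF p] in \<open>auto intro: monoD continuous_on_subset\<close>)
    then show "\<forall>\<^sub>F m in sequentially. \<forall>t\<in>{0..b}. dist (riemann_sum m p H1 t) (hazard_lint p t) < e"
    proof eventually_elim
      case (elim m)
      show ?case
      proof
        fix t assume t: "t \<in> {0..b}"
        then have tN: "0 \<le> t" "t \<le> grid m (k * Suc m)" using k unfolding grid_mult by auto
        have "\<bar>hazard_lint p t - hazard_lint p 0 - riemann_sum m p H1 t\<bar> < e"
          unfolding riemann_sum_eq[OF tN]
          by (rule elim[rule_format, OF t, of "\<lambda>i. min t (grid m i)"])
            (use tN(2) min_grid_mono in auto)
        moreover have "hazard_lint p 0 = 0" by (simp add: hazard_lint_def set_lebesgue_integral_def)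
        ultimately show "dist (riemann_sum m p H1 t) (hazard_lint p t) < e"
          by (simp add: dist_real_def abs_minus_commute)
      qed
    qed
  qed
  then show ?thesis by (rule filterlim_compose[OF _ m])
qed simp

text \<open>Summation by parts turns the left-endpoint sum of \<open>g\<close> against
  \<open>y\<close> into boundary terms minus the right-endpoint sum of \<open>y\<close> against
  \<open>g\<close>. The latter converges although \<open>y\<close> may have infinite variation,
  because \<open>g\<close> is continuous and monotone.\<close>

lemma parts_integral_limit:
  assumes y: "cadlag_fun y" and m: "filterlim m sequentially F"
  shows "uniform_limit {0..b} (\<lambda>n. riemann_sum (m n) g y) (parts_integral y) F"
proof (cases "0 \<le> b")
  case b: True
  define I where "I t = (LINT s:{0..t}|lebesgue. q s * y s)" for t
  have "uniform_limit {0..b} (\<lambda>m. riemann_sum m g y) (parts_integral y) sequentially"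
  proof (rule uniform_limitI)
    fix e :: real assume e: "0 < e"
    obtain k where k: "b \<le> real k" by (meson real_arch_simple)
    have "\<forall>\<^sub>F m in sequentially. \<forall>t\<in>{0..b}. \<forall>w N. (\<forall>i. w i \<in> {min t (grid m i)..min t (grid m (Suc i))}) \<and> t \<le> grid m N \<longrightarrow>
      \<bar>I t - I 0 - (\<Sum>i<N. y (w i) * (g (min t (grid m (Suc i))) - g (min t (grid m i))))\<bar> < e"
      by (rule eventually_integrator_grid_bound[OF y _ _ _ e b])
        (use g_mono g_cont lint_q_cell[OF y] in \<open>auto simp: I_def intro: continuous_on_subset\<close>)
    then show "\<forall>\<^sub>F m in sequentially. \<forall>t\<in>{0..b}. dist (riemann_sum m g y t) (parts_integral y t) < e"
    proof eventually_elim
      case (elim m)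
      show ?case
      proof
        fix t assume t: "t \<in> {0..b}"
        define N where "N = k * Suc m"
        have tN: "0 \<le> t" "t \<le> grid m N" using t k unfolding N_def grid_mult by auto
        let ?s = "\<lambda>i. min t (grid m i)"
        have "\<bar>I t - I 0 - (\<Sum>i<N. y (?s (Suc i)) * (g (?s (Suc i)) - g (?s i)))\<bar> < e"
          by (rule elim[rule_format, OF t, of "\<lambda>i. min t (grid m (Suc i))"])
            (use tN(2) min_grid_mono in auto)
        moreover have "(\<Sum>i<n. y (?s (Suc i)) * (g (?s (Suc i)) - g (?s i))) =
          y (?s n) * g (?s n) - y (?s 0) * g (?s 0) - (\<Sum>i<n. g (?s i) * (y (?s (Suc i)) - y (?s i)))" for n
          by (induction n) (simp_all add: algebra_simps)
        then have "(\<Sum>i<N. y (?s (Suc i)) * (g (?s (Suc i)) - g (?s i))) = y t * g t - y 0 - riemann_sum m g y t"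
          unfolding riemann_sum_eq[OF tN] using tN by (simp add: min_absorb1)
        moreover have "I 0 = integral {0..0} (\<lambda>s. q s * y s)"
          unfolding I_def by (rule set_lebesgue_integral_eq_integral(2)[OF q_mult_integrable[OF y]])
        then have "I 0 = 0" by simp
        ultimately show "dist (riemann_sum m g y t) (parts_integral y t) < e"
          unfolding parts_integral_def I_def dist_real_def by linarith
      qed
    qed
  qed
  then show ?thesis by (rule filterlim_compose[OF _ m])
qed simp

end

text \<open>Stopping at \<open>t\<close> cuts at most one cell; the increment over that cell is at
  most \<open>B\<close>.\<close>

lemma stopped_variation_le:
  assumes t: "0 \<le> t" "t \<le> b" and B: "\<And>u v. u \<in> {0..b} \<Longrightarrow> v \<in> {0..b} \<Longrightarrow> \<bar>y u - y v\<bar> \<le> (B :: real)"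
  shows "(\<Sum>i<N. \<bar>y (min t (grid m (Suc i))) - y (min t (grid m i))\<bar>)
    \<le> (\<Sum>i<N. \<bar>y (grid m (Suc i)) - y (grid m i)\<bar>) + B"
proof -
  have B0: "0 \<le> B" using B[of 0 0] t by simp
  have "(\<Sum>i<N. \<bar>y (min t (grid m (Suc i))) - y (min t (grid m i))\<bar>)
    \<le> (\<Sum>i<N. \<bar>y (grid m (Suc i)) - y (grid m i)\<bar>) + (if t < grid m N then B else 0)"
  proof (induction N)
    case (Suc N)
    have le: "grid m N \<le> grid m (Suc N)" by simp
    consider "t < grid m N" | "grid m N \<le> t" "t < grid m (Suc N)" | "grid m (Suc N) \<le> t" by linarith
    then show ?case
    proof cases
      case 1
      then show ?thesis using Suc min_grid_absorb[of t m N] less_le_trans[OF 1 le] by simp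
    next
      case 2
      then have "\<bar>y (min t (grid m (Suc N))) - y (min t (grid m N))\<bar> \<le> B"
        using t by (intro B) (auto simp: min_def)
      moreover have "0 \<le> \<bar>y (grid m (Suc N)) - y (grid m N)\<bar>" by simp
      ultimately show ?thesis using Suc 2 unfolding sum.lessThan_Suc by simp
    next
      case 3
      then have mins: "min t (grid m (Suc N)) = grid m (Suc N)" "min t (grid m N) = grid m N"
        using min_absorb2[OF order_trans[OF le 3]] by auto
      show ?thesis using Suc 3 order_trans[OF le 3] unfolding sum.lessThan_Suc mins by simp
    qed
  qed (use t in simp)
  also have "\<dots> \<le> (\<Sum>i<N. \<bar>y (grid m (Suc i)) - y (grid m i)\<bar>) + B" using B0 by simp
  finally show ?thesis .
qed

lemma uniform_limit_scaled:
  assumes f: "uniform_limit S f l F" and a: "(a \<longlongrightarrow> (0 :: real)) F" and B: "\<And>u. u \<in> S \<Longrightarrow> \<bar>l u\<bar> \<le> (B :: real)"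
  shows "uniform_limit S (\<lambda>n u. a n * f n u) (\<lambda>_. 0) F"
proof -
  have "uniform_limit S (\<lambda>n _. a n) (\<lambda>_. 0) F"
    by (rule uniform_limitI) (use tendstoD[OF a] in \<open>auto elim: eventually_mono\<close>)
  moreover have "bounded (l ` S)" using B by (auto simp: bounded_real intro!: exI[of _ B])
  ultimately have "uniform_limit S (\<lambda>n u. a n * f n u) (\<lambda>u. 0 * l u) F"
    by (intro uniform_lim_mult f) (auto simp: bounded_iff)
  then show ?thesis by simp
qed

section \<open>First-order expansion of the estimator\<close>

context hazard_limits begin

lemma variation_H1:
  assumes s: "\<And>i. s i \<le> s (Suc i)"
  shows "(\<Sum>i<N. \<bar>H1 (s (Suc i)) - H1 (s i)\<bar>) \<le> 1"
proof -
  have "(\<Sum>i<N. \<bar>H1 (s (Suc i)) - H1 (s i)\<bar>) = (\<Sum>i<N. H1 (s (Suc i)) - H1 (s i))"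
    using monoD[OF mono_H1 s] by (intro sum.cong) auto
  also have "\<dots> = H1 (s N) - H1 (s 0)" by (rule sum_lessThan_telescope)
  finally show ?thesis using H1_increment by simp
qed

text \<open>On \<open>[0, b]\<close> the survival function \<open>1 - H\<close> is at least
  \<open>1 - H b > 0\<close>, so the clip at \<open>c n\<close> is eventually inactive. The second
  claim is then the identity \<open>1 / W - 1 / V = (V - W) / (V * W)\<close> with
  \<open>V = 1 - H\<close>.\<close>

lemma inverse_survival_limit:
  assumes x: "cadlag_fun x" and xs: "uniform_limit {0..b} xs x F"
    and a: "(a \<longlongrightarrow> 0) F" and c: "(c \<longlongrightarrow> 0) F" "\<forall>\<^sub>F n in F. 0 < c n"
  defines "G \<equiv> \<lambda>n u. 1 / max (c n) (1 - (H u + a n * xs n u))"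
  shows "uniform_limit {0..b} G g F"
    and "\<forall>\<^sub>F n in F. \<forall>u\<in>{0..b}. G n u = g u + a n * (xs n u * (G n u * g u))"
proof -
  obtain B where B: "\<And>t. t \<in> {0..b} \<Longrightarrow> \<bar>x t\<bar> \<le> B"
    by (rule cadlag_fun_bounded[OF x, of b], rule that) auto
  have ax: "uniform_limit {0..b} (\<lambda>n u. a n * xs n u) (\<lambda>_. 0) F"
    by (rule uniform_limit_scaled[OF xs a B])
  define \<kappa> where "\<kappa> = 1 - H b"
  have \<kappa>: "0 < \<kappa>" "\<And>u. u \<in> {0..b} \<Longrightarrow> \<kappa> \<le> 1 - H u"
    using H_lt_1 monoD[OF mono_H] by (auto simp: \<kappa>_def)
  define W where "W n u = max (c n) (1 - (H u + a n * xs n u))" for n u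
  have clip: "\<forall>\<^sub>F n in F. \<forall>u\<in>{0..b}. W n u = 1 - (H u + a n * xs n u)"
  proof -
    have "\<forall>\<^sub>F n in F. \<forall>u\<in>{0..b}. dist (a n * xs n u) 0 < \<kappa> / 2"
      by (rule uniform_limitD[OF ax]) (use \<kappa> in simp)
    moreover have "\<forall>\<^sub>F n in F. c n < \<kappa> / 2" by (rule order_tendstoD[OF c(1)]) (use \<kappa> in simp)
    ultimately show ?thesis
    proof eventually_elim
      case (elim n)
      show ?case
      proof
        fix u assume u: "u \<in> {0..b}"
        show "W n u = 1 - (H u + a n * xs n u)"
          using elim(1)[rule_format, OF u] elim(2) \<kappa>(2)[OF u] unfolding W_def dist_real_def by linarith
      qed
    qed
  qed
  have "uniform_limit {0..b} (\<lambda>n u. 1 - H u - a n * xs n u) (\<lambda>u. 1 - H u - 0) F"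
    by (intro uniform_limit_minus uniform_limit_const ax)
  then have W: "uniform_limit {0..b} W (\<lambda>u. 1 - H u) F"
    by (subst uniform_limit_cong[OF clip]) (auto simp: algebra_simps)
  have "uniform_limit {0..b} (\<lambda>n u. inverse (W n u)) (inverse \<circ> (\<lambda>u. 1 - H u)) F"
    by (rule uniform_lim_inverse[OF W _ \<kappa>(1)]) (use \<kappa>(2) H_lt_1 in \<open>auto simp: abs_of_pos\<close>)
  then show "uniform_limit {0..b} G g F"
    by (simp add: G_def W_def g_def inverse_eq_divide comp_def)
  show "\<forall>\<^sub>F n in F. \<forall>u\<in>{0..b}. G n u = g u + a n * (xs n u * (G n u * g u))"
    using clip c(2)
  proof eventually_elim
    case (elim n)
    show ?case
    proof
      fix u assume u: "u \<in> {0..b}"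
      have Wpos: "0 < W n u" using elim(2) by (simp add: W_def)
      have eq: "a n * xs n u = (1 - H u) - W n u" using elim(1) u by simp
      have Gg: "G n u = 1 / W n u" "g u = 1 / (1 - H u)" by (simp_all add: G_def W_def g_def)
      have "a n * (xs n u * (G n u * g u)) = (a n * xs n u) * (G n u * g u)" by simp
      also have "\<dots> = G n u - g u"
        unfolding eq Gg using Wpos H_lt_1[of u] by (simp add: field_simps)
      finally show "G n u = g u + a n * (xs n u * (G n u * g u))" by simp
    qed
  qed
qed

definition limit_process :: "(real \<Rightarrow> real) \<Rightarrow> (real \<Rightarrow> real) \<Rightarrow> real \<Rightarrow> real" where
  "limit_process x x1 t = parts_integral x1 t + hazard_lint (\<lambda>u. x u * (g u * g u)) t"

lemma cadlag_fun_g: "cadlag_fun g" by (rule cadlag_fun_continuous[OF g_cont])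

text \<open>The expansion \<open>G n = g + a n * P n\<close> is exact, and bilinearity of Riemann
  sums leaves four terms after division by \<open>a n\<close>. Hypothesis \<open>err\<close> demands
  a mesh that is fine relative to \<open>a n\<close>, since the deterministic discretisation error
  is multiplied by \<open>inverse (a n)\<close>.\<close>

lemma nelson_aalen_functional_limit:
  assumes x: "cadlag_fun x" and x1: "cadlag_fun x1"
    and xs: "uniform_limit {0..b} xs x F" and x1s: "uniform_limit {0..b} x1s x1 F"
    and a: "(a \<longlongrightarrow> 0) F" "\<forall>\<^sub>F n in F. 0 < a n" and c: "(c \<longlongrightarrow> 0) F" "\<forall>\<^sub>F n in F. 0 < c n"
    and m: "filterlim m sequentially F" and N: "\<And>n. b \<le> grid (m n) (N n)"
    and V: "\<forall>\<^sub>F n in F. (\<Sum>i<N n. \<bar>(H1 (grid (m n) (Suc i)) + a n * x1s n (grid (m n) (Suc i))) -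
       (H1 (grid (m n) i) + a n * x1s n (grid (m n) i))\<bar>) \<le> 2"
    and err: "uniform_limit {0..b} (\<lambda>n t. inverse (a n) * (riemann_sum (m n) g H1 t - hazard_lint g t)) (\<lambda>_. 0) F"
  shows "uniform_limit {0..b} (\<lambda>n t. inverse (a n) *
      (riemann_sum (m n) (\<lambda>u. 1 / max (c n) (1 - (H u + a n * xs n u))) (\<lambda>u. H1 u + a n * x1s n u) t - hazard_lint g t))
      (limit_process x x1) F"
proof -
  define G where "G = (\<lambda>n u. 1 / max (c n) (1 - (H u + a n * xs n u)))"
  define P where "P n u = xs n u * (G n u * g u)" for n u
  define p where "p u = x u * (g u * g u)" for u
  define z where "z n u = a n * x1s n u" for n u
  have p: "cadlag_fun p" unfolding p_def by (intro cadlag_fun_mult x cadlag_fun_g)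
  obtain B where B: "\<And>t. t \<in> {0..b} \<Longrightarrow> \<bar>x t\<bar> \<le> B" by (rule cadlag_fun_bounded[OF x, of b], rule that) auto
  obtain B1 where B1: "\<And>t. t \<in> {0..b} \<Longrightarrow> \<bar>x1 t\<bar> \<le> B1" by (rule cadlag_fun_bounded[OF x1, of b], rule that) auto
  have gB: "\<bar>g t\<bar> \<le> g b" if "t \<in> {0..b}" for t
    using g_mono[of t b] g_pos[of t] that by auto
  have G: "uniform_limit {0..b} G g F"
    and G_eq: "\<forall>\<^sub>F n in F. \<forall>u\<in>{0..b}. G n u = g u + a n * P n u"
    using inverse_survival_limit[OF x xs a(1) c] unfolding G_def P_def by auto
  have bddg: "bounded (g ` {0..b})" using gB by (auto simp: bounded_real intro!: exI[of _ "g b"])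
  have "\<bar>g u * g u\<bar> \<le> g b * g b" if "u \<in> {0..b}" for u
    unfolding abs_mult using gB[OF that] g_pos[of b] by (intro mult_mono) auto
  then have bddgg: "bounded ((\<lambda>u. g u * g u) ` {0..b})"
    by (auto simp: bounded_real intro!: exI[of _ "g b * g b"])
  have bddx: "bounded (x ` {0..b})" using B by (auto simp: bounded_real intro!: exI[of _ B])
  have P: "uniform_limit {0..b} P p F"
    unfolding P_def p_def by (intro uniform_lim_mult uniform_limit_const xs G bddg bddx bddgg)
  have Pp: "uniform_limit {0..b} (\<lambda>n u. P n u - p u) (\<lambda>_. 0) F"
    using uniform_limit_minus[OF P uniform_limit_const[where c = p]] by simp
  have z: "uniform_limit {0..b} z (\<lambda>_. 0) F"
    unfolding z_def by (rule uniform_limit_scaled[OF x1s a(1) B1])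
  \<comment> \<open>The 6 is 2 from \<open>V\<close>, plus 3 for the cell cut by stopping
    (\<open>H1\<close> moves by at most 1, and \<open>z n\<close> is below 1 in absolute value at
    both ends), plus 1 for subtracting \<open>H1\<close>.\<close>
  have Vz: "\<forall>\<^sub>F n in F. \<forall>t\<in>{0..b}.
    (\<Sum>i<N n. \<bar>z n (min t (grid (m n) (Suc i))) - z n (min t (grid (m n) i))\<bar>) \<le> 6"
    using uniform_limitD[OF z zero_less_one] V
  proof eventually_elim
    case (elim n)
    show ?case
    proof
      fix t assume t: "t \<in> {0..b}"
      let ?s = "\<lambda>i. min t (grid (m n) i)"
      define K where "K u = H1 u + z n u" for u
      have K: "\<bar>K u - K v\<bar> \<le> 3" if "u \<in> {0..b}" "v \<in> {0..b}" for u v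
        using elim(1)[rule_format, OF that(1)] elim(1)[rule_format, OF that(2)] H1_increment[of u v] H1_increment[of v u]
        unfolding K_def dist_real_def by linarith
      have "(\<Sum>i<N n. \<bar>z n (?s (Suc i)) - z n (?s i)\<bar>)
          \<le> (\<Sum>i<N n. \<bar>K (?s (Suc i)) - K (?s i)\<bar> + \<bar>H1 (?s (Suc i)) - H1 (?s i)\<bar>)"
        unfolding K_def by (rule sum_mono) linarith
      also have "\<dots> = (\<Sum>i<N n. \<bar>K (?s (Suc i)) - K (?s i)\<bar>) + (\<Sum>i<N n. \<bar>H1 (?s (Suc i)) - H1 (?s i)\<bar>)"
        by (rule sum.distrib)
      also have "\<dots> \<le> (\<Sum>i<N n. \<bar>K (grid (m n) (Suc i)) - K (grid (m n) i)\<bar>) + 3 + 1"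
        by (intro add_mono stopped_variation_le[where b = b] variation_H1 min_grid_mono K) (use t in auto)
      also have "\<dots> \<le> 6" using elim(2) by (simp add: K_def z_def)
      finally show "(\<Sum>i<N n. \<bar>z n (?s (Suc i)) - z n (?s i)\<bar>) \<le> 6" .
    qed
  qed
  have T1: "uniform_limit {0..b} (\<lambda>n. riemann_sum (m n) g (x1s n)) (parts_integral x1) F"
  proof -
    have "uniform_limit {0..b} (\<lambda>n u. x1s n u - x1 u) (\<lambda>_. 0) F"
      using uniform_limit_minus[OF x1s uniform_limit_const[where c = x1]] by simp
    then have "uniform_limit {0..b} (\<lambda>n. riemann_sum (m n) g (\<lambda>u. x1s n u - x1 u)) (\<lambda>_. 0) F"
      by (rule uniform_limit_riemann_sum_mono_left[rotated]) (rule g_mono)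
    from uniform_limit_add[OF this parts_integral_limit[OF x1 m, of b]]
    show ?thesis by (simp add: riemann_sum_diff_right)
  qed
  \<comment> \<open>Split \<open>P n\<close> into \<open>P n - p\<close>, which is uniformly small,
    and the fixed cadlag \<open>p\<close>, against which the integrator \<open>z n\<close> is
    uniformly small.\<close>
  have T2: "uniform_limit {0..b} (\<lambda>n. riemann_sum (m n) (P n) (z n)) (\<lambda>_. 0) F"
    using uniform_limit_add[OF uniform_limit_riemann_sum_bounded_variation[OF Pp Vz N]
        uniform_limit_riemann_sum_cadlag_left[OF p z Vz N]]
    by (simp add: riemann_sum_diff_left)
  have T3: "uniform_limit {0..b} (\<lambda>n. riemann_sum (m n) (P n) H1) (hazard_lint p) F"
  proof -
    have "uniform_limit {0..b} (\<lambda>n. riemann_sum (m n) (\<lambda>u. P n u - p u) H1) (\<lambda>_. 0) F"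
      by (rule uniform_limit_riemann_sum_bounded_variation[where C = 1, OF Pp _ N])
        (intro always_eventually allI ballI variation_H1 min_grid_mono)
    from uniform_limit_add[OF this hazard_lint_limit[OF p m, of b]]
    show ?thesis by (simp add: riemann_sum_diff_left)
  qed
  have sum_lim: "uniform_limit {0..b} (\<lambda>n t. riemann_sum (m n) g (x1s n) t + riemann_sum (m n) (P n) (z n) t
      + riemann_sum (m n) (P n) H1 t + inverse (a n) * (riemann_sum (m n) g H1 t - hazard_lint g t))
      (\<lambda>t. parts_integral x1 t + 0 + hazard_lint p t + 0) F"
    by (intro uniform_limit_add T1 T2 T3 err)
  have sum_eq: "\<forall>\<^sub>F n in F. \<forall>t\<in>{0..b}. inverse (a n) *
      (riemann_sum (m n) (G n) (\<lambda>u. H1 u + a n * x1s n u) t - hazard_lint g t) =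
      riemann_sum (m n) g (x1s n) t + riemann_sum (m n) (P n) (z n) t
      + riemann_sum (m n) (P n) H1 t + inverse (a n) * (riemann_sum (m n) g H1 t - hazard_lint g t)"
    using G_eq a(2)
  proof eventually_elim
    case (elim n)
    show ?case
    proof
      fix t assume t: "t \<in> {0..b}"
      have "riemann_sum (m n) (G n) (\<lambda>u. H1 u + a n * x1s n u) t =
        riemann_sum (m n) (\<lambda>u. g u + a n * P n u) (\<lambda>u. H1 u + a n * x1s n u) t"
        by (rule riemann_sum_cong) (use elim(1) t in auto)
      also have "\<dots> = riemann_sum (m n) g H1 t + a n * riemann_sum (m n) g (x1s n) t
        + a n * riemann_sum (m n) (P n) H1 t + a n * riemann_sum (m n) (P n) (z n) t"
        unfolding z_def by (simp add: riemann_sum_add_left riemann_sum_add_right riemann_sum_mult_left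
            riemann_sum_mult_right algebra_simps)
      finally show "inverse (a n) *
        (riemann_sum (m n) (G n) (\<lambda>u. H1 u + a n * x1s n u) t - hazard_lint g t) =
        riemann_sum (m n) g (x1s n) t + riemann_sum (m n) (P n) (z n) t
        + riemann_sum (m n) (P n) H1 t + inverse (a n) * (riemann_sum (m n) g H1 t - hazard_lint g t)"
        using elim(2) by (simp add: field_simps)
    qed
  qed
  have "parts_integral x1 t + 0 + hazard_lint p t + 0 = limit_process x x1 t" for t
    by (simp add: limit_process_def p_def[abs_def])
  then show ?thesis
    using uniform_limit_cong[OF sum_eq, of "limit_process x x1" "limit_process x x1"] sum_lim
    by (simp only: G_def)
qed

end

section \<open>Continuity and measurability of the functionals\<close>

lemma mspace_max_metric [simp]: "mspace (max_metric m1 m2) = mspace m1 \<times> mspace m2"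
  and mdist_max_metric [simp]: "mdist (max_metric m1 m2) p q = max (mdist m1 (fst p) (fst q)) (mdist m2 (snd p) (snd q))"
  unfolding max_metric_def
  by (simp_all add: Metric_space.mspace_metric Metric_space.mdist_metric Metric_space_max)

lemma limitin_max_metric:
  "limitin (mtopology_of (max_metric m1 m2)) z x F \<longleftrightarrow>
    limitin (mtopology_of m1) (\<lambda>k. fst (z k)) (fst x) F \<and> limitin (mtopology_of m2) (\<lambda>k. snd (z k)) (snd x) F"
  unfolding limitin_mtopology_of mspace_max_metric mdist_max_metric
  by (auto simp: mem_Times_iff eventually_conj_iff)

text \<open>Here \<open>t\<close> enters through the stopped integrator only, so regularity in
  \<open>t\<close> is inherited from \<open>y\<close> whatever \<open>p\<close> is.\<close>

lemma riemann_sum_eq_grid: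
  assumes t: "0 \<le> t" "t \<le> grid m N"
  shows "riemann_sum m p y t =
    (\<Sum>i<N. p (grid m i) * (y (min t (grid m (Suc i))) - y (min t (grid m i))))"
  unfolding riemann_sum_eq[OF t]
proof (rule sum.cong[OF refl])
  fix i
  show "p (min t (grid m i)) * (y (min t (grid m (Suc i))) - y (min t (grid m i))) =
    p (grid m i) * (y (min t (grid m (Suc i))) - y (min t (grid m i)))"
    using min_grid_absorb[of t m i] by (cases "t \<le> grid m i") (auto simp: min_absorb2)
qed

lemma cadlag_fun_local:
  assumes "\<And>b. 0 \<le> b \<Longrightarrow> \<exists>h. cadlag_fun h \<and> (\<forall>t\<in>{0..b}. f t = h t)"
  shows "cadlag_fun f"
  unfolding cadlag_fun_def
proof (intro conjI allI impI)
  fix t :: real assume t: "0 \<le> t"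
  obtain h where h: "cadlag_fun h" "\<forall>u\<in>{0..t+1}. f u = h u" using assms[of "t + 1"] t by auto
  have "(h \<longlongrightarrow> h t) (at_right t)" using h t by (simp add: cadlag_fun_def continuous_within)
  moreover have "\<forall>\<^sub>F u in at_right t. h u = f u"
    by (rule eventually_mono[OF eventually_at_right_real[of t "t + 1"]]) (use h t in auto)
  ultimately have "(f \<longlongrightarrow> h t) (at_right t)" by (rule Lim_transform_eventually)
  then show "continuous (at_right t) f" using t h by (simp add: continuous_within)
next
  fix t :: real assume t: "0 < t"
  obtain h where h: "cadlag_fun h" "\<forall>u\<in>{0..t}. f u = h u" using assms[of t] t by auto
  then obtain l where "(h \<longlongrightarrow> l) (at_left t)" using t by (auto simp: cadlag_fun_def)
  moreover have "\<forall>\<^sub>F u in at_left t. h u = f u"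
    using eventually_at_left_real[OF t] by eventually_elim (use h in auto)
  ultimately show "\<exists>l. (f \<longlongrightarrow> l) (at_left t)" by (blast intro: Lim_transform_eventually)
qed

lemma cadlag_fun_riemann_sum:
  assumes y: "cadlag_fun y" shows "cadlag_fun (riemann_sum m p y)"
proof (rule cadlag_fun_local)
  fix b :: real assume "0 \<le> b"
  obtain k where k: "b \<le> real k" by (meson real_arch_simple)
  let ?h = "\<lambda>t. \<Sum>i<k * Suc m. p (grid m i) * (y (min t (grid m (Suc i))) - y (min t (grid m i)))"
  have "cadlag_fun ?h"
    by (rule cadlag_fun_sum) (intro cadlag_fun_mult[OF cadlag_fun_const cadlag_fun_diff] cadlag_fun_stop[OF y] grid_nonneg)
  moreover have "\<forall>t\<in>{0..b}. riemann_sum m p y t = ?h t"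
  proof
    fix t assume "t \<in> {0..b}"
    then show "riemann_sum m p y t = ?h t"
      using k by (intro riemann_sum_eq_grid) (auto simp only: grid_mult atLeastAtMost_iff)
  qed
  ultimately show "\<exists>h. cadlag_fun h \<and> (\<forall>t\<in>{0..b}. riemann_sum m p y t = h t)" by blast
qed

text \<open>Increments of \<open>I\<close> are at most \<open>3 * B\<close> times those of
  \<open>h\<close>: \<open>2 * B\<close> for the oscillation of \<open>p\<close> on the interval and
  \<open>B\<close> for its value at the left end. Hence \<open>I\<close> is even continuous on the
  half-line.\<close>

lemma cadlag_fun_integrator:
  assumes p: "cadlag_fun p" and h: "continuous_on UNIV h" "\<And>u v. u \<le> v \<Longrightarrow> h u \<le> h v"
    and cell: "\<And>u v w K. 0 \<le> u \<Longrightarrow> u \<le> v \<Longrightarrow> w \<in> {u..v} \<Longrightarrow> (\<And>a. a \<in> {u..v} \<Longrightarrow> \<bar>p a - p w\<bar> \<le> K)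
       \<Longrightarrow> \<bar>I v - I u - p w * (h v - h u)\<bar> \<le> K * (h v - h u)"
  shows "cadlag_fun I"
proof (rule cadlag_fun_local)
  fix b :: real assume b: "0 \<le> b"
  obtain B where B: "0 \<le> B" "\<And>t. 0 \<le> t \<Longrightarrow> t \<le> b \<Longrightarrow> \<bar>p t\<bar> \<le> B"
    by (rule cadlag_fun_bounded[OF p, of b], rule that)
  have le: "\<bar>I v - I u\<bar> \<le> \<bar>h v - h u\<bar> * (3 * B)" if "0 \<le> u" "u \<le> v" "v \<le> b" for u v
  proof -
    have hm: "h u \<le> h v" using h(2) that by simp
    have "\<bar>I v - I u - p u * (h v - h u)\<bar> \<le> (2 * B) * (h v - h u)"
    proof (rule cell)
      fix a assume "a \<in> {u..v}"
      then show "\<bar>p a - p u\<bar> \<le> 2 * B" using B(2)[of a] B(2)[of u] that by auto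
    qed (use that in auto)
    moreover have "\<bar>p u * (h v - h u)\<bar> \<le> B * (h v - h u)"
      unfolding abs_mult using B(2)[of u] that hm by (intro mult_mono) auto
    ultimately show ?thesis using hm by (simp add: algebra_simps)
  qed
  have le2: "\<bar>I v - I u\<bar> \<le> \<bar>h v - h u\<bar> * (3 * B)" if "u \<in> {0..b}" "v \<in> {0..b}" for u v
    using le[of u v] le[of v u] that by (cases "u \<le> v") (auto simp: abs_minus_commute)
  have "continuous_on {0..b} I" unfolding continuous_on_def
  proof
    fix x assume x: "x \<in> {0..b}"
    have "(h \<longlongrightarrow> h x) (at x within {0..b})"
      using h(1) x by (meson continuous_on_def continuous_on_subset subset_UNIV)
    then have "((\<lambda>u. h u - h x) \<longlongrightarrow> 0) (at x within {0..b})" by (simp add: LIM_zero)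
    then have "((\<lambda>u. I u - I x) \<longlongrightarrow> 0) (at x within {0..b})"
      by (rule tendsto_0_le[where K = "3 * B"])
        (use le2[OF x] in \<open>auto simp: eventually_at_filter intro!: always_eventually\<close>)
    then show "(I \<longlongrightarrow> I x) (at x within {0..b})" by (rule LIM_zero_cancel)
  qed
  then have "continuous_on UNIV (\<lambda>t. I (max 0 (min t b)))"
    by (rule continuous_on_compose2) (use b in \<open>auto intro!: continuous_intros\<close>)
  then show "\<exists>h. cadlag_fun h \<and> (\<forall>t\<in>{0..b}. I t = h t)"
    by (intro exI[of _ "\<lambda>t. I (max 0 (min t b))"] conjI cadlag_fun_continuous) auto
qed

lemma uniform_limit_sum_real:
  assumes "\<And>i. i \<in> I \<Longrightarrow> uniform_limit S (\<lambda>n. f n i) (l i) F"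
  shows "uniform_limit S (\<lambda>n t. \<Sum>i\<in>I. f n i t) (\<lambda>t. \<Sum>i\<in>I. l i t :: real) F"
  using assms by (induction I rule: infinite_finite_induct) (auto intro: uniform_limit_add uniform_limit_const)

text \<open>With the mesh fixed, only finitely many integrand values matter on
  \<open>[0, b]\<close>, so pointwise convergence of the integrands is enough.\<close>

lemma uniform_limit_riemann_sum_fixed_mesh:
  assumes p: "\<And>i. ((\<lambda>n. p n (grid m i)) \<longlongrightarrow> l (grid m i)) F"
    and y: "uniform_limit {0..b} y z F" and z: "cadlag_fun z"
  shows "uniform_limit {0..b} (\<lambda>n. riemann_sum m (p n) (y n)) (riemann_sum m l z) F"
proof -
  obtain B where B: "0 \<le> B" "\<And>t. 0 \<le> t \<Longrightarrow> t \<le> b \<Longrightarrow> \<bar>z t\<bar> \<le> B"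
    by (rule cadlag_fun_bounded[OF z, of b], rule that)
  obtain k where k: "b \<le> real k" by (meson real_arch_simple)
  have eq: "riemann_sum m p y t = (\<Sum>i<k * Suc m. p (grid m i) * (y (min t (grid m (Suc i))) - y (min t (grid m i))))"
    if "t \<in> {0..b}" for p y t
    using k that by (intro riemann_sum_eq_grid) (auto simp only: grid_mult atLeastAtMost_iff)
  have stop: "uniform_limit {0..b} (\<lambda>n t. y n (min t (grid m i))) (\<lambda>t. z (min t (grid m i))) F" for i
  proof (rule uniform_limitI)
    fix e :: real assume "0 < e"
    with y have "\<forall>\<^sub>F n in F. \<forall>t\<in>{0..b}. dist (y n t) (z t) < e" by (rule uniform_limitD)
    then show "\<forall>\<^sub>F n in F. \<forall>t\<in>{0..b}. dist (y n (min t (grid m i))) (z (min t (grid m i))) < e"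
      by eventually_elim (auto simp: min_le_iff_disj)
  qed
  have "uniform_limit {0..b} (\<lambda>n t. \<Sum>i<k * Suc m. p n (grid m i) * (y n (min t (grid m (Suc i))) - y n (min t (grid m i))))
     (\<lambda>t. \<Sum>i<k * Suc m. l (grid m i) * (z (min t (grid m (Suc i))) - z (min t (grid m i)))) F"
  proof (intro uniform_limit_sum_real uniform_lim_mult uniform_limit_minus stop)
    fix i
    show "uniform_limit {0..b} (\<lambda>n t. p n (grid m i)) (\<lambda>t. l (grid m i)) F"
      by (rule uniform_limitI) (use tendstoD[OF p] in \<open>auto elim: eventually_mono\<close>)
    show "bounded ((\<lambda>t. l (grid m i)) ` {0..b})" by (auto simp: bounded_iff)
    show "bounded ((\<lambda>t. z (min t (grid m (Suc i))) - z (min t (grid m i))) ` {0..b})"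
    proof (intro boundedI[of _ "2 * B"], elim imageE)
      fix s t assume "s = z (min t (grid m (Suc i))) - z (min t (grid m i))" "t \<in> {0..b}"
      then show "norm s \<le> 2 * B"
        using B(2)[of "min t (grid m (Suc i))"] B(2)[of "min t (grid m i)"] by (auto simp: min_le_iff_disj)
    qed
  qed
  then show ?thesis by (rule uniform_limit_cong'[THEN iffD1, rotated 2]) (simp_all add: eq)
qed

section \<open>Path regularity and continuity of the functionals\<close>

context hazard_limits begin

lemma cadlag_fun_hazard_lint: "cadlag_fun p \<Longrightarrow> cadlag_fun (hazard_lint p)"
  by (rule cadlag_fun_integrator[of p H1]) (auto intro: cont_H1 monoD[OF mono_H1] hazard_lint_cell)

lemma cadlag_fun_parts_integral:
  assumes y: "cadlag_fun y" shows "cadlag_fun (parts_integral y)"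
proof -
  have "cadlag_fun (\<lambda>t. LINT s:{0..t}|lebesgue. q s * y s)"
    by (rule cadlag_fun_integrator[of y g, OF y g_cont g_mono lint_q_cell[OF y]])
  then show ?thesis unfolding parts_integral_def
    by (intro cadlag_fun_diff cadlag_fun_mult y cadlag_fun_g cadlag_fun_const)
qed

lemma cadlag_fun_limit_process:
  "cadlag_fun x \<Longrightarrow> cadlag_fun x1 \<Longrightarrow> cadlag_fun (limit_process x x1)"
  unfolding limit_process_def[abs_def]
  by (intro cadlag_fun_add cadlag_fun_parts_integral cadlag_fun_hazard_lint cadlag_fun_mult cadlag_fun_g)

text \<open>The clip at a positive \<open>c\<close> keeps the functional continuous also at paths
  for which \<open>1 - H - a * x\<close> vanishes or becomes negative.\<close>

definition approx_process :: "real \<Rightarrow> real \<Rightarrow> nat \<Rightarrow> (real \<Rightarrow> real) \<Rightarrow> (real \<Rightarrow> real) \<Rightarrow> real \<Rightarrow> real" where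
  "approx_process a c m x x1 t = inverse a *
     (riemann_sum m (\<lambda>u. 1 / max c (1 - (H u + a * x u))) (\<lambda>u. H1 u + a * x1 u) t - hazard_lint g t)"

text \<open>Off the range of the empirical processes the limit holds only where this variation stays bounded.\<close>

definition grid_variation :: "real \<Rightarrow> nat \<Rightarrow> nat \<Rightarrow> (real \<Rightarrow> real) \<Rightarrow> real" where
  "grid_variation a m n x1 = (\<Sum>i<n * Suc m. \<bar>(H1 (grid m (Suc i)) + a * x1 (grid m (Suc i))) -
       (H1 (grid m i) + a * x1 (grid m i))\<bar>)"

lemma cadlag_fun_approx_process:
  assumes "cadlag_fun x1" shows "cadlag_fun (approx_process a c m x x1)"
  unfolding approx_process_def[abs_def]
  by (intro cadlag_fun_mult cadlag_fun_diff cadlag_fun_add cadlag_fun_riemann_sum cadlag_fun_const assms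
      cadlag_fun_hazard_lint cadlag_fun_g cadlag_fun_continuous[OF cont_H1])

text \<open>Linearity, bounds and measurability of the limit functional are all inherited from
  Riemann sums through this representation.\<close>

lemma limit_process_tendsto:
  assumes x: "cadlag_fun x" and x1: "cadlag_fun x1" and t: "0 \<le> t"
  shows "(\<lambda>m. riemann_sum m g x1 t + riemann_sum m (\<lambda>u. x u * (g u * g u)) H1 t) \<longlonglongrightarrow> limit_process x x1 t"
proof -
  have *: "(\<lambda>m. f m t) \<longlonglongrightarrow> l t" if "uniform_limit {0..t} f l sequentially" for f and l :: "real \<Rightarrow> real"
    using tendsto_uniform_limitI[OF that, of t] t by simp
  show ?thesis unfolding limit_process_def
    by (intro tendsto_add *[OF parts_integral_limit] *[OF hazard_lint_limit] x x1 cadlag_fun_mult cadlag_fun_g filterlim_ident)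
qed

lemma limit_process_diff:
  assumes "cadlag_fun x" "cadlag_fun x1" "cadlag_fun y" "cadlag_fun y1" and t: "0 \<le> t"
  shows "limit_process x x1 t - limit_process y y1 t = limit_process (\<lambda>u. x u - y u) (\<lambda>u. x1 u - y1 u) t"
proof (rule LIMSEQ_unique)
  show "(\<lambda>m. riemann_sum m g (\<lambda>u. x1 u - y1 u) t + riemann_sum m (\<lambda>u. (x u - y u) * (g u * g u)) H1 t)
    \<longlonglongrightarrow> limit_process (\<lambda>u. x u - y u) (\<lambda>u. x1 u - y1 u) t"
    by (rule limit_process_tendsto) (use assms in \<open>auto intro: cadlag_fun_diff\<close>)
  show "(\<lambda>m. riemann_sum m g (\<lambda>u. x1 u - y1 u) t + riemann_sum m (\<lambda>u. (x u - y u) * (g u * g u)) H1 t)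
    \<longlonglongrightarrow> limit_process x x1 t - limit_process y y1 t"
    using tendsto_diff[OF limit_process_tendsto[of x x1 t] limit_process_tendsto[of y y1 t]] assms
    by (simp add: riemann_sum_diff_right riemann_sum_diff_left left_diff_distrib algebra_simps)
qed

text \<open>The factor \<open>4 * g b\<close> comes from summation by parts with the monotone
  \<open>g\<close>, the factor \<open>g b * g b\<close> from a total variation of \<open>H1\<close>
  of at most 1.\<close>

lemma limit_process_bound:
  assumes x: "cadlag_fun x" and x1: "cadlag_fun x1" and t: "0 \<le> t" "t \<le> b"
    and B: "\<And>u. u \<in> {0..b} \<Longrightarrow> \<bar>x u\<bar> \<le> e" "\<And>u. u \<in> {0..b} \<Longrightarrow> \<bar>x1 u\<bar> \<le> e"
  shows "\<bar>limit_process x x1 t\<bar> \<le> (4 * g b + g b * g b) * e"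
proof (rule LIMSEQ_le_const2[OF tendsto_rabs[OF limit_process_tendsto[OF x x1 t(1)]]], intro exI allI impI)
  fix m :: nat
  have gB: "\<bar>g u\<bar> \<le> g b" if "u \<in> {0..b}" for u
    using g_mono[of u b] g_pos[of u] that by auto
  have e: "0 \<le> e" using B(1)[of 0] t by auto
  obtain k where k: "t \<le> real k" by (meson real_arch_simple)
  have "\<bar>riemann_sum m g x1 t\<bar> \<le> 4 * g b * e"
    by (rule riemann_sum_mono_bound[where b = b]) (use t gB B g_mono in auto)
  moreover have "\<bar>riemann_sum m (\<lambda>u. x u * (g u * g u)) H1 t\<bar> \<le> (e * (g b * g b)) * 1"
  proof (rule riemann_sum_bound[where N = "k * Suc m"])
    show "\<bar>x u * (g u * g u)\<bar> \<le> e * (g b * g b)" if "0 \<le> u" "u \<le> t" for u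
      unfolding abs_mult using that t e g_pos[of b] by (intro mult_mono B gB) auto
    show "t \<le> grid m (k * Suc m)" using k unfolding grid_mult .
  qed (use t in \<open>auto intro!: variation_H1 min_grid_mono\<close>)
  ultimately show "\<bar>riemann_sum m g x1 t + riemann_sum m (\<lambda>u. x u * (g u * g u)) H1 t\<bar> \<le> (4 * g b + g b * g b) * e"
    by (simp add: algebra_simps)
qed

lemma limit_process_continuous:
  assumes x: "cadlag_fun x" "cadlag_fun x1" and xs: "\<And>n. cadlag_fun (xs n)" "\<And>n. cadlag_fun (x1s n)"
    and lim: "uniform_limit {0..b} xs x F" "uniform_limit {0..b} x1s x1 F"
  shows "uniform_limit {0..b} (\<lambda>n. limit_process (xs n) (x1s n)) (limit_process x x1) F"
proof (rule uniform_limitI)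
  fix e :: real assume e: "0 < e"
  have "0 \<le> 4 * g b + g b * g b" using g_pos[of b] by simp
  with e obtain d where d: "0 < d" "d * (4 * g b + g b * g b) < e" by (rule scaled_less)
  from uniform_limitD[OF lim(1) d(1)] uniform_limitD[OF lim(2) d(1)]
  show "\<forall>\<^sub>F n in F. \<forall>t\<in>{0..b}. dist (limit_process (xs n) (x1s n) t) (limit_process x x1 t) < e"
  proof eventually_elim
    case (elim n)
    show ?case
    proof
      fix t assume t: "t \<in> {0..b}"
      then have t0: "0 \<le> t" by simp
      have "\<bar>limit_process (xs n) (x1s n) t - limit_process x x1 t\<bar> \<le> (4 * g b + g b * g b) * d"
        unfolding limit_process_diff[OF xs(1) xs(2) x t0]
        by (rule limit_process_bound[where b = b])
          (use t elim x xs in \<open>auto simp: dist_real_def intro!: cadlag_fun_diff less_imp_le\<close>)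
      then show "dist (limit_process (xs n) (x1s n) t) (limit_process x x1 t) < e"
        using d(2) by (simp add: dist_real_def mult.commute)
    qed
  qed
qed

lemma approx_process_continuous:
  assumes c: "0 < c" and x1: "cadlag_fun x1"
    and xs: "\<And>b. uniform_limit {0..b} xs x F" "\<And>b. uniform_limit {0..b} x1s x1 F"
  shows "uniform_limit {0..b} (\<lambda>n. approx_process a c m (xs n) (x1s n)) (approx_process a c m x x1) F"
proof -
  have pt: "((\<lambda>n. xs n t) \<longlongrightarrow> x t) F" if "0 \<le> t" for t
    using tendsto_uniform_limitI[OF xs(1)[of t], of t] that by simp
  have c1: "cadlag_fun (\<lambda>u. H1 u + a * x1 u)"
    by (intro cadlag_fun_add cadlag_fun_mult cadlag_fun_const x1 cadlag_fun_continuous[OF cont_H1])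
  have bdd: "bounded (h ` {0..b})" if "cadlag_fun h" for h
    using cadlag_fun_bounded[OF that, of b] by (auto simp: bounded_real) (metis atLeastAtMost_iff)
  have cst: "uniform_limit {0..b} (\<lambda>n t. k) (\<lambda>t. k :: real) F" for k by (rule uniform_limit_const)
  have bk: "bounded ((\<lambda>t. k :: real) ` {0..b})" for k by (auto simp: bounded_iff)
  have R: "uniform_limit {0..b} (\<lambda>n. riemann_sum m (\<lambda>u. 1 / max c (1 - (H u + a * xs n u))) (\<lambda>u. H1 u + a * x1s n u))
      (riemann_sum m (\<lambda>u. 1 / max c (1 - (H u + a * x u))) (\<lambda>u. H1 u + a * x1 u)) F"
  proof (rule uniform_limit_riemann_sum_fixed_mesh[OF _ _ c1])
    show "((\<lambda>n. 1 / max c (1 - (H (grid m i) + a * xs n (grid m i)))) \<longlongrightarrow> 1 / max c (1 - (H (grid m i) + a * x (grid m i)))) F" for i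
      using c by (intro tendsto_intros pt grid_nonneg) auto
    show "uniform_limit {0..b} (\<lambda>n u. H1 u + a * x1s n u) (\<lambda>u. H1 u + a * x1 u) F"
      by (intro uniform_limit_add uniform_limit_const uniform_lim_mult cst xs bdd x1 bk)
  qed
  show ?thesis unfolding approx_process_def[abs_def]
    by (intro uniform_lim_mult uniform_limit_minus R cst bk uniform_limit_const)
      (intro bdd cadlag_fun_diff cadlag_fun_riemann_sum c1 cadlag_fun_hazard_lint cadlag_fun_g)
qed

section \<open>Measurability for the product of the ball sigma-algebras\<close>

abbreviation (input) pair_ball_algebra where
  "pair_ball_algebra \<equiv> ball_algebra cadlag_metric \<Otimes>\<^sub>M ball_algebra cadlag_metric"

lemma eval_fst_measurable: "0 \<le> t \<Longrightarrow> (\<lambda>xx. fst xx t) \<in> borel_measurable pair_ball_algebra"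
  and eval_snd_measurable: "0 \<le> t \<Longrightarrow> (\<lambda>xx. snd xx t) \<in> borel_measurable pair_ball_algebra"
  using measurable_compose[OF measurable_fst eval_measurable_ball_algebra]
    measurable_compose[OF measurable_snd eval_measurable_ball_algebra] by auto

lemma space_pair_ball_algebra: "space pair_ball_algebra = cadlag \<times> cadlag" by (simp add: space_pair_measure)

lemma approx_process_measurable:
  "(\<lambda>xx. restrict (approx_process a c m (fst xx) (snd xx)) {0..}) \<in> pair_ball_algebra \<rightarrow>\<^sub>M ball_algebra cadlag_metric"
proof (rule measurable_into_ball_algebra)
  fix xx assume "xx \<in> space pair_ball_algebra"
  then show "restrict (approx_process a c m (fst xx) (snd xx)) {0..} \<in> cadlag"
    by (intro restrict_cadlag cadlag_fun_approx_process) (auto simp: space_pair_ball_algebra cadlag_iff)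
next
  fix t :: real assume t: "0 \<le> t"
  have [measurable]: "(\<lambda>xx. fst xx (grid m i)) \<in> borel_measurable pair_ball_algebra" "(\<lambda>xx. snd xx (grid m i)) \<in> borel_measurable pair_ball_algebra"
     "(\<lambda>xx. snd xx (min t (grid m i))) \<in> borel_measurable pair_ball_algebra" for i
    using t by (auto intro!: eval_fst_measurable eval_snd_measurable)
  have "(\<lambda>xx. approx_process a c m (fst xx) (snd xx) t) \<in> borel_measurable pair_ball_algebra"
    unfolding approx_process_def riemann_sum_def by measurable
  then show "(\<lambda>xx. restrict (approx_process a c m (fst xx) (snd xx)) {0..} t) \<in> borel_measurable pair_ball_algebra"
    using t by simp
qed

lemma limit_process_measurable:
  "(\<lambda>xx. restrict (limit_process (fst xx) (snd xx)) {0..}) \<in> pair_ball_algebra \<rightarrow>\<^sub>M ball_algebra cadlag_metric"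
proof (rule measurable_into_ball_algebra)
  fix xx assume "xx \<in> space pair_ball_algebra"
  then show "restrict (limit_process (fst xx) (snd xx)) {0..} \<in> cadlag"
    by (intro restrict_cadlag cadlag_fun_limit_process) (auto simp: space_pair_ball_algebra cadlag_iff)
next
  fix t :: real assume t: "0 \<le> t"
  have "(\<lambda>xx. limit_process (fst xx) (snd xx) t) \<in> borel_measurable pair_ball_algebra"
  proof (rule borel_measurable_LIMSEQ_metric)
    fix xx assume "xx \<in> space pair_ball_algebra"
    then show "(\<lambda>m. riemann_sum m g (snd xx) t + riemann_sum m (\<lambda>u. fst xx u * (g u * g u)) H1 t)
       \<longlonglongrightarrow> limit_process (fst xx) (snd xx) t"
      by (intro limit_process_tendsto t) (auto simp: space_pair_ball_algebra cadlag_iff)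
  next
    fix m
    have [measurable]: "(\<lambda>xx. fst xx (grid m i)) \<in> borel_measurable pair_ball_algebra" "(\<lambda>xx. snd xx (grid m i)) \<in> borel_measurable pair_ball_algebra"
       "(\<lambda>xx. snd xx (min t (grid m i))) \<in> borel_measurable pair_ball_algebra" for i
      using t by (auto intro!: eval_fst_measurable eval_snd_measurable)
    show "(\<lambda>xx. riemann_sum m g (snd xx) t + riemann_sum m (\<lambda>u. fst xx u * (g u * g u)) H1 t) \<in> borel_measurable pair_ball_algebra"
      unfolding riemann_sum_def by measurable
  qed
  then show "(\<lambda>xx. restrict (limit_process (fst xx) (snd xx)) {0..} t) \<in> borel_measurable pair_ball_algebra"
    using t by simp
qed

lemma grid_variation_measurable: "(\<lambda>xx. grid_variation a m n (snd xx)) \<in> borel_measurable pair_ball_algebra"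
proof -
  have [measurable]: "(\<lambda>xx. snd xx (grid m i)) \<in> borel_measurable pair_ball_algebra" for i
    by (auto intro!: eval_snd_measurable)
  show ?thesis unfolding grid_variation_def by measurable
qed

end

section \<open>Distribution functions that are integrals of their derivative\<close>

lemma AE_lborel_negligible:
  assumes "AE x in lborel. P (x :: real)"
  shows "negligible {x. \<not> P x}"
proof -
  obtain N where N: "N \<in> null_sets lborel" "{x \<in> space lborel. \<not> P x} \<subseteq> N"
    using assms by (auto simp: eventually_ae_filter)
  have "N \<in> null_sets lebesgue" using N(1) by (rule null_sets_completionI)
  then show ?thesis using N(2) by (auto simp: negligible_iff_null_sets[symmetric] intro: negligible_subset)
qed

lemma deriv_nonneg_mono:
  fixes f :: "real \<Rightarrow> real"
  assumes "mono f" "f differentiable at x"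
  shows "0 \<le> deriv f x"
proof (rule ccontr)
  assume "\<not> ?thesis"
  then have "deriv f x < 0" by simp
  moreover have "DERIV f x :> deriv f x"
    using assms(2) by (simp add: DERIV_deriv_iff_real_differentiable)
  ultimately obtain d where d: "0 < d" "\<And>h. 0 < h \<Longrightarrow> h < d \<Longrightarrow> f (x + h) < f x"
    using DERIV_neg_dec_right by blast
  have "f (x + d / 2) < f x" using d by simp
  moreover have "f x \<le> f (x + d / 2)" using d(1) by (intro monoD[OF assms(1)]) simp
  ultimately show False by simp
qed

locale integrated_cdf =
  fixes H :: "real \<Rightarrow> real"
  assumes mono_H: "mono H" and H_nonneg: "\<And>s. 0 \<le> H s"
    and H_deriv: "AE u in lborel. 0 < u \<longrightarrow> H differentiable at u"
    and H_integral: "\<And>t. 0 \<le> t \<Longrightarrow> (deriv H has_integral H t) {0..t}"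
    and H_deriv_left: "AE u in lborel. 0 < u \<longrightarrow> (\<exists>l. (deriv H \<longlongrightarrow> l) (diff_left H u))"
    and H_less_1: "\<And>u. 0 \<le> u \<Longrightarrow> left_lim H u < 1"
    and H_L1: "\<And>c. (\<lambda>u. deriv_left_lim H u / (1 - left_lim H u)\<^sup>2) absolutely_integrable_on {0..c}"
begin

text \<open>The integral over the degenerate interval at 0 forces \<open>H 0 = 0\<close>;
  monotonicity and nonnegativity do the rest.\<close>

lemma H_neg: "s \<le> 0 \<Longrightarrow> H s = 0"
proof -
  assume s: "s \<le> 0"
  have "(deriv H has_integral H 0) {0..0}" using H_integral[of 0] by simp
  moreover have "(deriv H has_integral 0) {0..0}" by (simp add: has_integral_refl)
  ultimately have "H 0 = 0" by (rule has_integral_unique)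
  then show "H s = 0" using monoD[OF mono_H s] H_nonneg[of s] by simp
qed

lemma H_integral_between:
  assumes "0 \<le> u" "u \<le> v" shows "(deriv H has_integral (H v - H u)) {u..v}"
proof -
  have int: "deriv H integrable_on {0..v}" using H_integral[of v] assms by auto
  then have "deriv H integrable_on {u..v}" by (rule integrable_on_subinterval) (use assms in auto)
  then have "(deriv H has_integral integral {u..v} (deriv H)) {u..v}" by (rule integrable_integral)
  moreover have "integral {u..v} (deriv H) = H v - H u"
    using Henstock_Kurzweil_Integration.integral_combine[OF assms int]
      integral_unique[OF H_integral[of v]] integral_unique[OF H_integral[of u]] assms by simp
  ultimately show ?thesis by simp
qed

lemma cont_H: "continuous_on UNIV H"
proof -
  have "continuous_on {..<b} H" for b :: real
  proof (cases "0 \<le> b")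
    case True
    have "continuous_on {0..b} (\<lambda>t. integral {0..t} (deriv H))"
      by (rule indefinite_integral_continuous_1) (use H_integral[OF True] in auto)
    then have "continuous_on {0..b} H"
      by (rule continuous_on_eq) (use H_integral in \<open>auto intro: integral_unique\<close>)
    then have "continuous_on {..<b} (\<lambda>t. H (max 0 (min t b)))"
      by (rule continuous_on_compose2) (use True in \<open>auto intro!: continuous_intros\<close>)
    then show ?thesis
      by (rule continuous_on_eq) (auto simp: max_def min_def H_neg)
  next
    case False
    have "continuous_on {..<b} (\<lambda>_. 0 :: real)" by simp
    then show ?thesis by (rule continuous_on_eq) (use False in \<open>auto simp: H_neg\<close>)
  qed
  then have "continuous_on (\<Union>b. {..<b}) H" by (intro continuous_on_open_UN) auto
  moreover have "(\<Union>b. {..<b}) = (UNIV :: real set)" using gt_ex by auto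
  ultimately show ?thesis by simp
qed

lemma left_lim_H [simp]: "left_lim H u = H u"
proof -
  have "(H \<longlongrightarrow> H u) (at u)" using cont_H by (simp add: continuous_on_def)
  then have "(H \<longlongrightarrow> H u) (at_left u)" by (rule tendsto_mono[OF at_le, rotated]) simp
  then show ?thesis unfolding left_lim_def by (intro tendsto_Lim) auto
qed

lemma H_lt_1: "H u < 1"
  using H_less_1[of u] H_neg[of u] by (cases "0 \<le> u") auto

definition g :: "real \<Rightarrow> real" where "g u = 1 / (1 - H u)"

text \<open>Off a negligible set this is the derivative of \<open>g\<close>.\<close>

definition q :: "real \<Rightarrow> real" where "q u = deriv_left_lim H u / (1 - left_lim H u)\<^sup>2"

lemma g_mono: "u \<le> v \<Longrightarrow> g u \<le> g v"
  using monoD[OF mono_H, of u v] H_lt_1[of u] H_lt_1[of v] by (simp add: g_def frac_le)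

lemma g_pos: "0 < g u" using H_lt_1[of u] by (simp add: g_def)

lemma g_cont: "continuous_on UNIV g"
  unfolding g_def using H_lt_1 cont_H by (intro continuous_intros) (auto simp: less_le)

text \<open>The left difference quotient at \<open>u\<close> is the mean of \<open>deriv H\<close>
  over \<open>[s, u]\<close>. If \<open>deriv H\<close> tends to \<open>l\<close> along the
  differentiability points, then so do these means, and the derivative at \<open>u\<close> is
  \<open>l\<close>.\<close>

lemma deriv_left_lim_eq_deriv:
  assumes u: "0 < u" and diff: "H differentiable at u" and l: "(deriv H \<longlongrightarrow> l) (diff_left H u)"
  shows "deriv_left_lim H u = deriv H u"
proof -
  define Z where "Z = {s. \<not> (0 < s \<longrightarrow> H differentiable at s)}"
  have Z: "negligible Z" unfolding Z_def by (rule AE_lborel_negligible[OF H_deriv])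
  \<comment> \<open>A negligible set contains no open interval, so differentiability points
    accumulate at \<open>u\<close> from the left and the limit along them is unique.\<close>
  have "u islimpt {s. s < u \<and> H differentiable at s}"
    unfolding islimpt_approachable
  proof (intro allI impI)
    fix e :: real assume e: "0 < e"
    have "open {max 0 (u - e)<..<u}" "{max 0 (u - e)<..<u} \<noteq> {}" using u e by auto
    then have "\<not> negligible {max 0 (u - e)<..<u}" by (rule open_not_negligible)
    then obtain s where "s \<in> {max 0 (u - e)<..<u}" "s \<notin> Z" using Z negligible_subset by blast
    then show "\<exists>s\<in>{s. s < u \<and> H differentiable at s}. s \<noteq> u \<and> dist s u < e"
      by (intro bexI[of _ s]) (auto simp: Z_def dist_real_def)
  qed
  then have nontriv: "\<not> trivial_limit (diff_left H u)"
    by (simp add: diff_left_def trivial_limit_within)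
  have "\<bar>deriv H u - l\<bar> \<le> e" if e: "0 < e" for e
  proof -
    have "\<forall>\<^sub>F s in diff_left H u. dist (deriv H s) l < e" using l e by (rule tendstoD)
    then obtain d where d: "0 < d"
      "\<And>s. s < u \<Longrightarrow> H differentiable at s \<Longrightarrow> dist s u < d \<Longrightarrow> dist (deriv H s) l < e"
      unfolding diff_left_def eventually_at by auto
    have quot: "\<bar>(H s - H u) / (s - u) - l\<bar> \<le> e" if s: "max 0 (u - d) < s" "s < u" for s
    proof -
      have "((\<lambda>x. deriv H x - l) has_integral (H u - H s - (u - s) * l)) {s..u}"
        using has_integral_diff[OF H_integral_between[of s u] has_integral_const_real[of l s u]] s
        by (simp add: mult.commute)
      \<comment> \<open>Zeroing the integrand on a negligible set makes the bound by
        \<open>e\<close> valid at every point of the interval.\<close>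
      then have "((\<lambda>x. if x \<in> Z \<or> x = u then 0 else deriv H x - l) has_integral (H u - H s - (u - s) * l)) {s..u}"
        by (rule has_integral_spike[of "Z \<union> {u}", rotated 2]) (use Z in auto)
      then have "norm (H u - H s - (u - s) * l) \<le> e * measure lborel {s..u}"
      proof (rule has_integral_bound_real[rotated 2])
        fix x assume "x \<in> {s..u} - {}"
        then show "norm (if x \<in> Z \<or> x = u then 0 else deriv H x - l) \<le> e"
          using d(2)[of x] s e by (auto simp: Z_def dist_real_def)
      qed (use e in auto)
      then have "\<bar>H u - H s - (u - s) * l\<bar> \<le> e * (u - s)" using s by simp
      moreover have "(H s - H u) / (s - u) - l = (H u - H s - (u - s) * l) / (u - s)"
        using s by (simp add: field_simps)
      ultimately show ?thesis using s by (simp add: abs_divide pos_divide_le_eq)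
    qed
    have "((\<lambda>s. (H s - H u) / (s - u)) \<longlongrightarrow> deriv H u) (at u)"
      using diff unfolding DERIV_deriv_iff_real_differentiable[symmetric] has_field_derivative_iff .
    then have "((\<lambda>s. (H s - H u) / (s - u)) \<longlongrightarrow> deriv H u) (at_left u)"
      by (rule tendsto_mono[OF at_le, rotated]) simp
    then have "((\<lambda>s. \<bar>(H s - H u) / (s - u) - l\<bar>) \<longlongrightarrow> \<bar>deriv H u - l\<bar>) (at_left u)"
      by (intro tendsto_intros)
    moreover have "max 0 (u - d) < u" using u d(1) by simp
    then have "\<forall>\<^sub>F s in at_left u. \<bar>(H s - H u) / (s - u) - l\<bar> \<le> e"
      by (rule eventually_mono[OF eventually_at_left_real]) (use quot in auto)
    ultimately show ?thesis by (rule tendsto_upperbound) simp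
  qed
  then have "\<bar>deriv H u - l\<bar> \<le> 0" by (rule field_le_epsilon) simp
  then have "deriv H u = l" by simp
  then show ?thesis unfolding deriv_left_lim_def using tendsto_Lim[OF nontriv l] by simp
qed

definition exceptional :: "real set" where
  "exceptional = {u. \<not> (0 < u \<longrightarrow> H differentiable at u)} \<union> {u. \<not> (0 < u \<longrightarrow> (\<exists>l. (deriv H \<longlongrightarrow> l) (diff_left H u)))} \<union> {0}"

lemma negligible_exceptional: "negligible exceptional"
  unfolding exceptional_def
  by (intro negligible_Un AE_lborel_negligible H_deriv H_deriv_left) simp

lemma not_exceptional:
  assumes "0 \<le> u" "u \<notin> exceptional"
  shows "q u = deriv H u * (g u)\<^sup>2" "0 \<le> deriv H u"
proof -
  have "0 < u" using assms by (cases "u = 0") (auto simp: exceptional_def)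
  then have *: "H differentiable at u" "\<exists>l. (deriv H \<longlongrightarrow> l) (diff_left H u)" using assms by (auto simp: exceptional_def)
  then show "q u = deriv H u * (g u)\<^sup>2"
    using deriv_left_lim_eq_deriv[OF \<open>0 < u\<close>] by (auto simp: q_def g_def power_divide)
  show "0 \<le> deriv H u" by (rule deriv_nonneg_mono[OF mono_H *(1)])
qed

lemma q_integrable: "q absolutely_integrable_on {0..c}"
  using H_L1[of c] unfolding q_def .

lemma q_integrable_on: "0 \<le> u \<Longrightarrow> q integrable_on {u..v}"
  by (rule integrable_on_subinterval[OF set_lebesgue_integral_eq_integral(1)[OF q_integrable[of v]]]) auto

text \<open>Almost everywhere the integrand is \<open>deriv H\<close> times the square of
  \<open>g\<close>; since \<open>deriv H\<close> is nonnegative there and \<open>g\<close> is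
  increasing, that square may be replaced by its endpoint values.\<close>

lemma integral_q_bounds:
  assumes uv: "0 \<le> u" "u \<le> v"
  shows "(g u)\<^sup>2 * (H v - H u) \<le> integral {u..v} q" "integral {u..v} q \<le> (g v)\<^sup>2 * (H v - H u)"
proof -
  let ?r = "\<lambda>s. if s \<in> exceptional then 0 else deriv H s" and ?q = "\<lambda>s. if s \<in> exceptional then 0 else q s"
  have r: "((\<lambda>s. c * ?r s) has_integral c * (H v - H u)) {u..v}" for c
    using has_integral_spike[OF negligible_exceptional _ H_integral_between[OF uv], of ?r]
    by (intro has_integral_mult_right) auto
  have qi: "(?q has_integral integral {u..v} q) {u..v}"
    using has_integral_spike[OF negligible_exceptional _ integrable_integral[OF q_integrable_on[OF uv(1)]], of _ ?q] by auto
  have sq: "(g s)\<^sup>2 \<le> (g t)\<^sup>2" if "s \<le> t" for s t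
    using g_mono[OF that] g_pos[of s] by (intro power_mono) auto
  show "(g u)\<^sup>2 * (H v - H u) \<le> integral {u..v} q"
    by (rule has_integral_le[OF r qi])
      (use uv not_exceptional sq in \<open>auto simp: mult.commute intro!: mult_left_mono\<close>)
  show "integral {u..v} q \<le> (g v)\<^sup>2 * (H v - H u)"
    by (rule has_integral_le[OF qi r])
      (use uv not_exceptional sq in \<open>auto simp: mult.commute intro!: mult_left_mono\<close>)
qed

lemma g_increment: "g v - g u = g u * g v * (H v - H u)"
  using H_lt_1[of u] H_lt_1[of v] by (simp add: g_def field_simps)

text \<open>Both \<open>g v - g u = g u * g v * (H v - H u)\<close> and the integral of
  \<open>q\<close> lie between the squares of \<open>g u\<close> and \<open>g v\<close> times
  \<open>H v - H u\<close>. On short intervals they thus differ by at most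
  \<open>e * (H v - H u)\<close>, a bound that is additive and extends by bisection.\<close>

lemma integral_q:
  assumes uv: "0 \<le> u" "u \<le> v"
  shows "integral {u..v} q = g v - g u"
proof -
  define X where "X s t = g t - g s - integral {s..t} q" for s t
  have bound: "\<bar>X u v\<bar> \<le> e * (H v - H u)" if e: "0 < e" for e
  proof -
    \<comment> \<open>The premise travels with the induction because the local step of
      \<open>Bolzano\<close> admits intervals that start below 0.\<close>
    have "0 \<le> u \<longrightarrow> \<bar>X u v\<bar> \<le> e * (H v - H u)" using uv(2)
    proof (induction rule: Bolzano)
      case (trans a b c)
      show ?case
      proof
        assume a: "0 \<le> a"
        have "X a c = X a b + X b c"
          using Henstock_Kurzweil_Integration.integral_combine[OF trans(3,4) q_integrable_on[OF a]]
          by (simp add: X_def)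
        then show "\<bar>X a c\<bar> \<le> e * (H c - H a)" using trans a by (simp add: algebra_simps)
      qed
    next
      case (local x)
      have "continuous_on UNIV (\<lambda>u. (g u)\<^sup>2)" by (intro continuous_intros g_cont)
      then obtain d where d: "0 < d" "\<And>y. dist y x < d \<Longrightarrow> dist ((g y)\<^sup>2) ((g x)\<^sup>2) < e / 2"
        unfolding continuous_on_iff using e by (meson UNIV_I half_gt_zero)
      show ?case
      proof (intro exI[of _ d] conjI d(1) allI impI)
        fix a b assume ab: "a \<le> x \<and> x \<le> b \<and> b - a < d" and a: "0 \<le> a"
        then have ab': "a \<le> b" by simp
        have "dist a x < d" "dist b x < d" using ab by (auto simp: dist_real_def)
        then have le: "(g b)\<^sup>2 - (g a)\<^sup>2 \<le> e"
          using d(2)[of a] d(2)[of b] unfolding dist_real_def by linarith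
        have Hm: "0 \<le> H b - H a" using monoD[OF mono_H ab'] by simp
        have "(g a)\<^sup>2 * (H b - H a) \<le> g b - g a" "g b - g a \<le> (g b)\<^sup>2 * (H b - H a)"
          unfolding g_increment power2_eq_square
          using g_mono[OF ab'] g_pos[of a] g_pos[of b] Hm by (auto intro!: mult_right_mono mult_left_mono)
        then have "\<bar>X a b\<bar> \<le> ((g b)\<^sup>2 - (g a)\<^sup>2) * (H b - H a)"
          using integral_q_bounds[OF a ab'] unfolding X_def left_diff_distrib by linarith
        also have "\<dots> \<le> e * (H b - H a)" using le Hm by (rule mult_right_mono)
        finally show "\<bar>X a b\<bar> \<le> e * (H b - H a)" .
      qed
    qed
    then show ?thesis using uv(1) by simp
  qed
  have "\<bar>X u v\<bar> \<le> 0"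
  proof (rule field_le_epsilon)
    fix e :: real assume "0 < e"
    moreover have "0 \<le> H v - H u" using monoD[OF mono_H uv(2)] by simp
    ultimately obtain d where "0 < d" "d * (H v - H u) < e" by (rule scaled_less)
    then show "\<bar>X u v\<bar> \<le> 0 + e" using bound[of d] by simp
  qed
  then show ?thesis by (simp add: X_def)
qed

lemma integral_abs_q:
  assumes uv: "0 \<le> u" "u \<le> v"
  shows "integral {u..v} (\<lambda>s. \<bar>q s\<bar>) = g v - g u"
proof -
  have "integral {u..v} (\<lambda>s. \<bar>q s\<bar>) = integral {u..v} q"
    by (rule integral_spike[OF negligible_exceptional]) (use uv not_exceptional in auto)
  then show ?thesis using integral_q[OF uv] by simp
qed

text \<open>Increments of \<open>H1\<close> are dominated by those of \<open>H\<close>, which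
  carries continuity over from \<open>H\<close> to \<open>H1\<close>.\<close>

lemma hazard_limits:
  assumes "mono H1" "\<And>u. 0 \<le> H1 u" "\<And>u. H1 u \<le> 1" "\<And>u v. u \<le> v \<Longrightarrow> H1 v - H1 u \<le> H v - H u"
  shows "hazard_limits H H1 g q"
proof
  have "\<bar>H1 v - H1 u\<bar> \<le> \<bar>H v - H u\<bar> * 1" for u v
    using assms(4)[of u v] assms(4)[of v u] monoD[OF assms(1), of u v] monoD[OF assms(1), of v u]
    by (cases "u \<le> v") auto
  note le = this
  have "(H1 \<longlongrightarrow> H1 u) (at u)" for u
  proof (rule LIM_zero_cancel)
    have "(H \<longlongrightarrow> H u) (at u)" using cont_H by (simp add: continuous_on_def)
    then have "((\<lambda>v. H v - H u) \<longlongrightarrow> 0) (at u)" by (rule LIM_zero)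
    then show "((\<lambda>v. H1 v - H1 u) \<longlongrightarrow> 0) (at u)"
      by (rule tendsto_0_le[where K = 1]) (simp add: le[unfolded mult_1_right])
  qed
  then show "continuous_on UNIV H1" by (simp add: continuous_on_def)
  show "H1 v - H1 u \<le> 1" for u v using assms(2)[of u] assms(3)[of v] by simp
qed (use mono_H cont_H H_neg H_lt_1 assms q_integrable integral_q integral_abs_q in \<open>auto simp: g_def[abs_def]\<close>)

end

section \<open>Nelson-Aalen estimators as Riemann sums\<close>

definition step_sum :: "nat \<Rightarrow> (nat \<Rightarrow> real) \<Rightarrow> (nat \<Rightarrow> real) \<Rightarrow> real \<Rightarrow> real" where
  "step_sum n c t s = (\<Sum>i<n. c i * of_bool (t i \<le> s))"

lemma step_right_continuous: "((\<lambda>s. of_bool (a \<le> s) :: real) \<longlongrightarrow> of_bool (a \<le> s)) (at_right s)" for a s :: real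
proof (cases "a \<le> s")
  case True
  have "\<forall>\<^sub>F u in at_right s. (of_bool (a \<le> u) :: real) = of_bool (a \<le> s)"
    using eventually_at_right_less[of s] by eventually_elim (use True in auto)
  then show ?thesis by (rule tendsto_eventually)
next
  case False
  then have "s < a" by simp
  have "\<forall>\<^sub>F u in at_right s. (of_bool (a \<le> u) :: real) = of_bool (a \<le> s)"
    using eventually_at_right_real[OF \<open>s < a\<close>] by eventually_elim (use False in auto)
  then show ?thesis by (rule tendsto_eventually)
qed

lemma step_left_limit: "((\<lambda>s. of_bool (a \<le> s) :: real) \<longlongrightarrow> of_bool (a < s)) (at_left s)" for a s :: real
proof (cases "a < s")
  case True
  have "\<forall>\<^sub>F u in at_left s. (of_bool (a \<le> u) :: real) = of_bool (a < s)"
    using eventually_at_left_real[OF True] by eventually_elim (use True in auto)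
  then show ?thesis by (rule tendsto_eventually)
next
  case False
  have "s - 1 < s" by simp
  have "\<forall>\<^sub>F u in at_left s. (of_bool (a \<le> u) :: real) = of_bool (a < s)"
    using eventually_at_left_real[OF \<open>s - 1 < s\<close>] by eventually_elim (use False in auto)
  then show ?thesis by (rule tendsto_eventually)
qed

lemma left_lim_step_sum: "left_lim (step_sum n c t) u = (\<Sum>i<n. c i * of_bool (t i < u))"
  unfolding left_lim_def step_sum_def[abs_def]
  by (intro tendsto_Lim tendsto_sum tendsto_mult tendsto_const step_left_limit) simp

text \<open>Two finite Borel measures with the same distribution function agree. Pushing a weighted
  point measure on the indices forward along \<open>t\<close> lets the weights of tied observations
  add up.\<close>

lemma interval_measure_step_sum:
  assumes c: "\<And>i. 0 \<le> c i"
  shows "interval_measure (step_sum n c t) = distr (point_measure {..<n} c) borel t"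
proof (rule cdf_unique')
  let ?F = "step_sum n c t"
  have mono: "?F x \<le> ?F y" if "x \<le> y" for x y
    unfolding step_sum_def using that c by (intro sum_mono mult_left_mono) auto
  have rc: "continuous (at_right a) ?F" for a
    unfolding continuous_within step_sum_def[abs_def]
    by (intro tendsto_sum tendsto_mult tendsto_const step_right_continuous)
  have bot: "(?F \<longlongrightarrow> 0) at_bot"
  proof -
    have "((\<lambda>s. of_bool (t i \<le> s) :: real) \<longlongrightarrow> 0) at_bot" for i
      by (rule tendsto_eventually, rule eventually_mono[OF eventually_gt_at_bot[of "t i"]]) simp
    then have "(?F \<longlongrightarrow> (\<Sum>i<n. c i * 0)) at_bot"
      unfolding step_sum_def[abs_def] by (intro tendsto_sum tendsto_mult tendsto_const)
    then show ?thesis by simp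
  qed
  have top: "(?F \<longlongrightarrow> (\<Sum>i<n. c i * 1)) at_top"
  proof -
    have "((\<lambda>s. of_bool (t i \<le> s) :: real) \<longlongrightarrow> 1) at_top" for i
      by (rule tendsto_eventually, rule eventually_mono[OF eventually_ge_at_top[of "t i"]]) simp
    then show ?thesis
      unfolding step_sum_def[abs_def] by (intro tendsto_sum tendsto_mult tendsto_const)
  qed
  show "finite_borel_measure (interval_measure ?F)"
    by (rule finite_borel_measure_interval_measure[OF mono rc bot top]) (use c in \<open>auto intro: sum_nonneg\<close>)
  have meas: "t \<in> point_measure {..<n} c \<rightarrow>\<^sub>M borel"
    by (simp add: measurable_def space_point_measure sets_point_measure)
  have em: "emeasure (distr (point_measure {..<n} c) borel t) A = (\<Sum>i | i < n \<and> t i \<in> A. ennreal (c i))"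
    if "A \<in> sets borel" for A
    using that by (subst emeasure_distr[OF meas])
      (auto simp: space_point_measure emeasure_point_measure_finite intro!: sum.cong)
  have "finite_measure (distr (point_measure {..<n} c) borel t)"
    by (rule finite_measureI) (simp add: em)
  then show "finite_borel_measure (distr (point_measure {..<n} c) borel t)"
    by (simp add: finite_borel_measure_def finite_borel_measure_axioms_def)
  have "measure (distr (point_measure {..<n} c) borel t) {..x} = ?F x" for x
  proof -
    have "emeasure (distr (point_measure {..<n} c) borel t) {..x} = ennreal (\<Sum>i | i < n \<and> t i \<le> x. c i)"
      by (subst em) (use c in \<open>auto intro: sum_ennreal\<close>)
    then have "measure (distr (point_measure {..<n} c) borel t) {..x} = (\<Sum>i | i < n \<and> t i \<le> x. c i)"
      by (simp add: measure_def c sum_nonneg)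
    also have "{i. i < n \<and> t i \<le> x} = {..<n} \<inter> {i. t i \<le> x}" by auto
    also have "sum c ({..<n} \<inter> {i. t i \<le> x}) = (\<Sum>i<n. if t i \<le> x then c i else 0)"
      by (simp add: sum.inter_restrict)
    also have "\<dots> = ?F x" unfolding step_sum_def by (intro sum.cong) auto
    finally show ?thesis .
  qed
  then have "cdf (distr (point_measure {..<n} c) borel t) = ?F" by (simp add: cdf_def fun_eq_iff)
  then show "cdf (interval_measure ?F) = cdf (distr (point_measure {..<n} c) borel t)"
    using cdf_interval_measure[OF mono rc bot] by simp
qed

lemma lint_step_sum:
  assumes c: "\<And>i. 0 \<le> c i" and \<phi>: "\<phi> \<in> borel_measurable borel"
  shows "(LINT u:{0<..s}|interval_measure (step_sum n c t). \<phi> u) = (\<Sum>i<n. c i * (of_bool (0 < t i \<and> t i \<le> s) * \<phi> (t i)))"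
proof -
  have meas: "t \<in> point_measure {..<n} c \<rightarrow>\<^sub>M borel"
    by (simp add: measurable_def space_point_measure sets_point_measure)
  have "(LINT u:{0<..s}|interval_measure (step_sum n c t). \<phi> u) =
    (\<integral>i. indicator {0<..s} (t i) *\<^sub>R \<phi> (t i) \<partial>point_measure {..<n} c)"
    unfolding interval_measure_step_sum[of c, OF c] set_lebesgue_integral_def
    by (rule integral_distr[OF meas]) (use \<phi> in measurable)
  also have "\<dots> = (\<Sum>i<n. c i * (of_bool (0 < t i \<and> t i \<le> s) * \<phi> (t i)))"
    using c by (subst lebesgue_integral_point_measure_finite) (auto simp: indicator_def intro!: sum.cong)
  finally show ?thesis .
qed

lemma cum_hazard_step_sum:
  assumes c: "\<And>i. 0 \<le> c i"
  shows "cum_hazard (step_sum n d t) (step_sum n c t) s =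
    (\<Sum>i<n. c i * (of_bool (0 < t i \<and> t i \<le> s) * (1 / (1 - (\<Sum>j<n. d j * of_bool (t j < t i))))))"
proof -
  have "(\<lambda>u. 1 / (1 - (\<Sum>j<n. d j * of_bool (t j < u)))) \<in> borel_measurable borel"
    by measurable
  from lint_step_sum[of c, OF c this] show ?thesis
    unfolding cum_hazard_def left_lim_step_sum by simp
qed

lemma grid_cell:
  assumes "0 < a"
  obtains j where "grid m j < a" "a \<le> grid m (Suc j)" "a - 1 / real (Suc m) \<le> grid m j"
proof -
  obtain k where "a \<le> real k" by (meson real_arch_simple)
  then have ex: "\<exists>i. a \<le> grid m i" by (intro exI[of _ "k * Suc m"]) (simp only: grid_mult)
  define i where "i = (LEAST i. a \<le> grid m i)"
  have i: "a \<le> grid m i" unfolding i_def using ex by (rule LeastI_ex)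
  have "i \<noteq> 0" using i assms by (cases i) auto
  then obtain j where j: "i = Suc j" by (cases i) auto
  have "\<not> a \<le> grid m j" using not_less_Least[of j "\<lambda>i. a \<le> grid m i"] j unfolding i_def by simp
  then show ?thesis using that[of j] i j unfolding j grid_Suc by simp
qed

text \<open>Only the cell containing the jump has a nonzero increment, and it is weighted by the
  integrand at its left endpoint.\<close>

lemma riemann_sum_step:
  assumes j: "grid m j < a" "a \<le> grid m (Suc j)"
  shows "riemann_sum m p (\<lambda>s. of_bool (a \<le> s)) s = of_bool (a \<le> s) * p (grid m j)"
proof (cases "0 \<le> s")
  case s: True
  obtain k where k: "max s a \<le> real k" by (meson real_arch_simple)
  define N where "N = k * Suc m"
  have sN: "s \<le> grid m N" and aN: "a \<le> grid m N" using k unfolding N_def grid_mult by auto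
  have jN: "j < N"
  proof (rule ccontr)
    assume "\<not> j < N"
    then have "grid m N \<le> grid m j" by simp
    then show False using j aN by linarith
  qed
  have term_eq: "p (grid m i) * (of_bool (a \<le> min s (grid m (Suc i))) - of_bool (a \<le> min s (grid m i)))
      = (if i = j then of_bool (a \<le> s) * p (grid m j) else 0)" for i
  proof (cases i j rule: linorder_cases)
    case less
    then have "grid m (Suc i) \<le> grid m j" "grid m i \<le> grid m j" by auto
    then have "\<not> a \<le> grid m (Suc i)" "\<not> a \<le> grid m i" using j(1) by linarith+
    then show ?thesis using less by simp
  next
    case equal
    then show ?thesis using j by auto
  next
    case greater
    then have "grid m (Suc j) \<le> grid m i" "grid m (Suc j) \<le> grid m (Suc i)" by auto
    then have "a \<le> grid m (Suc i)" "a \<le> grid m i" using j(2) by linarith+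
    then show ?thesis using greater by simp
  qed
  show ?thesis
    unfolding riemann_sum_eq_grid[OF s sN] term_eq using jN by simp
next
  case False
  then have "{i. grid m i < s} = {}" using grid_nonneg[of m] by (metis (mono_tags, lifting) Collect_empty_eq le_less_trans less_le_not_le linorder_not_le)
  then have "riemann_sum m p (\<lambda>s. of_bool (a \<le> s)) s = 0" unfolding riemann_sum_def by simp
  moreover have "\<not> a \<le> s" using False j(1) grid_nonneg[of m j] by linarith
  ultimately show ?thesis by simp
qed

text \<open>A jump at or before 0 precedes all increments, in agreement with integration over
  \<open>{0<..s}\<close>.\<close>

lemma riemann_sum_step_nonpos:
  assumes "a \<le> 0"
  shows "riemann_sum m p (\<lambda>s. of_bool (a \<le> s)) s = 0"
proof -
  have "a \<le> grid m i" for i using assms grid_nonneg[of m i] by linarith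
  then show ?thesis
    unfolding riemann_sum_def by (intro sum.neutral) (auto intro: less_imp_le le_less_trans)
qed

lemma riemann_sum_step_sum:
  "riemann_sum m p (step_sum n c t) s = (\<Sum>i<n. c i * riemann_sum m p (\<lambda>s. of_bool (t i \<le> s)) s)"
  unfolding riemann_sum_def step_sum_def sum_distrib_left sum_subtractf[symmetric] right_diff_distrib
  by (subst sum.swap) (simp add: algebra_simps)

text \<open>Once the mesh is at most the smallest gap between distinct observations, none of them
  lies strictly between the left endpoint of the cell of \<open>t i\<close> and \<open>t i\<close>
  itself. The value of the step function at that endpoint is then its left limit at
  \<open>t i\<close>.\<close>

lemma eventually_riemann_sum_eq_cum_hazard:
  assumes c: "\<And>i. 0 \<le> c i" and \<epsilon>: "\<And>i. i < n \<Longrightarrow> \<epsilon> \<le> 1 - (\<Sum>j<n. d j * of_bool (t j < t i))"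
  shows "\<forall>\<^sub>F m in sequentially. \<forall>s.
     riemann_sum m (\<lambda>u. 1 / max \<epsilon> (1 - step_sum n d t u)) (step_sum n c t) s = cum_hazard (step_sum n d t) (step_sum n c t) s"
proof -
  have "\<forall>\<^sub>F m in sequentially. \<forall>i\<in>{..<n}. \<forall>j\<in>{..<n}. t j < t i \<longrightarrow> t j \<le> t i - 1 / real (Suc m)"
  proof (intro eventually_ball_finite ballI finite_lessThan)
    fix i j
    show "\<forall>\<^sub>F m in sequentially. t j < t i \<longrightarrow> t j \<le> t i - 1 / real (Suc m)"
    proof (cases "t j < t i")
      case True
      then have "0 < t i - t j" by simp
      then have "\<forall>\<^sub>F m in sequentially. 1 / real (Suc m) < t i - t j"
        by (rule order_tendstoD(2)[OF lim_1_over_n[THEN LIMSEQ_Suc]])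
      then show ?thesis by eventually_elim linarith
    qed simp
  qed
  then show ?thesis
  proof eventually_elim
    case (elim m)
    show ?case
    proof
      fix s
      show "riemann_sum m (\<lambda>u. 1 / max \<epsilon> (1 - step_sum n d t u)) (step_sum n c t) s = cum_hazard (step_sum n d t) (step_sum n c t) s"
        unfolding riemann_sum_step_sum cum_hazard_step_sum[of c, OF c]
      proof (intro sum.cong refl arg_cong2[of _ _ _ _ "(*)"])
        fix i assume i: "i \<in> {..<n}"
        show "riemann_sum m (\<lambda>u. 1 / max \<epsilon> (1 - step_sum n d t u)) (\<lambda>s. of_bool (t i \<le> s)) s =
          of_bool (0 < t i \<and> t i \<le> s) * (1 / (1 - (\<Sum>j<n. d j * of_bool (t j < t i))))"
        proof (cases "0 < t i")
          case True
          then obtain j where j: "grid m j < t i" "t i \<le> grid m (Suc j)" "t i - 1 / real (Suc m) \<le> grid m j"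
            by (rule grid_cell)
          have "step_sum n d t (grid m j) = (\<Sum>k<n. d k * of_bool (t k < t i))"
            unfolding step_sum_def
          proof (intro sum.cong refl arg_cong2[of _ _ _ _ "(*)"])
            fix k assume k: "k \<in> {..<n}"
            have "t k \<le> grid m j \<longleftrightarrow> t k < t i" using elim i k j by force
            then show "(of_bool (t k \<le> grid m j) :: real) = of_bool (t k < t i)" by simp
          qed
          then show ?thesis
            unfolding riemann_sum_step[OF j(1,2)] using True \<epsilon>[of i] i by (simp add: max_absorb2)
        next
          case False
          then show ?thesis by (simp add: riemann_sum_step_nonpos)
        qed
      qed
    qed
  qed
qed

section \<open>Empirical distribution functions as step sums\<close>

lemma emp_cdf_step_sum: "emp_cdf T \<tau> n \<omega> = step_sum n (\<lambda>_. 1 / real n) (\<lambda>i. obs_time T \<tau> i \<omega>)"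
  and emp_unc_cdf_step_sum: "emp_unc_cdf T \<tau> n \<omega> =
    step_sum n (\<lambda>i. of_bool (uncensored T \<tau> i \<omega>) / real n) (\<lambda>i. obs_time T \<tau> i \<omega>)"
  by (rule ext, unfold emp_cdf_def emp_unc_cdf_def step_sum_def sum_distrib_left, rule sum.cong, simp_all)+

lemma nelson_aalen_eq:
  "nelson_aalen T \<tau> n \<omega> s = (\<Sum>i<n. of_bool (uncensored T \<tau> i \<omega>) / real n *
     (of_bool (0 < obs_time T \<tau> i \<omega> \<and> obs_time T \<tau> i \<omega> \<le> s) *
      (1 / (1 - (\<Sum>j<n. 1 / real n * of_bool (obs_time T \<tau> j \<omega> < obs_time T \<tau> i \<omega>))))))"
  unfolding nelson_aalen_def emp_cdf_step_sum emp_unc_cdf_step_sum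
  by (rule cum_hazard_step_sum) simp

lemma cadlag_fun_nelson_aalen: "cadlag_fun (nelson_aalen T \<tau> n \<omega>)"
proof -
  have "cadlag_fun (\<lambda>s. \<Sum>i<n. of_bool (uncensored T \<tau> i \<omega>) / real n * of_bool (0 < obs_time T \<tau> i \<omega>) *
      (1 / (1 - (\<Sum>j<n. 1 / real n * of_bool (obs_time T \<tau> j \<omega> < obs_time T \<tau> i \<omega>)))) *
      (if obs_time T \<tau> i \<omega> \<le> s then 1 else 0))"
    by (rule cadlag_fun_sum) (rule cadlag_fun_mult[OF cadlag_fun_const cadlag_fun_step])
  then show ?thesis
    by (rule cadlag_fun_cong) (auto simp: nelson_aalen_eq intro!: sum.cong)
qed

lemma emp_unc_cdf_mono: "u \<le> v \<Longrightarrow> emp_unc_cdf T \<tau> n \<omega> u \<le> emp_unc_cdf T \<tau> n \<omega> v"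
  unfolding emp_unc_cdf_def by (intro mult_left_mono sum_mono) auto

lemma emp_unc_cdf_nonneg: "0 \<le> emp_unc_cdf T \<tau> n \<omega> u"
  unfolding emp_unc_cdf_def by (intro mult_nonneg_nonneg sum_nonneg) auto

lemma emp_unc_cdf_le_1: "emp_unc_cdf T \<tau> n \<omega> u \<le> 1"
proof (cases "n = 0")
  case False
  have "(\<Sum>i<n. of_bool (uncensored T \<tau> i \<omega>) * of_bool (obs_time T \<tau> i \<omega> \<le> u)) \<le> (\<Sum>i<n. 1 :: real)"
    by (rule sum_mono) auto
  then show ?thesis using False by (simp add: emp_unc_cdf_def divide_le_eq)
qed (simp add: emp_unc_cdf_def)

text \<open>An observation does not count itself in the left limit at its own time, so the
  denominator there is at least \<open>1 / real n\<close>. The clip level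
  \<open>1 / real (Suc n)\<close> lies below this and is therefore inactive.\<close>

lemma eventually_riemann_sum_eq_nelson_aalen:
  "\<forall>\<^sub>F m in sequentially. \<forall>s. riemann_sum m (\<lambda>u. 1 / max (1 / real (Suc n)) (1 - emp_cdf T \<tau> n \<omega> u))
     (emp_unc_cdf T \<tau> n \<omega>) s = nelson_aalen T \<tau> n \<omega> s"
  unfolding nelson_aalen_def emp_cdf_step_sum emp_unc_cdf_step_sum
proof (rule eventually_riemann_sum_eq_cum_hazard)
  fix i assume i: "i < n"
  let ?t = "\<lambda>i. obs_time T \<tau> i \<omega>"
  have "(\<Sum>j<n. 1 / real n * of_bool (?t j < ?t i)) \<le> (\<Sum>j<n. if j = i then 0 else 1 / real n)"
    by (rule sum_mono) auto
  also have "\<dots> = (\<Sum>j<n. 1 / real n - (if j = i then 1 / real n else 0))"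
    by (rule sum.cong) auto
  also have "\<dots> = 1 - 1 / real n" using i by (simp add: sum_subtractf)
  also have "\<dots> \<le> 1 - 1 / real (Suc n)" using i by (simp add: frac_le)
  finally show "1 / real (Suc n) \<le> 1 - (\<Sum>j<n. 1 / real n * of_bool (?t j < ?t i))" by simp
qed simp

section \<open>Measurability of the estimator and monotonicity of the true distribution
  functions\<close>

context random_censoring
begin

lemma obs_time_measurable [measurable]: "obs_time T \<tau> i \<in> borel_measurable M"
  using T_measurable tau_measurable unfolding obs_time_def[abs_def] by measurable

lemma uncensored_measurable [measurable]: "Measurable.pred M (uncensored T \<tau> i)"
proof -
  note [measurable] = T_measurable tau_measurable
  show ?thesis unfolding uncensored_def[abs_def] by measurable
qed

lemma nelson_aalen_measurable: "(\<lambda>\<omega>. nelson_aalen T \<tau> n \<omega> s) \<in> borel_measurable M"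
  unfolding nelson_aalen_eq by measurable

lemma mono_obs_cdf: "mono (obs_cdf M T \<tau>)" and obs_cdf_nonneg: "0 \<le> obs_cdf M T \<tau> s"
  unfolding obs_cdf_def by (auto simp: mono_def intro!: finite_measure_mono)

lemma mono_unc_cdf: "mono (unc_cdf M T \<tau>)" and unc_cdf_nonneg: "0 \<le> unc_cdf M T \<tau> s"
  and unc_cdf_le_1: "unc_cdf M T \<tau> s \<le> 1"
  unfolding unc_cdf_def by (auto simp: mono_def intro!: finite_measure_mono)

lemma unc_cdf_increment:
  assumes "u \<le> v"
  shows "unc_cdf M T \<tau> v - unc_cdf M T \<tau> u \<le> obs_cdf M T \<tau> v - obs_cdf M T \<tau> u"
proof -
  let ?A = "\<lambda>s. {\<omega> \<in> space M. obs_time T \<tau> 0 \<omega> \<le> s}"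
  let ?B = "\<lambda>s. {\<omega> \<in> space M. obs_time T \<tau> 0 \<omega> \<le> s \<and> uncensored T \<tau> 0 \<omega>}"
  have "unc_cdf M T \<tau> v - unc_cdf M T \<tau> u = prob (?B v - ?B u)"
    unfolding unc_cdf_def by (rule finite_measure_Diff[symmetric]) (use assms in auto)
  also have "\<dots> \<le> prob (?A v - ?A u)" by (rule finite_measure_mono) auto
  also have "\<dots> = obs_cdf M T \<tau> v - obs_cdf M T \<tau> u"
    unfolding obs_cdf_def by (rule finite_measure_Diff) (use assms in auto)
  finally show ?thesis .
qed

end

section \<open>The limit theorem\<close>

theorem theorem1:
  fixes M :: "'a measure" and N :: "'b measure"
    and T \<tau> :: "nat \<Rightarrow> 'a \<Rightarrow> real"
    and F G H H1 :: "real \<Rightarrow> real"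
    and a :: "nat \<Rightarrow> real"
    and w w1 :: "'b \<Rightarrow> real \<Rightarrow> real"
  assumes data: "random_censoring M T \<tau> F G"
    and H: "H = obs_cdf M T \<tau>"
    and H1: "H1 = unc_cdf M T \<tau>"
    and H1_at_0: "(H1 \<longlongrightarrow> 0) (at_right 0)"
    and H_minus_H1_at_0: "((\<lambda>t. H t - H1 t) \<longlongrightarrow> 0) (at_right 0)"
    \<comment> \<open>\<open>H\<close> has the derivative \<open>H'\<close> almost everywhere and is its integral, \<open>H'\<close> has left-hand
      limits, and \<open>1 / (1 - H(u-))\<close> is meaningful\<close>
    and H_deriv: "AE u in lborel. 0 < u \<longrightarrow> H differentiable at u"
    and H_integral: "\<And>t. 0 \<le> t \<Longrightarrow> (deriv H has_integral H t) {0..t}"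
    and H_deriv_left: "AE u in lborel. 0 < u \<longrightarrow> (\<exists>l. (deriv H \<longlongrightarrow> l) (diff_left H u))"
    and H_less_1: "\<And>u. 0 \<le> u \<Longrightarrow> left_lim H u < 1"
    and H_bounded: "bounded (H ` {0..})"
    and H_finite_variation: "finite_variation_on {0..} H"
    and H_L1: "\<And>b c. 0 \<le> b \<Longrightarrow>
      (\<lambda>u. deriv_left_lim H u / (1 - left_lim H u)\<^sup>2) absolutely_integrable_on {b..c}"
    and a_pos: "\<And>n. 1 \<le> n \<Longrightarrow> 0 < a n"
    and a_decreasing: "antimono_on {1..} a"
    and a_lim: "a \<longlonglongrightarrow> 0"
    and N: "prob_space N"
    and joint_limit:
      "converges_weakly (max_metric cadlag_metric cadlag_metric)
         (ball_algebra cadlag_metric \<Otimes>\<^sub>M ball_algebra cadlag_metric)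
         M (\<lambda>n \<omega>. (\<lambda>t\<in>{0..}. inverse (a n) * (emp_cdf T \<tau> n \<omega> t - H t),
                    \<lambda>t\<in>{0..}. inverse (a n) * (emp_unc_cdf T \<tau> n \<omega> t - H1 t)))
         N (\<lambda>\<omega>. (w \<omega>, w1 \<omega>))"
  shows "converges_weakly cadlag_metric (ball_algebra cadlag_metric)
           M (\<lambda>n \<omega>. \<lambda>t\<in>{0..}. inverse (a n) * (nelson_aalen T \<tau> n \<omega> t - cum_hazard H H1 t))
           N (\<lambda>\<omega>. \<lambda>t\<in>{0..}. hazard_integral H (w1 \<omega>) t +
                 (LINT u:{0<..t}|interval_measure H1. w \<omega> u / (1 - left_lim H u)\<^sup>2))"
proof -
  interpret random_censoring M T \<tau> F G by (rule data)
  interpret N: prob_space N by (rule N)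
  interpret cdf: integrated_cdf H
    by unfold_locales (use mono_obs_cdf obs_cdf_nonneg H_deriv H_integral H_deriv_left H_less_1 H_L1 in \<open>auto simp: H\<close>)
  interpret hazard_limits H H1 cdf.g cdf.q
    by (rule cdf.hazard_limits)
      (use mono_unc_cdf unc_cdf_nonneg unc_cdf_le_1 unc_cdf_increment in \<open>auto simp: H H1\<close>)

  let ?BB = "ball_algebra cadlag_metric \<Otimes>\<^sub>M ball_algebra cadlag_metric"
  let ?m2 = "max_metric cadlag_metric cadlag_metric"
  define \<Lambda> where "\<Lambda> = hazard_lint cdf.g"
  have cum_hazard: "cum_hazard H H1 = \<Lambda>"
    by (simp add: cum_hazard_def hazard_lint_def cdf.g_def fun_eq_iff \<Lambda>_def)
  define X where "X n \<omega> = (\<lambda>t\<in>{0..}. inverse (a n) * (emp_cdf T \<tau> n \<omega> t - H t),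
                    \<lambda>t\<in>{0..}. inverse (a n) * (emp_unc_cdf T \<tau> n \<omega> t - H1 t))" for n \<omega>
  define Z where "Z n \<omega> = (\<lambda>t\<in>{0..}. inverse (a n) * (nelson_aalen T \<tau> n \<omega> t - \<Lambda> t))" for n \<omega>
  define L where "L xx = restrict (limit_process (fst xx) (snd xx)) {0..}" for xx
  define A where "A n m xx = restrict (approx_process (a n) (1 / real (Suc n)) m (fst xx) (snd xx)) {0..}" for n m xx
  \<comment> \<open>Continuity of \<open>H\<close> replaces left limits by values, and
    \<open>H 0 = 0\<close> removes the denominator of the boundary term at 0.\<close>
  have target: "(\<lambda>t\<in>{0..}. hazard_integral H x1 t +
      (LINT u:{0<..t}|interval_measure H1. x u / (1 - left_lim H u)\<^sup>2)) = L (x, x1)" for x x1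
    unfolding L_def
    by (rule restrict_ext) (simp add: limit_process_def hazard_integral_def parts_integral_def hazard_lint_def
        cdf.g_def cdf.q_def H_0 power2_eq_square)
  have weak: "converges_weakly ?m2 ?BB M X N (\<lambda>\<omega>. (w \<omega>, w1 \<omega>))"
    using joint_limit unfolding X_def .
  have X_meas: "X n \<in> M \<rightarrow>\<^sub>M ?BB" and W_meas: "(\<lambda>\<omega>. (w \<omega>, w1 \<omega>)) \<in> N \<rightarrow>\<^sub>M ?BB" for n
    using weak by (auto simp: converges_weakly_def)
  have A_meas: "A n m \<in> ?BB \<rightarrow>\<^sub>M ball_algebra cadlag_metric" for n m
    unfolding A_def by (rule approx_process_measurable)
  have L_meas: "L \<in> ?BB \<rightarrow>\<^sub>M ball_algebra cadlag_metric"
    unfolding L_def by (rule limit_process_measurable)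
  have A_cadlag: "A n m xx \<in> cadlag" if "xx \<in> cadlag \<times> cadlag" for n m xx
    using that unfolding A_def by (intro restrict_cadlag cadlag_fun_approx_process) (auto simp: cadlag_iff)
  have L_cadlag: "L xx \<in> cadlag" if "xx \<in> cadlag \<times> cadlag" for xx
    using that unfolding L_def by (intro restrict_cadlag cadlag_fun_limit_process) (auto simp: cadlag_iff)
  have X_space: "X n \<omega> \<in> cadlag \<times> cadlag" if "\<omega> \<in> space M" for n \<omega>
    using measurable_space[OF X_meas that] by (simp add: space_pair_ball_algebra)
  have Z_cadlag: "Z n \<omega> \<in> cadlag" for n \<omega>
    unfolding Z_def \<Lambda>_def
    by (intro restrict_cadlag cadlag_fun_mult cadlag_fun_diff cadlag_fun_const cadlag_fun_nelson_aalen
        cadlag_fun_hazard_lint cadlag_fun_g)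
  have Z_meas: "Z n \<in> M \<rightarrow>\<^sub>M ball_algebra cadlag_metric" for n
  proof (rule measurable_into_ball_algebra[OF Z_cadlag])
    note [measurable] = nelson_aalen_measurable
    show "(\<lambda>\<omega>. Z n \<omega> t) \<in> borel_measurable M" if "0 \<le> t" for t
      using that unfolding Z_def by simp
  qed
  have a_cancel: "a n * (inverse (a n) * s) = s" if "1 \<le> n" for n s
    using a_pos[OF that] by simp
  \<comment> \<open>Multiplying by \<open>a n\<close> undoes the normalisation, so the functional
    sees the empirical functions themselves. How fine the mesh has to be depends on
    \<omega>.\<close>
  have A_X: "\<forall>\<^sub>F m in sequentially. A n m (X n \<omega>) = Z n \<omega>" if n: "1 \<le> n" for n \<omega>
    using eventually_riemann_sum_eq_nelson_aalen[of n T \<tau> \<omega>]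
  proof eventually_elim
    case (elim m)
    have "riemann_sum m (\<lambda>u. 1 / max (1 / real (Suc n)) (1 - (H u + a n * fst (X n \<omega>) u)))
        (\<lambda>u. H1 u + a n * snd (X n \<omega>) u) t = nelson_aalen T \<tau> n \<omega> t" if "0 \<le> t" for t
      unfolding elim[rule_format, symmetric] using that
      by (intro riemann_sum_cong) (simp_all add: X_def a_cancel[OF n] del: of_nat_Suc)
    then show ?case
      unfolding A_def Z_def approx_process_def \<Lambda>_def by (intro restrict_ext) simp
  qed

  \<comment> \<open>Convergence of expectations for a fixed test functional\<close>
  have limit: "(\<lambda>n. \<integral>\<omega>. f (Z n \<omega>) \<partial>M) \<longlonglongrightarrow> (\<integral>\<omega>. f (L (w \<omega>, w1 \<omega>)) \<partial>N)"
    if f: "continuous_map (mtopology_of cadlag_metric) euclideanreal f"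
      "bounded (f ` cadlag)" "f \<in> borel_measurable (ball_algebra cadlag_metric)" for f :: "(real \<Rightarrow> real) \<Rightarrow> real"
  proof -
    note f_meas [measurable] = f(3)
    obtain C where C: "\<And>x. x \<in> cadlag \<Longrightarrow> \<bar>f x\<bar> \<le> C" using f(2) by (auto simp: bounded_real)
    have f_lim: "(\<lambda>k. f (y k)) \<longlonglongrightarrow> f x"
      if "x \<in> cadlag" "\<And>k. y k \<in> cadlag" "\<And>b. uniform_limit {0..b} y x sequentially" for y x
    proof -
      have "limitin (mtopology_of cadlag_metric) y x sequentially"
        using that by (simp add: limitin_cadlag_metric)
      from continuous_map_limit[OF f(1) this] show ?thesis by (simp add: comp_def)
    qed
    \<comment> \<open>The tolerance is \<open>a n\<close> times a null sequence on a growing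
      interval: after division by \<open>a n\<close> the error vanishes uniformly on every fixed
      interval.\<close>
    have ev_err: "\<forall>\<^sub>F m in sequentially. \<forall>t\<in>{0..real n}. dist (riemann_sum m cdf.g H1 t) (\<Lambda> t) < a n / real (Suc n)"
      if "1 \<le> n" for n
      unfolding \<Lambda>_def
      by (rule uniform_limitD[OF hazard_lint_limit[OF cadlag_fun_g filterlim_ident]]) (use a_pos[OF that] in simp)
    \<comment> \<open>The equality of the two processes is eventual in \<open>m\<close> for each
      \<omega> separately; dominated convergence turns this into one mesh for the expectations, at
      the price that it depends on \<open>f\<close>.\<close>
    have ev_int: "\<forall>\<^sub>F m in sequentially. dist (\<integral>\<omega>. f (A n m (X n \<omega>)) \<partial>M) (\<integral>\<omega>. f (Z n \<omega>) \<partial>M) < 1 / real (Suc n)"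
      if n: "1 \<le> n" for n
    proof (rule tendstoD)
      show "(\<lambda>m. \<integral>\<omega>. f (A n m (X n \<omega>)) \<partial>M) \<longlonglongrightarrow> (\<integral>\<omega>. f (Z n \<omega>) \<partial>M)"
      proof (rule integral_dominated_convergence[where w = "\<lambda>_. C"])
        show "(\<lambda>\<omega>. f (Z n \<omega>)) \<in> borel_measurable M" by (rule measurable_compose[OF Z_meas f_meas])
        show "(\<lambda>\<omega>. f (A n m (X n \<omega>))) \<in> borel_measurable M" for m
          by (rule measurable_compose[OF measurable_compose[OF X_meas A_meas] f_meas])
        show "AE \<omega> in M. (\<lambda>m. f (A n m (X n \<omega>))) \<longlonglongrightarrow> f (Z n \<omega>)"
        proof (rule AE_I2, rule tendsto_eventually)
          show "\<forall>\<^sub>F m in sequentially. f (A n m (X n \<omega>)) = f (Z n \<omega>)" for \<omega>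
            using A_X[OF n, of \<omega>] by eventually_elim simp
        qed
        show "AE \<omega> in M. norm (f (A n m (X n \<omega>))) \<le> C" for m
          by (rule AE_I2) (use C A_cadlag X_space in simp)
      qed simp
    qed simp
    \<comment> \<open>Index 0 is exempt, because \<open>a 0\<close> may fail to be positive.\<close>
    have "\<forall>n. \<exists>m. 1 \<le> n \<longrightarrow> n \<le> m \<and>
      (\<forall>t\<in>{0..real n}. dist (riemann_sum m cdf.g H1 t) (\<Lambda> t) < a n / real (Suc n)) \<and>
      dist (\<integral>\<omega>. f (A n m (X n \<omega>)) \<partial>M) (\<integral>\<omega>. f (Z n \<omega>) \<partial>M) < 1 / real (Suc n)"
    proof
      fix n
      show "\<exists>m. 1 \<le> n \<longrightarrow> n \<le> m \<and>
        (\<forall>t\<in>{0..real n}. dist (riemann_sum m cdf.g H1 t) (\<Lambda> t) < a n / real (Suc n)) \<and>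
        dist (\<integral>\<omega>. f (A n m (X n \<omega>)) \<partial>M) (\<integral>\<omega>. f (Z n \<omega>) \<partial>M) < 1 / real (Suc n)"
      proof (cases "1 \<le> n")
        case True
        from eventually_conj[OF eventually_ge_at_top[of n] eventually_conj[OF ev_err[OF True] ev_int[OF True]]]
        show ?thesis by (auto dest!: eventually_happens)
      qed simp
    qed
    then obtain m where m: "\<And>n. 1 \<le> n \<Longrightarrow> n \<le> m n"
      and m_err: "\<And>n t. 1 \<le> n \<Longrightarrow> t \<in> {0..real n} \<Longrightarrow> dist (riemann_sum (m n) cdf.g H1 t) (\<Lambda> t) < a n / real (Suc n)"
      and m_int: "\<And>n. 1 \<le> n \<Longrightarrow> dist (\<integral>\<omega>. f (A n (m n) (X n \<omega>)) \<partial>M) (\<integral>\<omega>. f (Z n \<omega>) \<partial>M) < 1 / real (Suc n)"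
      by metis
    \<comment> \<open>The weight is 1 up to variation 1 and 0 from variation 2 on. Variation is
      measured on \<open>[0, n]\<close>, so any fixed interval is eventually covered.\<close>
    define \<rho> where "\<rho> n xx = max 0 (min 1 (2 - grid_variation (a n) (m n) n (snd xx)))" for n and xx :: "(real \<Rightarrow> real) \<times> (real \<Rightarrow> real)"
    have convD: "xx \<in> cadlag \<times> cadlag" "\<And>b. uniform_limit {0..b} (\<lambda>k. fst (z k)) (fst xx) sequentially"
      "\<And>b. uniform_limit {0..b} (\<lambda>k. snd (z k)) (snd xx) sequentially"
      if "limitin (mtopology_of ?m2) z xx sequentially" for z xx
      using that by (auto simp: limitin_max_metric limitin_cadlag_metric mem_Times_iff)
    have main: "(\<lambda>n. \<integral>\<omega>. f (A n (m n) (X n \<omega>)) \<partial>M) \<longlonglongrightarrow> (\<integral>\<omega>. f (L (w \<omega>, w1 \<omega>)) \<partial>N)"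
    proof (rule extended_continuous_mapping[OF prob_space_axioms N weak, where \<rho> = \<rho> and C = C])
      show "space ?BB = mspace ?m2" by (simp add: space_pair_ball_algebra)
      show "(\<lambda>xx. f (A n (m n) xx)) \<in> borel_measurable ?BB" for n
        by (rule measurable_compose[OF A_meas f_meas])
      show "(\<lambda>xx. f (L xx)) \<in> borel_measurable ?BB"
        by (rule measurable_compose[OF L_meas f_meas])
      show "\<rho> n \<in> borel_measurable ?BB" for n
        unfolding \<rho>_def[abs_def] using grid_variation_measurable by measurable
      show "\<bar>f (A n (m n) x)\<bar> \<le> C" "\<bar>f (L x)\<bar> \<le> C" "0 \<le> \<rho> n x" "\<rho> n x \<le> 1" if "x \<in> mspace ?m2" for n x
        using that C A_cadlag L_cadlag by (auto simp: \<rho>_def)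
      show "\<forall>\<^sub>F n in sequentially. \<forall>\<omega>\<in>space M. \<rho> n (X n \<omega>) = 1"
        using eventually_ge_at_top[of 1]
      proof eventually_elim
        case (elim n)
        show ?case
        proof
          fix \<omega>
          have eq: "H1 (grid (m n) i) + a n * snd (X n \<omega>) (grid (m n) i) = emp_unc_cdf T \<tau> n \<omega> (grid (m n) i)" for i
            by (simp add: X_def a_cancel[OF elim])
          have "grid_variation (a n) (m n) n (snd (X n \<omega>)) =
            (\<Sum>i<n * Suc (m n). emp_unc_cdf T \<tau> n \<omega> (grid (m n) (Suc i)) - emp_unc_cdf T \<tau> n \<omega> (grid (m n) i))"
            unfolding grid_variation_def eq
            by (intro sum.cong refl abs_of_nonneg) (simp add: emp_unc_cdf_mono)
          also have "\<dots> = emp_unc_cdf T \<tau> n \<omega> (grid (m n) (n * Suc (m n))) - emp_unc_cdf T \<tau> n \<omega> (grid (m n) 0)"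
            by (rule sum_lessThan_telescope)
          also have "\<dots> \<le> 1" using emp_unc_cdf_nonneg emp_unc_cdf_le_1 by (meson diff_le_eq add_increasing2 order_trans)
          finally show "\<rho> n (X n \<omega>) = 1" by (simp add: \<rho>_def)
        qed
      qed
    next
      fix n z x assume z: "limitin (mtopology_of ?m2) z x sequentially" "\<And>k. z k \<in> mspace ?m2"
      have x: "cadlag_fun (fst x)" "cadlag_fun (snd x)" and zk: "\<And>k. cadlag_fun (fst (z k))" "\<And>k. cadlag_fun (snd (z k))"
        using convD(1)[OF z(1)] z(2) by (auto simp: mem_Times_iff cadlag_iff)
      have restr: "uniform_limit {0..b} (\<lambda>k. restrict (u k) {0..}) (restrict v {0..}) sequentially"
        if "uniform_limit {0..b} u v sequentially" for b and u :: "nat \<Rightarrow> real \<Rightarrow> real" and v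
        using that by (rule uniform_limit_cong'[THEN iffD1, rotated 2]) auto
      show "(\<lambda>k. f (A n (m n) (z k))) \<longlonglongrightarrow> f (A n (m n) x)"
      proof (rule f_lim)
        show "uniform_limit {0..b} (\<lambda>k. A n (m n) (z k)) (A n (m n) x) sequentially" for b
          unfolding A_def by (intro restr approx_process_continuous x convD[OF z(1)]) simp
      qed (use A_cadlag convD(1)[OF z(1)] z(2) in auto)
      show "(\<lambda>k. f (L (z k))) \<longlonglongrightarrow> f (L x)"
      proof (rule f_lim)
        show "uniform_limit {0..b} (\<lambda>k. L (z k)) (L x) sequentially" for b
          unfolding L_def by (intro restr limit_process_continuous x zk convD[OF z(1)])
      qed (use L_cadlag convD(1)[OF z(1)] z(2) in auto)
      have pt: "(\<lambda>k. snd (z k) t) \<longlonglongrightarrow> snd x t" if "0 \<le> t" for t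
        using tendsto_uniform_limitI[OF convD(3)[OF z(1), of t], of t] that by simp
      show "(\<lambda>k. \<rho> n (z k)) \<longlonglongrightarrow> \<rho> n x"
        unfolding \<rho>_def grid_variation_def by (intro tendsto_intros pt grid_nonneg)
      fix \<nu> :: "nat \<Rightarrow> nat" assume \<nu>: "filterlim \<nu> at_top sequentially" and pos: "\<And>k. 0 < \<rho> (\<nu> k) (z k)"
      show "(\<lambda>k. f (A (\<nu> k) (m (\<nu> k)) (z k))) \<longlonglongrightarrow> f (L x)"
      proof (rule f_lim)
        fix b :: real
        obtain kb where kb: "b \<le> real kb" by (meson real_arch_simple)
        have \<nu>1: "\<forall>\<^sub>F k in sequentially. j \<le> \<nu> k" for j using \<nu> by (simp add: filterlim_at_top)
        have inv: "(\<lambda>k. 1 / real (Suc (\<nu> k))) \<longlonglongrightarrow> 0"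
          using filterlim_compose[OF lim_1_over_n[THEN LIMSEQ_Suc] \<nu>] .
        show "uniform_limit {0..b} (\<lambda>k. A (\<nu> k) (m (\<nu> k)) (z k)) (L x) sequentially"
          unfolding A_def L_def approx_process_def[abs_def]
        proof (intro restr nelson_aalen_functional_limit[where N = "\<lambda>k. kb * Suc (m (\<nu> k))"] x convD[OF z(1)] inv)
          show "(\<lambda>k. a (\<nu> k)) \<longlonglongrightarrow> 0" by (rule filterlim_compose[OF a_lim \<nu>])
          show "\<forall>\<^sub>F k in sequentially. 0 < a (\<nu> k)"
            using \<nu>1[of 1] by eventually_elim (rule a_pos)
          show "\<forall>\<^sub>F k in sequentially. 0 < 1 / real (Suc (\<nu> k))" by simp
          show "filterlim (\<lambda>k. m (\<nu> k)) sequentially sequentially"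
            by (rule filterlim_at_top_mono[OF \<nu>]) (use \<nu>1[of 1] m in \<open>auto elim: eventually_mono\<close>)
          show "b \<le> grid (m (\<nu> k)) (kb * Suc (m (\<nu> k)))" for k using kb unfolding grid_mult .
          \<comment> \<open>As soon as \<open>kb \<le> \<nu> k\<close>, this is part of the sum in
            \<open>grid_variation\<close>, which is below 2 where the weight is positive.\<close>
          show "\<forall>\<^sub>F k in sequentially. (\<Sum>i<kb * Suc (m (\<nu> k)).
             \<bar>(H1 (grid (m (\<nu> k)) (Suc i)) + a (\<nu> k) * snd (z k) (grid (m (\<nu> k)) (Suc i))) -
              (H1 (grid (m (\<nu> k)) i) + a (\<nu> k) * snd (z k) (grid (m (\<nu> k)) i))\<bar>) \<le> 2"
            using \<nu>1[of kb]
          proof eventually_elim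
            case (elim k)
            have "(\<Sum>i<kb * Suc (m (\<nu> k)).
               \<bar>(H1 (grid (m (\<nu> k)) (Suc i)) + a (\<nu> k) * snd (z k) (grid (m (\<nu> k)) (Suc i))) -
                (H1 (grid (m (\<nu> k)) i) + a (\<nu> k) * snd (z k) (grid (m (\<nu> k)) i))\<bar>)
              \<le> grid_variation (a (\<nu> k)) (m (\<nu> k)) (\<nu> k) (snd (z k))"
              unfolding grid_variation_def
              by (rule sum_mono2) (use mult_le_mono1[OF elim, of "Suc (m (\<nu> k))"] in auto)
            also have "\<dots> \<le> 2" using pos[of k] by (auto simp: \<rho>_def)
            finally show ?case .
          qed
          show "uniform_limit {0..b} (\<lambda>k t. inverse (a (\<nu> k)) * (riemann_sum (m (\<nu> k)) cdf.g H1 t - hazard_lint cdf.g t)) (\<lambda>_. 0) sequentially"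
          proof (rule uniform_limitI)
            fix e :: real assume "0 < e"
            with inv have "\<forall>\<^sub>F k in sequentially. 1 / real (Suc (\<nu> k)) < e" by (rule order_tendstoD)
            then show "\<forall>\<^sub>F k in sequentially. \<forall>t\<in>{0..b}. dist (inverse (a (\<nu> k)) *
              (riemann_sum (m (\<nu> k)) cdf.g H1 t - hazard_lint cdf.g t)) 0 < e"
              using \<nu>1[of 1] \<nu>1[of kb]
            proof eventually_elim
              case (elim k)
              show ?case
              proof
                fix t assume t: "t \<in> {0..b}"
                have "b \<le> real (\<nu> k)" using kb elim(3) by linarith
                then have "dist (riemann_sum (m (\<nu> k)) cdf.g H1 t) (\<Lambda> t) < a (\<nu> k) / real (Suc (\<nu> k))"
                  using t by (intro m_err elim(2)) auto
                then have "inverse (a (\<nu> k)) * \<bar>riemann_sum (m (\<nu> k)) cdf.g H1 t - \<Lambda> t\<bar>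
                    < inverse (a (\<nu> k)) * (a (\<nu> k) / real (Suc (\<nu> k)))"
                  using a_pos[OF elim(2)] by (intro mult_strict_left_mono) (auto simp: dist_real_def)
                also have "\<dots> = 1 / real (Suc (\<nu> k))" using a_pos[OF elim(2)] by simp
                also note elim(1)
                finally show "dist (inverse (a (\<nu> k)) * (riemann_sum (m (\<nu> k)) cdf.g H1 t - hazard_lint cdf.g t)) 0 < e"
                  using a_pos[OF elim(2)] by (simp add: dist_real_def abs_mult \<Lambda>_def)
              qed
            qed
          qed
        qed
      qed (use A_cadlag L_cadlag convD(1)[OF z(1)] z(2) in auto)
    qed
    have "(\<lambda>n. (\<integral>\<omega>. f (A n (m n) (X n \<omega>)) \<partial>M) - (\<integral>\<omega>. f (Z n \<omega>) \<partial>M)) \<longlonglongrightarrow> 0"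
    proof (rule tendsto_0_le[OF lim_1_over_n[where 'a = real, THEN LIMSEQ_Suc], where K = 1])
      show "\<forall>\<^sub>F n in sequentially. norm ((\<integral>\<omega>. f (A n (m n) (X n \<omega>)) \<partial>M) - (\<integral>\<omega>. f (Z n \<omega>) \<partial>M))
          \<le> norm (1 / real (Suc n)) * 1"
        using eventually_ge_at_top[of 1]
      proof eventually_elim
        case (elim n)
        then show ?case using m_int[OF elim] by (simp add: dist_real_def)
      qed
    qed
    from tendsto_diff[OF main this] show ?thesis by simp
  qed
  show ?thesis
    unfolding cum_hazard target Z_def[symmetric] converges_weakly_def
    using Z_meas limit measurable_compose[OF W_meas L_meas] by simp
qed

end
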